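(* Let $G$ be a finite simple graph without isolated vertices, let $K$ be a field, let $S=K[V(G)]$ be the polynomial ring whose variables are the vertices of $G$, and let $I(G)\subset S$ be the edge ideal of $G$. Then the depth function of $I(G)$ is constant if and only if the connected components of $G$ are complete bipartite graphs.
   Context: The edge ideal $I(G)$ is the ideal of $S$ generated by the monomials $xy$ for all edges $\{x,y\}$ of $G$ (vertices being identified with variables). For a proper graded ideal $L\subset S$, the depth function of $L$ is $k\mapsto \operatorname{depth} S/L^k$ for integers $k\ge 1$; it is constant if $\operatorname{depth} S/L^k=\operatorname{depth} S/L$ for all $k\ge 1$. A complete bipartite graph is one whose vertex set is a disjoint union of two nonempty sets $X$ and $Y$ and whose edges are exactly all pairs $\{x,y\}$ with $x\in X$, $y\in Y$. *)

theory Defs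
  imports
    "Graph_Theory.Graph_Theory"
    "HOL-Library.Poly_Mapping"
    "HOL-Library.Extended_Nat"
    "HOL-Algebra.Ideal_Product"
    "HOL-Algebra.QuotRing"
begin

section \<open>Polynomial rings over a field with variables in a set\<close>

text \<open>
  Exponent vectors are finitely supported maps from variables to \<^typ>\<open>nat\<close>, and polynomials are
  finitely supported maps from exponent vectors to coefficients; the multiplication of
  \<^type>\<open>poly_mapping\<close> is convolution, i.e.\ multiplication of polynomials.
\<close>

type_synonym ('v, 'k) mpoly = "('v \<Rightarrow>\<^sub>0 nat) \<Rightarrow>\<^sub>0 'k"

definition mpoly_ring :: "'v set \<Rightarrow> ('v, 'k::field) mpoly ring" where
  "mpoly_ring V =
    \<lparr>carrier = {p. \<forall>m \<in> Poly_Mapping.keys p. Poly_Mapping.keys m \<subseteq> V},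
     mult = (*), one = 1, zero = 0, add = (+)\<rparr>"

definition variable :: "'v \<Rightarrow> ('v, 'k::field) mpoly" where
  "variable v = Poly_Mapping.single (Poly_Mapping.single v 1) 1"

definition graded_maximal_ideal :: "'v set \<Rightarrow> ('v, 'k::field) mpoly set" where
  "graded_maximal_ideal V = Idl\<^bsub>mpoly_ring V\<^esub> (variable ` V)"

lemma cring_mpoly_ring: "cring (mpoly_ring V :: ('v, 'k::field) mpoly ring)"
proof -
  let ?S = "mpoly_ring V :: ('v, 'k) mpoly ring"
  have keys_times: "p * q \<in> carrier ?S" if "p \<in> carrier ?S" "q \<in> carrier ?S" for p q
  proof -
    have "Poly_Mapping.keys m \<subseteq> V" if m: "m \<in> Poly_Mapping.keys (p * q)" for m
    proof -
      obtain a b where "m = a + b" "a \<in> Poly_Mapping.keys p" "b \<in> Poly_Mapping.keys q"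
        using m keys_mult[of p q] by auto
      then show ?thesis
        using that \<open>p \<in> carrier ?S\<close> \<open>q \<in> carrier ?S\<close> Poly_Mapping.keys_add[of a b]
        unfolding mpoly_ring_def by fastforce
    qed
    then show ?thesis by (simp add: mpoly_ring_def)
  qed
  have keys_plus: "p + q \<in> carrier ?S" if "p \<in> carrier ?S" "q \<in> carrier ?S" for p q
    using that Poly_Mapping.keys_add[of p q] by (simp add: mpoly_ring_def) blast
  have keys_neg: "- p \<in> carrier ?S" if "p \<in> carrier ?S" for p
    using that by (simp add: mpoly_ring_def)
  have ops [simp]: "x \<otimes>\<^bsub>?S\<^esub> y = x * y" "x \<oplus>\<^bsub>?S\<^esub> y = x + y"
    "\<one>\<^bsub>?S\<^esub> = 1" "\<zero>\<^bsub>?S\<^esub> = 0" for x y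
    by (simp_all add: mpoly_ring_def)
  have closed01: "0 \<in> carrier ?S" "1 \<in> carrier ?S"
    by (simp_all add: mpoly_ring_def)
  show ?thesis
  proof (intro cringI abelian_groupI comm_monoidI)
    fix p assume "p \<in> carrier ?S"
    then show "\<exists>q\<in>carrier ?S. q \<oplus>\<^bsub>?S\<^esub> p = \<zero>\<^bsub>?S\<^esub>"
      using keys_neg by (intro bexI[of _ "- p"]) simp_all
  qed (simp_all add: keys_times keys_plus closed01 algebra_simps)
qed


section \<open>Depth\<close>

text \<open>The element \<open>f\<close> acts injectively on the \<open>R\<close>-module \<open>R/J\<close>.\<close>

definition regular_element :: "('a, 'b) ring_scheme \<Rightarrow> 'a set \<Rightarrow> 'a \<Rightarrow> bool" where
  "regular_element R J f \<longleftrightarrow>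
    (\<forall>X \<in> carrier (R Quot J).
       (J +>\<^bsub>R\<^esub> f) \<otimes>\<^bsub>R Quot J\<^esub> X = \<zero>\<^bsub>R Quot J\<^esub> \<longrightarrow> X = \<zero>\<^bsub>R Quot J\<^esub>)"

text \<open>
  The sequence \<open>f\<^sub>1, \<dots>, f\<^sub>r\<close> is regular on \<open>M = R/J\<close>: every \<open>f\<^sub>i\<close> is a nonzerodivisor on
  \<open>M/(f\<^sub>1, \<dots>, f\<^sub>i\<^sub>-\<^sub>1)M = R/(J + (f\<^sub>1, \<dots>, f\<^sub>i\<^sub>-\<^sub>1))\<close>, and \<open>M \<noteq> (f\<^sub>1, \<dots>, f\<^sub>r)M\<close>.
\<close>

definition regular_sequence :: "('a, 'b) ring_scheme \<Rightarrow> 'a set \<Rightarrow> 'a list \<Rightarrow> bool" where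
  "regular_sequence R J fs \<longleftrightarrow>
    set fs \<subseteq> carrier R \<and>
    (\<forall>i < length fs. regular_element R (Idl\<^bsub>R\<^esub> (J \<union> set (take i fs))) (fs ! i)) \<and>
    Idl\<^bsub>R\<^esub> (J \<union> set fs) \<noteq> carrier R"

text \<open>
  The depth of \<open>R/J\<close> with respect to \<open>\<mm>\<close>: the supremum of the lengths of the regular sequences
  on \<open>R/J\<close> with members in \<open>\<mm>\<close>.
\<close>

definition depth_quotient :: "('a, 'b) ring_scheme \<Rightarrow> 'a set \<Rightarrow> 'a set \<Rightarrow> enat" where
  "depth_quotient R \<mm> J = Sup {enat (length fs) |fs. set fs \<subseteq> \<mm> \<and> regular_sequence R J fs}"

text \<open>
  The power of an ideal is the monoid power in \<^const>\<open>ideals_set\<close>, whose multiplication is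
  the product of ideals.
\<close>

definition depth_function :: "'v set \<Rightarrow> ('v, 'k::field) mpoly set \<Rightarrow> nat \<Rightarrow> enat" where
  "depth_function V L k =
    depth_quotient (mpoly_ring V) (graded_maximal_ideal V)
      (L [^]\<^bsub>ideals_set (mpoly_ring V)\<^esub> k)"

definition constant_depth_function :: "'v set \<Rightarrow> ('v, 'k::field) mpoly set \<Rightarrow> bool" where
  "constant_depth_function V L \<longleftrightarrow>
    (\<forall>k \<ge> 1. depth_function V L k =
       depth_quotient (mpoly_ring V) (graded_maximal_ideal V) L)"


section \<open>Graphs\<close>

text \<open>
  A finite simple graph is given by the locale \<^locale>\<open>graph\<close>: a finite symmetric digraph
  without loops and parallel arcs, so that an edge \<open>{u, v}\<close> is a pair of opposite arcs. The strongly
  connected components \<^const>\<open>pre_digraph.sccs\<close> of such a digraph are the connected components of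
  the graph.
\<close>

definition no_isolated_vertices :: "('v, 'e) pre_digraph \<Rightarrow> bool" where
  "no_isolated_vertices G \<longleftrightarrow> (\<forall>u \<in> verts G. \<exists>v. u \<rightarrow>\<^bsub>G\<^esub> v)"

definition edge_ideal :: "('v, 'e) pre_digraph \<Rightarrow> ('v, 'k::field) mpoly set" where
  "edge_ideal G =
    Idl\<^bsub>mpoly_ring (verts G)\<^esub> {variable u * variable v |u v. u \<rightarrow>\<^bsub>G\<^esub> v}"

definition complete_bipartite :: "('v, 'e) pre_digraph \<Rightarrow> bool" where
  "complete_bipartite H \<longleftrightarrow> (\<exists>m > 0. \<exists>n > 0. complete_bipartite_digraph m n H)"

end

theory Submission
  imports Defs
begin

text \<open>
  Upper bound: if there is a regular sequence of length greater than \<open>i\<close> on \<open>S/J\<close>, every Koszul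
  \<open>i\<close>-cocycle of the variables with values in \<open>S/J\<close> is a coboundary. For each bipartite component
  with parts \<open>X\<close>, \<open>Y\<close> take the 1-cochain that is \<open>v \<mapsto> v\<close> on \<open>X\<close> and zero elsewhere. Let \<open>u\<close> be a
  product of \<open>e\<close> edges such that \<open>u v w \<in> I\<^sup>e\<^sup>+\<^sup>1\<close> whenever \<open>v\<close> and \<open>w\<close> are joined by a walk of odd length.
  Then \<open>u\<close> times one vertex of each nonbipartite component times the wedge of these cochains is a
  cocycle modulo \<open>I\<^sup>e\<^sup>+\<^sup>1\<close> but not a coboundary, so \<open>depth S/I\<^sup>e\<^sup>+\<^sup>1\<close> is at most the number of bipartite
  components. Such a \<open>u\<close> exists for some \<open>e\<close>, and if all components are complete bipartite then every
  product of edges will do.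

  Lower bound: the sums of the variables of the components form a regular sequence on \<open>S/I\<close>, and on
  \<open>S/I\<^sup>k\<close> for all \<open>k\<close> if the components are complete bipartite. So constancy forces all components to
  be bipartite. A bipartite component that is not complete has a connected independence complex, and
  then a sum of powers of its variables with distinct exponents is a further regular element.
\<close>

text \<open>Depth is a supremum over regular sequences: a lower bound is one explicit sequence, but
  an upper bound must exclude every longer one. For this it suffices that Koszul cocycles below the
  length of a regular sequence are coboundaries, which has an elementary proof by a contracting
  homotopy. That the wedge is no coboundary is seen by evaluating it on a product of cycles
  \<open>x - y\<close>, with \<open>x\<close> the root of a bipartite component and \<open>y\<close>
  a neighbour. This leaves the claim that \<open>u\<close> times certain vertices is not in
  \<open>I^(e+1)\<close>, which a counting function on monomials decides. In a nonbipartite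
  component every vertex is joined to the chosen one by an odd walk, so the chosen vertex makes all
  variables of its component kill the product. No limit of depths is computed: with \<open>c\<close>
  components, \<open>b\<close> of them bipartite, constancy gives
  \<open>c \<le> depth S/I = depth S/I^(e+1) \<le> b\<close>. The field may be finite, so a linear
  form with distinct coefficients at the vertices of a component need not exist; distinct exponents
  take their place, because two powers of different degree cannot cancel once a variable is
  eliminated by the first form.\<close>

abbreviation lookup :: "('a \<Rightarrow>\<^sub>0 'b::zero) \<Rightarrow> 'a \<Rightarrow> 'b" where
  "lookup \<equiv> Poly_Mapping.lookup"

abbreviation keys :: "('a \<Rightarrow>\<^sub>0 'b::zero) \<Rightarrow> 'a set" where
  "keys \<equiv> Poly_Mapping.keys"

abbreviation single :: "'a \<Rightarrow> 'b \<Rightarrow> ('a \<Rightarrow>\<^sub>0 'b::zero)" where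
  "single \<equiv> Poly_Mapping.single"

abbreviation xv :: "'v \<Rightarrow> ('v \<Rightarrow>\<^sub>0 nat)" where
  "xv v \<equiv> Poly_Mapping.single v (Suc 0)"

section \<open>Polynomials and their coefficients\<close>

definition Pol :: "'v set \<Rightarrow> ('v, 'k::field) mpoly set" where
  "Pol V = {p. \<forall>m\<in>keys p. keys m \<subseteq> V}"

lemma poly_mapping_sum_single: "(\<Sum>m\<in>keys p. single m (lookup p m)) = p"
  by (rule poly_mapping_eqI)
    (auto simp: lookup_sum lookup_single when_def in_keys_iff)

lemma mpoly_induct [case_names zero add]:
  fixes p :: "('a \<Rightarrow>\<^sub>0 'b::comm_monoid_add)"
  assumes "P 0" and "\<And>m c q. P q \<Longrightarrow> P (single m c + q)"
  shows "P p"
proof -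
  have "P (\<Sum>m\<in>A. single m (lookup p m))" if "finite A" for A
    using that by induction (auto intro: assms)
  from this[of "keys p"] show ?thesis
    by (simp add: poly_mapping_sum_single)
qed

lemma lookup_single_times:
  fixes p :: "('v, 'k::field) mpoly"
  shows "lookup (single a c * p) m = (if \<exists>k. m = a + k then c * lookup p (m - a) else 0)"
proof (induction p rule: mpoly_induct)
  case (add n d q)
  have *: "lookup (single (a + n) (c * d)) m = (if \<exists>k. m = a + k then c * lookup (single n d) (m - a) else 0)"
    by (cases "m = a + n") (auto simp: lookup_single when_def)
  show ?case
    using add * by (auto simp: distrib_left mult_single lookup_add)
qed simp

lemma lookup_single_times_add [simp]:
  fixes p :: "('v, 'k::field) mpoly"
  shows "lookup (single a c * p) (a + m) = c * lookup p m"
  by (auto simp: lookup_single_times)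

lemma xv_split: "lookup m v > 0 \<longleftrightarrow> (\<exists>k. m = xv v + k)"
proof
  assume "lookup m v > 0"
  then have "m = xv v + (m - xv v)"
    by (intro poly_mapping_eqI) (auto simp: lookup_add lookup_minus lookup_single when_def)
  then show "\<exists>k. m = xv v + k" by blast
qed (auto simp: lookup_add)

lemma xv_minus_add: "lookup m v > 0 \<Longrightarrow> xv v + (m - xv v) = m"
  by (auto simp: xv_split)

lemma lookup_variable_times:
  fixes p :: "('v, 'k::field) mpoly"
  shows "lookup (variable v * p) m = (if lookup m v > 0 then lookup p (m - xv v) else 0)"
  unfolding variable_def lookup_single_times xv_split by simp

lemma lookup_variable_times_add [simp]:
  fixes p :: "('v, 'k::field) mpoly"
  shows "lookup (variable v * p) (xv v + m) = lookup p m"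
  by (simp add: variable_def)

lemma keys_variable_times:
  fixes p :: "('v, 'k::field) mpoly"
  shows "keys (variable v * p) = (\<lambda>m. xv v + m) ` keys p"
proof -
  have "m \<in> keys (variable v * p) \<longleftrightarrow> m \<in> (\<lambda>m. xv v + m) ` keys p" for m
  proof
    assume "m \<in> keys (variable v * p)"
    then have "lookup m v > 0" "lookup p (m - xv v) \<noteq> 0"
      by (auto simp: in_keys_iff lookup_variable_times split: if_splits)
    then show "m \<in> (\<lambda>m. xv v + m) ` keys p"
      by (intro image_eqI[of _ _ "m - xv v"]) (auto simp: xv_minus_add in_keys_iff simp del: One_nat_def)
  qed (auto simp: in_keys_iff)
  then show ?thesis by blast
qed

subsection \<open>Ideals\<close>

lemma carrier_mpoly_ring [simp]: "carrier (mpoly_ring V) = Pol V"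
  and mult_mpoly_ring [simp]: "x \<otimes>\<^bsub>mpoly_ring V\<^esub> y = x * y"
  and add_mpoly_ring [simp]: "x \<oplus>\<^bsub>mpoly_ring V\<^esub> y = x + y"
  and one_mpoly_ring [simp]: "\<one>\<^bsub>mpoly_ring V\<^esub> = 1"
  and zero_mpoly_ring [simp]: "\<zero>\<^bsub>mpoly_ring V\<^esub> = 0"
  by (simp_all add: mpoly_ring_def Pol_def)

lemma ring_mpoly_ring: "ring (mpoly_ring V)"
  by (rule cring.axioms(1)[OF cring_mpoly_ring])

lemma
  fixes p q :: "('v, 'k::field) mpoly"
  shows Pol_add [intro]: "p \<in> Pol V \<Longrightarrow> q \<in> Pol V \<Longrightarrow> p + q \<in> Pol V"
    and Pol_mult [intro]: "p \<in> Pol V \<Longrightarrow> q \<in> Pol V \<Longrightarrow> p * q \<in> Pol V"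
    and Pol_zero [intro, simp]: "(0 :: ('v, 'k) mpoly) \<in> Pol V"
    and Pol_one [intro, simp]: "(1 :: ('v, 'k) mpoly) \<in> Pol V"
proof -
  interpret cring "mpoly_ring V :: ('v, 'k) mpoly ring" by (rule cring_mpoly_ring)
  show "p \<in> Pol V \<Longrightarrow> q \<in> Pol V \<Longrightarrow> p + q \<in> Pol V"
    "p \<in> Pol V \<Longrightarrow> q \<in> Pol V \<Longrightarrow> p * q \<in> Pol V"
    "(0 :: ('v, 'k) mpoly) \<in> Pol V" "(1 :: ('v, 'k) mpoly) \<in> Pol V"
    using a_closed m_closed zero_closed one_closed by simp_all
qed

lemma Pol_uminus [intro]: "p \<in> Pol V \<Longrightarrow> - p \<in> Pol V" for p :: "('v, 'k::field) mpoly"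
  by (simp add: Pol_def)

lemma Pol_minus [intro]: "p \<in> Pol V \<Longrightarrow> q \<in> Pol V \<Longrightarrow> p - q \<in> Pol V"
  for p :: "('v, 'k::field) mpoly"
  using Pol_add[of p V "- q"] by auto

lemma Pol_sum [intro]: "(\<And>i. i \<in> A \<Longrightarrow> f i \<in> Pol V) \<Longrightarrow> sum f A \<in> Pol V"
  for f :: "'i \<Rightarrow> ('v, 'k::field) mpoly"
  by (induction A rule: infinite_finite_induct) auto

lemma Pol_power [intro]: "p \<in> Pol V \<Longrightarrow> p ^ n \<in> Pol V" for p :: "('v, 'k::field) mpoly"
  by (induction n) auto

lemma Pol_single [intro]: "keys m \<subseteq> V \<Longrightarrow> single m c \<in> Pol V" for c :: "'k::field"
  by (auto simp: Pol_def)

lemma Pol_variable [intro]: "v \<in> V \<Longrightarrow> (variable v :: ('v, 'k::field) mpoly) \<in> Pol V"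
  by (auto simp: variable_def intro!: Pol_single)

text \<open>Ideals in terms of the type class operations, so that the simplifier's ring
  normalisation applies to their members; \<open>ideal_iff_pideal\<close> is the bridge to the
  library notion.\<close>

definition pideal :: "'v set \<Rightarrow> ('v, 'k::field) mpoly set \<Rightarrow> bool" where
  "pideal V Q \<longleftrightarrow> Q \<subseteq> Pol V \<and> 0 \<in> Q \<and> (\<forall>p\<in>Q. \<forall>q\<in>Q. p + q \<in> Q) \<and> (\<forall>p\<in>Pol V. \<forall>q\<in>Q. p * q \<in> Q)"

lemma
  fixes Q :: "('v, 'k::field) mpoly set"
  assumes "pideal V Q"
  shows pideal_Pol: "p \<in> Q \<Longrightarrow> p \<in> Pol V"
    and pideal_zero: "0 \<in> Q"
    and pideal_add: "p \<in> Q \<Longrightarrow> q \<in> Q \<Longrightarrow> p + q \<in> Q"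
    and pideal_mult: "r \<in> Pol V \<Longrightarrow> p \<in> Q \<Longrightarrow> r * p \<in> Q"
  using assms by (auto simp: pideal_def)

lemma pideal_uminus: "pideal V Q \<Longrightarrow> p \<in> Q \<Longrightarrow> - p \<in> Q"
  using pideal_mult[of V Q "- 1" p] by auto

lemma pideal_minus: "pideal V Q \<Longrightarrow> p \<in> Q \<Longrightarrow> q \<in> Q \<Longrightarrow> p - q \<in> Q"
  using pideal_add[of V Q p "- q"] pideal_uminus[of V Q q] by simp

lemma pideal_sum: "pideal V Q \<Longrightarrow> (\<And>i. i \<in> A \<Longrightarrow> f i \<in> Q) \<Longrightarrow> sum f A \<in> Q"
  by (induction A rule: infinite_finite_induct) (auto intro: pideal_add pideal_zero)

lemma pideal_diff_cancel: "pideal V Q \<Longrightarrow> p - q \<in> Q \<Longrightarrow> q \<in> Q \<Longrightarrow> p \<in> Q"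
  using pideal_add[of V Q "p - q" q] by simp

lemma ideal_iff_pideal: "ideal Q (mpoly_ring V) \<longleftrightarrow> pideal V Q"
proof
  assume "ideal Q (mpoly_ring V)"
  then interpret ideal Q "mpoly_ring V" .
  show "pideal V Q"
    using Icarr additive_subgroup.a_closed[OF is_additive_subgroup]
      additive_subgroup.zero_closed[OF is_additive_subgroup] I_l_closed
    by (auto simp: pideal_def)
next
  assume Q: "pideal V Q"
  interpret cring "mpoly_ring V" by (rule cring_mpoly_ring)
  have neg: "\<ominus>\<^bsub>mpoly_ring V\<^esub> p = - p" if "p \<in> Pol V" for p
    using that minus_equality[of "- p" p] by auto
  show "ideal Q (mpoly_ring V)"
  proof (intro idealI ring_axioms subgroup.intro)
    fix a assume "a \<in> Q"
    then show "inv\<^bsub>add_monoid (mpoly_ring V)\<^esub> a \<in> Q"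
      using neg[of a] pideal_uminus[OF Q] pideal_Pol[OF Q] by (simp add: a_inv_def)
  next
    fix a x :: "('a, 'b) mpoly" assume "a \<in> Q" "x \<in> carrier (mpoly_ring V)"
    then show "a \<otimes>\<^bsub>mpoly_ring V\<^esub> x \<in> Q"
      using pideal_mult[OF Q, of x a] by (simp add: mult.commute)
  qed (use Q in \<open>auto simp: pideal_def\<close>)
qed

lemma pideal_Idl: "A \<subseteq> Pol V \<Longrightarrow> pideal V (Idl\<^bsub>mpoly_ring V\<^esub> A)"
  using ring.genideal_ideal[OF ring_mpoly_ring, of A V] by (simp add: ideal_iff_pideal)

lemma Idl_superset: "A \<subseteq> Pol V \<Longrightarrow> A \<subseteq> Idl\<^bsub>mpoly_ring V\<^esub> A"
  using ring.genideal_self[OF ring_mpoly_ring, of A V] by simp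

lemma Idl_minimal: "pideal V Q \<Longrightarrow> A \<subseteq> Q \<Longrightarrow> Idl\<^bsub>mpoly_ring V\<^esub> A \<subseteq> Q"
  using ring.genideal_minimal[OF ring_mpoly_ring, of Q V A] by (simp add: ideal_iff_pideal)

text \<open>The ideal \<open>Q + (f)\<close>, given by a cofactor \<open>g\<close> modulo
  \<open>Q\<close>: the Koszul and multidegree arguments manipulate this cofactor directly.\<close>

definition ideal_adjoin :: "'v set \<Rightarrow> ('v, 'k::field) mpoly set \<Rightarrow> ('v, 'k) mpoly \<Rightarrow> ('v, 'k) mpoly set" where
  "ideal_adjoin V Q f = {p \<in> Pol V. \<exists>g\<in>Pol V. p - g * f \<in> Q}"

lemma pideal_adjoin:
  fixes Q :: "('v, 'k::field) mpoly set"
  assumes "pideal V Q" and "f \<in> Pol V"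
  shows "pideal V (ideal_adjoin V Q f)"
  unfolding pideal_def
proof (intro conjI ballI)
  show "0 \<in> ideal_adjoin V Q f"
    using pideal_zero[OF assms(1)] by (auto simp: ideal_adjoin_def intro!: bexI[of _ 0])
next
  fix p q assume "p \<in> ideal_adjoin V Q f" "q \<in> ideal_adjoin V Q f"
  then obtain g h where "p \<in> Pol V" "q \<in> Pol V" "g \<in> Pol V" "h \<in> Pol V" "p - g * f \<in> Q" "q - h * f \<in> Q"
    by (auto simp: ideal_adjoin_def)
  moreover from this have "(p + q) - (g + h) * f \<in> Q"
    using pideal_add[OF assms(1), of "p - g * f" "q - h * f"] by (simp add: algebra_simps)
  ultimately show "p + q \<in> ideal_adjoin V Q f"
    by (auto simp: ideal_adjoin_def intro!: bexI[of _ "g + h"])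
next
  fix r p :: "('v, 'k) mpoly" assume "r \<in> Pol V" "p \<in> ideal_adjoin V Q f"
  then obtain g where "p \<in> Pol V" "g \<in> Pol V" "p - g * f \<in> Q"
    by (auto simp: ideal_adjoin_def)
  moreover from this have "r * p - (r * g) * f \<in> Q"
    using pideal_mult[OF assms(1) \<open>r \<in> Pol V\<close>, of "p - g * f"] by (simp add: algebra_simps)
  ultimately show "r * p \<in> ideal_adjoin V Q f"
    using \<open>r \<in> Pol V\<close> by (auto simp: ideal_adjoin_def intro!: bexI[of _ "r * g"])
qed (auto simp: ideal_adjoin_def)

lemma ideal_adjoin_superset: "pideal V Q \<Longrightarrow> Q \<subseteq> ideal_adjoin V Q f"
  using pideal_Pol[of V Q] by (auto simp: ideal_adjoin_def intro!: bexI[of _ 0])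

lemma ideal_adjoin_gen: "pideal V Q \<Longrightarrow> f \<in> Pol V \<Longrightarrow> f \<in> ideal_adjoin V Q f"
  using pideal_zero[of V Q] by (auto simp: ideal_adjoin_def intro!: bexI[of _ 1])

lemma ideal_adjoin_minimal:
  assumes "pideal V P" "Q \<subseteq> P" "f \<in> P"
  shows "ideal_adjoin V Q f \<subseteq> P"
proof
  fix p assume "p \<in> ideal_adjoin V Q f"
  then obtain g where "g \<in> Pol V" "p - g * f \<in> Q" by (auto simp: ideal_adjoin_def)
  then show "p \<in> P"
    using assms pideal_mult[OF assms(1), of g f] pideal_diff_cancel[OF assms(1), of p "g * f"] by blast
qed

lemma Idl_adjoin:
  assumes "pideal V Q" "f \<in> Pol V" "A \<subseteq> Pol V"
  shows "Idl\<^bsub>mpoly_ring V\<^esub> (Q \<union> insert f A) = Idl\<^bsub>mpoly_ring V\<^esub> (ideal_adjoin V Q f \<union> A)"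
proof
  have Q: "Q \<subseteq> Pol V" and Qf: "ideal_adjoin V Q f \<subseteq> Pol V"
    using assms(1) by (auto simp: pideal_def ideal_adjoin_def)
  have 1: "pideal V (Idl\<^bsub>mpoly_ring V\<^esub> (ideal_adjoin V Q f \<union> A))"
    "ideal_adjoin V Q f \<union> A \<subseteq> Idl\<^bsub>mpoly_ring V\<^esub> (ideal_adjoin V Q f \<union> A)"
    using Qf assms(3) by (intro pideal_Idl Idl_superset; blast)+
  show "Idl\<^bsub>mpoly_ring V\<^esub> (Q \<union> insert f A) \<subseteq> Idl\<^bsub>mpoly_ring V\<^esub> (ideal_adjoin V Q f \<union> A)"
    using 1 ideal_adjoin_superset[OF assms(1)] ideal_adjoin_gen[OF assms(1,2)]
    by (intro Idl_minimal) auto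
  have 2: "pideal V (Idl\<^bsub>mpoly_ring V\<^esub> (Q \<union> insert f A))"
    "Q \<union> insert f A \<subseteq> Idl\<^bsub>mpoly_ring V\<^esub> (Q \<union> insert f A)"
    using Q assms(2,3) by (intro pideal_Idl Idl_superset; blast)+
  then have "ideal_adjoin V Q f \<subseteq> Idl\<^bsub>mpoly_ring V\<^esub> (Q \<union> insert f A)"
    by (intro ideal_adjoin_minimal) auto
  then show "Idl\<^bsub>mpoly_ring V\<^esub> (ideal_adjoin V Q f \<union> A) \<subseteq> Idl\<^bsub>mpoly_ring V\<^esub> (Q \<union> insert f A)"
    using 2 by (intro Idl_minimal) auto
qed

lemma Idl_pideal: "pideal V Q \<Longrightarrow> Idl\<^bsub>mpoly_ring V\<^esub> Q = Q"
  using Idl_minimal[of V Q Q] Idl_superset[of Q V] by (auto simp: pideal_def)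

subsection \<open>Regular sequences\<close>

definition nonzerodivisor :: "'v set \<Rightarrow> ('v, 'k::field) mpoly set \<Rightarrow> ('v, 'k) mpoly \<Rightarrow> bool" where
  "nonzerodivisor V Q f \<longleftrightarrow> (\<forall>p\<in>Pol V. f * p \<in> Q \<longrightarrow> p \<in> Q)"

lemma regular_element_iff:
  assumes Q: "pideal V Q" and f: "f \<in> Pol V"
  shows "regular_element (mpoly_ring V) Q f \<longleftrightarrow> nonzerodivisor V Q f"
proof -
  interpret ideal Q "mpoly_ring V" using Q by (simp add: ideal_iff_pideal)
  have *: "(Q +>\<^bsub>mpoly_ring V\<^esub> p = Q) = (p \<in> Q)" if "p \<in> Pol V" for p
    using that a_rcos_const[of p] a_rcos_self[of p] by auto
  have "regular_element (mpoly_ring V) Q f \<longleftrightarrow>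
    (\<forall>p\<in>Pol V. Q +>\<^bsub>mpoly_ring V\<^esub> (f * p) = Q \<longrightarrow> Q +>\<^bsub>mpoly_ring V\<^esub> p = Q)"
    using f by (auto simp: regular_element_def FactRing_def A_RCOSETS_def' rcoset_mult_add)
  also have "\<dots> \<longleftrightarrow> nonzerodivisor V Q f"
    using * Pol_mult[OF f] by (simp add: nonzerodivisor_def)
  finally show ?thesis .
qed

text \<open>Regularity peeled off from the head: the remaining sequence is regular over a larger
  ideal, so inductions on the sequence generalise over \<open>Q\<close>. The base case
  \<open>1 \<notin> Q\<close> becomes properness of the ideal generated by all members.\<close>

fun rseq :: "'v set \<Rightarrow> ('v, 'k::field) mpoly set \<Rightarrow> ('v, 'k) mpoly list \<Rightarrow> bool" where
  "rseq V Q [] \<longleftrightarrow> 1 \<notin> Q"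
| "rseq V Q (f # fs) \<longleftrightarrow> f \<in> Pol V \<and> nonzerodivisor V Q f \<and> rseq V (ideal_adjoin V Q f) fs"

lemma regular_sequence_iff:
  "pideal V Q \<Longrightarrow> regular_sequence (mpoly_ring V) Q fs \<longleftrightarrow> rseq V Q fs"
proof (induction fs arbitrary: Q)
  case Nil
  have "Q \<noteq> Pol V \<longleftrightarrow> 1 \<notin> Q"
    using pideal_Pol[OF Nil] pideal_mult[OF Nil, of _ 1] by fastforce
  then show ?case using Idl_pideal[OF Nil] by (simp add: regular_sequence_def)
next
  case (Cons f fs)
  let ?R = "mpoly_ring V :: ('a, 'b) mpoly ring"
  show ?case
  proof (cases "set (f # fs) \<subseteq> Pol V")
    case True
    then have f: "f \<in> Pol V" and fs: "set fs \<subseteq> Pol V" by auto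
    have "set (take i fs) \<subseteq> Pol V" for i
      using fs set_take_subset[of i fs] by blast
    note Idl_eq = Idl_adjoin[OF Cons.prems f this] Idl_adjoin[OF Cons.prems f fs]
    have "regular_sequence ?R Q (f # fs) \<longleftrightarrow>
      regular_element ?R Q f \<and> regular_sequence ?R (ideal_adjoin V Q f) fs"
      using True by (simp add: regular_sequence_def All_less_Suc2 Idl_eq[simplified Un_insert_right] Idl_pideal[OF Cons.prems])
    then show ?thesis
      using Cons.IH[OF pideal_adjoin[OF Cons.prems f]] regular_element_iff[OF Cons.prems f] f
      by simp
  next
    case False
    have "set gs \<subseteq> Pol V" if "rseq V P gs" for P :: "('a, 'b) mpoly set" and gs
      using that by (induction gs arbitrary: P) auto
    then show ?thesis using False by (auto simp: regular_sequence_def)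
  qed
qed

subsection \<open>Monomial ideals\<close>

text \<open>A monomial ideal is encoded by the predicate of its exponent vectors; it is an ideal as
  soon as the predicate is closed under multiplication (\<open>upset\<close>). Ideal membership
  thereby becomes a question about single exponents.\<close>

definition mon :: "'v set \<Rightarrow> (('v \<Rightarrow>\<^sub>0 nat) \<Rightarrow> bool) \<Rightarrow> ('v, 'k::field) mpoly set" where
  "mon V M = {p \<in> Pol V. \<forall>m\<in>keys p. M m}"

definition upset :: "(('v \<Rightarrow>\<^sub>0 nat) \<Rightarrow> bool) \<Rightarrow> bool" where
  "upset M \<longleftrightarrow> (\<forall>m n. M m \<longrightarrow> M (n + m))"

lemma upset_add: "upset M \<Longrightarrow> M m \<Longrightarrow> M (n + m)"
  and upset_add': "upset M \<Longrightarrow> M m \<Longrightarrow> M (m + n)"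
  by (auto simp: upset_def add.commute)

lemma pideal_mon: "upset M \<Longrightarrow> pideal V (mon V M :: ('v, 'k::field) mpoly set)"
  using Poly_Mapping.keys_add keys_mult
  unfolding pideal_def mon_def by (fastforce simp: upset_add)

lemma mon_iff: "p \<in> Pol V \<Longrightarrow> p \<in> mon V M \<longleftrightarrow> (\<forall>m. lookup p m \<noteq> 0 \<longrightarrow> M m)"
  by (auto simp: mon_def in_keys_iff)

lemma mon_lookup: "p \<in> mon V M \<Longrightarrow> \<not> M m \<Longrightarrow> lookup p m = 0"
  by (auto simp: mon_def in_keys_iff)

lemma mon_single: "M m \<Longrightarrow> keys m \<subseteq> V \<Longrightarrow> single m c \<in> mon V M"
  by (auto simp: mon_def intro: Pol_single)

lemma mon_eqI: "(\<And>m. keys m \<subseteq> V \<Longrightarrow> M m \<longleftrightarrow> N m) \<Longrightarrow> mon V M = mon V N"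
  by (auto simp: mon_def Pol_def)

lemma ideal_prod_mon:
  assumes "upset A" "upset B"
  shows "mon V A \<cdot>\<^bsub>mpoly_ring V\<^esub> mon V B =
    (mon V (\<lambda>m. \<exists>a b. A a \<and> B b \<and> m = a + b) :: ('v, 'k::field) mpoly set)"
    (is "?P = mon V ?C")
proof
  have up: "upset ?C"
    using assms unfolding upset_def by (metis add.assoc)
  note C = pideal_mon[OF up, of V, where 'k = 'k]
  show "?P \<subseteq> mon V ?C"
  proof
    fix p assume "p \<in> ?P"
    then show "p \<in> mon V ?C"
    proof induction
      case (prod i j)
      then have "i * j \<in> Pol V" by (auto simp: mon_def)
      moreover have "?C m" if "m \<in> keys (i * j)" for m
        using that keys_mult[of i j] prod unfolding mon_def by blast
      ultimately show ?case by (auto simp: mon_def)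
    next
      case (sum s1 s2)
      then show ?case using pideal_add[OF C] by simp
    qed
  qed
  have P: "pideal V (mon V A \<cdot>\<^bsub>mpoly_ring V\<^esub> mon V B :: ('v, 'k) mpoly set)"
    unfolding ideal_iff_pideal[symmetric]
    by (intro ring.ideal_prod_is_ideal[OF ring_mpoly_ring] ideal_iff_pideal[THEN iffD2] pideal_mon assms)
  show "mon V ?C \<subseteq> ?P"
  proof
    fix p :: "('v, 'k) mpoly" assume p: "p \<in> mon V ?C"
    have "single m (lookup p m) \<in> ?P" if m: "m \<in> keys p" for m
    proof -
      obtain a b where ab: "A a" "B b" "m = a + b" using p m by (auto simp: mon_def)
      have "keys (a + b) \<subseteq> V" using p m ab by (auto simp: mon_def Pol_def)
      \<comment> \<open>Natural exponents cannot cancel, so both factors of a monomial in the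
        variables \<open>V\<close> again involve only variables of \<open>V\<close>.\<close>
      moreover have "keys a \<subseteq> keys (a + b)" "keys b \<subseteq> keys (a + b)"
        by (auto simp: in_keys_iff lookup_add)
      ultimately have "(single a (lookup p m) :: ('v, 'k) mpoly) \<in> mon V A"
        "(single b 1 :: ('v, 'k) mpoly) \<in> mon V B"
        using ab by (auto intro!: mon_single)
      then have "single a (lookup p m) \<otimes>\<^bsub>mpoly_ring V\<^esub> single b 1 \<in> ?P"
        by (rule ideal_prod.prod)
      then show ?thesis using ab by (simp add: mult_single)
    qed
    then have "(\<Sum>m\<in>keys p. single m (lookup p m)) \<in> ?P"
      by (intro pideal_sum[OF P])
    then show "p \<in> ?P" by (simp add: poly_mapping_sum_single)
  qed
qed

subsection \<open>The graded maximal ideal\<close>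

lemma pideal_constant_term: "pideal V {p :: ('v, 'k::field) mpoly. p \<in> Pol V \<and> lookup p 0 = 0}"
proof -
  have "{p :: ('v, 'k) mpoly. p \<in> Pol V \<and> lookup p 0 = 0} = mon V (\<lambda>m. m \<noteq> 0)"
    by (auto simp: mon_def in_keys_iff)
  moreover have "upset (\<lambda>m :: 'v \<Rightarrow>\<^sub>0 nat. m \<noteq> 0)"
    by (auto simp: upset_def poly_mapping_eq_iff lookup_add fun_eq_iff)
  ultimately show ?thesis by (simp add: pideal_mon)
qed

lemma pideal_graded_maximal: "pideal V (graded_maximal_ideal V :: ('v, 'k::field) mpoly set)"
  unfolding graded_maximal_ideal_def by (intro pideal_Idl) auto

lemma variable_in_graded_maximal: "v \<in> V \<Longrightarrow> variable v \<in> (graded_maximal_ideal V :: ('v, 'k::field) mpoly set)"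
  unfolding graded_maximal_ideal_def
  by (rule subsetD[OF Idl_superset]) auto

lemma lookup_variable_0 [simp]: "lookup (variable v) 0 = 0"
  by (simp add: variable_def lookup_single_not_eq poly_mapping_eq_iff fun_eq_iff lookup_single when_def)

lemma graded_maximal_constant_term:
  assumes "f \<in> graded_maximal_ideal V"
  shows "lookup f 0 = 0"
proof -
  have "graded_maximal_ideal V \<subseteq> {p \<in> Pol V. lookup p 0 = 0}"
    unfolding graded_maximal_ideal_def by (intro Idl_minimal pideal_constant_term) auto
  then show ?thesis using assms by auto
qed

text \<open>The coefficients \<open>g\<close> serve as the contraction in the Koszul homotopy:
  contracting along \<open>g\<close> is a homotopy from multiplication by \<open>f\<close> to
  zero.\<close>

lemma graded_maximal_combination:
  fixes f :: "('v, 'k::field) mpoly"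
  assumes "f \<in> graded_maximal_ideal V" and "finite V"
  shows "\<exists>g. (\<forall>v. g v \<in> Pol V) \<and> f = (\<Sum>v\<in>V. g v * variable v)"
proof -
  let ?Q = "{f \<in> Pol V. \<exists>g. (\<forall>v. g v \<in> Pol V) \<and> f = (\<Sum>v\<in>V. g v * (variable v :: ('v, 'k) mpoly))}"
  have "pideal V ?Q"
    unfolding pideal_def
  proof (intro conjI ballI)
    show "0 \<in> ?Q" by (auto intro!: exI[of _ "\<lambda>_. 0"])
  next
    fix p q assume "p \<in> ?Q" "q \<in> ?Q"
    then obtain g h where *: "p \<in> Pol V" "q \<in> Pol V" "\<forall>v. g v \<in> Pol V" "\<forall>v. h v \<in> Pol V"
      "p = (\<Sum>v\<in>V. g v * variable v)" "q = (\<Sum>v\<in>V. h v * variable v)" by auto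
    have "p + q = (\<Sum>v\<in>V. (g v + h v) * variable v)"
      unfolding *(5,6) by (simp add: sum.distrib distrib_right)
    moreover have "\<forall>v. g v + h v \<in> Pol V" "p + q \<in> Pol V" using * by auto
    ultimately show "p + q \<in> ?Q" by (intro CollectI conjI exI[of _ "\<lambda>v. g v + h v"]) simp_all
  next
    fix r p :: "('v, 'k) mpoly" assume r: "r \<in> Pol V" and "p \<in> ?Q"
    then obtain g where *: "p \<in> Pol V" "\<forall>v. g v \<in> Pol V" "p = (\<Sum>v\<in>V. g v * variable v)" by auto
    have "r * p = (\<Sum>v\<in>V. (r * g v) * variable v)"
      unfolding *(3) by (simp add: sum_distrib_left mult.assoc)
    moreover have "\<forall>v. r * g v \<in> Pol V" "r * p \<in> Pol V" using * r by auto
    ultimately show "r * p \<in> ?Q" by (intro CollectI conjI exI[of _ "\<lambda>v. r * g v"]) simp_all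
  qed auto
  moreover have "variable ` V \<subseteq> ?Q"
  proof safe
    fix w assume w: "w \<in> V"
    have "(variable w :: ('v, 'k) mpoly) = (\<Sum>v\<in>V. if v = w then variable v else 0)"
      using w assms(2) by simp
    also have "\<dots> = (\<Sum>v\<in>V. (if v = w then 1 else 0) * variable v)"
      by (intro sum.cong) auto
    finally show "\<exists>g. (\<forall>v. g v \<in> Pol V) \<and> (variable w :: ('v, 'k) mpoly) = (\<Sum>v\<in>V. g v * variable v)"
      by (intro exI[of _ "\<lambda>v. if v = w then 1 else 0"]) auto
  qed auto
  ultimately have "graded_maximal_ideal V \<subseteq> ?Q"
    unfolding graded_maximal_ideal_def by (intro Idl_minimal)
  then show ?thesis using assms by auto
qed

subsection \<open>Koszul cochains\<close>

text \<open>Cochains are arbitrary, not necessarily alternating, functions of lists of vertices; this avoids a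
  linear order on the vertices and all bookkeeping of signs.\<close>

fun koszul :: "('v \<Rightarrow> 'r::comm_ring_1) \<Rightarrow> ('v list \<Rightarrow> 'r) \<Rightarrow> 'v list \<Rightarrow> 'r" where
  "koszul a c [] = 0"
| "koszul a c (v # vs) = a v * c vs - koszul a (\<lambda>ws. c (v # ws)) vs"

lemma koszul_add: "koszul a (\<lambda>ws. c ws + d ws) vs = koszul a c vs + koszul a d vs"
  by (induction vs arbitrary: c d) (auto simp: algebra_simps)

lemma koszul_scale: "koszul a (\<lambda>ws. r * c ws) vs = r * koszul a c vs"
  by (induction vs arbitrary: c) (auto simp: algebra_simps)

lemma koszul_diff: "koszul a (\<lambda>ws. c ws - d ws) vs = koszul a c vs - koszul a d vs"
  by (induction vs arbitrary: c d) (auto simp: algebra_simps)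

lemma koszul_0: "koszul a (\<lambda>ws. 0) vs = 0"
  using koszul_scale[of a 0 "\<lambda>_. 0"] by simp

lemma koszul_sum: "koszul a (\<lambda>ws. \<Sum>i\<in>I. c i ws) vs = (\<Sum>i\<in>I. koszul a (c i) vs)"
  by (induction I rule: infinite_finite_induct) (auto simp: koszul_0 koszul_add)

lemma koszul_add_form: "koszul (\<lambda>v. a v + b v) c vs = koszul a c vs + koszul b c vs"
  by (induction vs arbitrary: c) (auto simp: algebra_simps)

lemma koszul_zero_form: "(\<And>v. v \<in> set vs \<Longrightarrow> a v = 0) \<Longrightarrow> koszul a c vs = 0"
  by (induction vs arbitrary: c) auto

lemma koszul_sum_form:
  "koszul (\<lambda>v. \<Sum>i\<in>I. a i v) c vs = (\<Sum>i\<in>I. koszul (a i) c vs)"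
  by (induction I rule: infinite_finite_induct) (auto simp: koszul_zero_form koszul_add_form)

lemma koszul_cong:
  "(\<And>v. v \<in> set vs \<Longrightarrow> a v = b v) \<Longrightarrow>
   (\<And>ws. set ws \<subseteq> set vs \<Longrightarrow> Suc (length ws) = length vs \<Longrightarrow> c ws = d ws) \<Longrightarrow>
   koszul a c vs = koszul b d vs"
proof (induction vs arbitrary: c d)
  case (Cons v vs)
  have "koszul a (\<lambda>ws. c (v # ws)) vs = koszul b (\<lambda>ws. d (v # ws)) vs"
  proof (intro Cons.IH)
    fix ws assume "set ws \<subseteq> set vs" "Suc (length ws) = length vs"
    then show "c (v # ws) = d (v # ws)" by (intro Cons.prems(2)) auto
  qed (use Cons.prems(1) in auto)
  moreover have "c vs = d vs" by (intro Cons.prems(2)) auto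
  ultimately show ?case using Cons.prems(1) by auto
qed simp

text \<open>Expanding at the first vertex \<open>v\<close>, the mixed terms
  \<open>a v * koszul b c vs\<close> and \<open>b v * koszul a c vs\<close> each occur once with
  either sign. What remains is the same sum for the shorter list.\<close>

lemma koszul_anticommute: "koszul a (koszul b c) vs + koszul b (koszul a c) vs = 0"
proof (induction vs arbitrary: c)
  case (Cons v vs)
  have "koszul a (\<lambda>ws. b v * c ws - koszul b (\<lambda>us. c (v # us)) ws) vs = b v * koszul a c vs - koszul a (koszul b (\<lambda>ws. c (v # ws))) vs"
    "koszul b (\<lambda>ws. a v * c ws - koszul a (\<lambda>us. c (v # us)) ws) vs = a v * koszul b c vs - koszul b (koszul a (\<lambda>ws. c (v # ws))) vs"
    by (simp_all add: koszul_diff koszul_scale)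
  then show ?case using Cons.IH[of "\<lambda>ws. c (v # ws)"] by simp
qed simp

lemma koszul_anticommute': "koszul a (koszul b c) vs = - koszul b (koszul a c) vs"
  using koszul_anticommute[of a b c vs] by (simp add: eq_neg_iff_add_eq_0)

text \<open>Anticommutation with \<open>b = a\<close> would only show that twice this value is zero,
  which says nothing in characteristic 2; hence a separate induction.\<close>

lemma koszul_square: "koszul a (koszul a c) vs = 0"
proof (induction vs arbitrary: c)
  case (Cons v vs)
  have "koszul a (\<lambda>ws. koszul a c (v # ws)) vs = a v * koszul a c vs - koszul a (koszul a (\<lambda>ws. c (v # ws))) vs"
    by (simp add: koszul_diff koszul_scale)
  then show ?case using Cons.IH[of "\<lambda>ws. c (v # ws)"] by simp
qed simp

text \<open>The defining recursion of \<^const>\<open>koszul\<close> says that inserting \<open>v\<close> is a homotopy from multiplication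
  by \<open>a v\<close> to zero.\<close>

lemma koszul_homotopy:
  "koszul a (\<lambda>ws. \<Sum>v\<in>V. g v * c (v # ws)) vs =
    (\<Sum>v\<in>V. g v * a v) * c vs - (\<Sum>v\<in>V. g v * koszul a c (v # vs))"
  by (simp add: koszul_sum koszul_scale sum_distrib_right sum_subtractf right_diff_distrib mult.assoc)

lemma koszul_in_ideal:
  assumes "pideal V Q" "\<And>v. v \<in> set vs \<Longrightarrow> a v \<in> Pol V"
    "\<And>ws. set ws \<subseteq> set vs \<Longrightarrow> Suc (length ws) = length vs \<Longrightarrow> c ws \<in> Q"
  shows "koszul a c vs \<in> Q"
  using assms(2,3)
proof (induction vs arbitrary: c)
  case (Cons v vs)
  have "koszul a (\<lambda>ws. c (v # ws)) vs \<in> Q"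
  proof (intro Cons.IH)
    fix ws assume "set ws \<subseteq> set vs" "Suc (length ws) = length vs"
    then show "c (v # ws) \<in> Q" by (intro Cons.prems(2)) auto
  qed (use Cons.prems(1) in auto)
  moreover have "a v * c vs \<in> Q"
    using Cons.prems by (intro pideal_mult[OF assms(1)]) auto
  ultimately show ?case using pideal_minus[OF assms(1)] by simp
qed (simp add: pideal_zero[OF assms(1)])

lemma pideal_carrier: "pideal V (Pol V :: ('v, 'k::field) mpoly set)"
  by (auto simp: pideal_def)

lemmas koszul_Pol = koszul_in_ideal[OF pideal_carrier]

text \<open>Contracting \<open>c\<close> with the cofactors of \<open>f\<close> gives a cochain
  \<open>w\<close> whose coboundary is \<open>f * c\<close> modulo \<open>Q\<close>. Thus
  \<open>w\<close> is a cocycle modulo \<open>Q + (f)\<close>, of degree one less, and by induction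
  it is a coboundary plus \<open>f * h\<close> modulo \<open>Q\<close>. Taking coboundaries once
  more shows that \<open>f\<close> times \<open>c - koszul variable h\<close> is in
  \<open>Q\<close>, and \<open>f\<close> cancels.\<close>

theorem koszul_acyclic:
  fixes Q :: "('v, 'k::field) mpoly set"
  assumes V: "finite V" and "pideal V Q" "rseq V Q fs" "set fs \<subseteq> graded_maximal_ideal V" "i < length fs"
    and "\<And>vs. set vs \<subseteq> V \<Longrightarrow> length vs = i \<Longrightarrow> c vs \<in> Pol V"
    and "\<And>vs. set vs \<subseteq> V \<Longrightarrow> length vs = Suc i \<Longrightarrow> koszul variable c vs \<in> Q"
  shows "\<exists>b. (\<forall>vs. set vs \<subseteq> V \<and> Suc (length vs) = i \<longrightarrow> b vs \<in> Pol V) \<and>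
    (\<forall>vs. set vs \<subseteq> V \<and> length vs = i \<longrightarrow> c vs - koszul variable b vs \<in> Q)"
  using assms(2-)
proof (induction fs arbitrary: Q i c)
  case Nil
  then show ?case by simp
next
  case (Cons f fs)
  note Q = Cons.prems(1)
  have f: "f \<in> Pol V" "nonzerodivisor V Q f" "rseq V (ideal_adjoin V Q f) fs"
    using Cons.prems(2) by auto
  obtain g where g: "\<And>v. g v \<in> Pol V" "f = (\<Sum>v\<in>V. g v * variable v)"
    using graded_maximal_combination[of f V] Cons.prems(3) V by auto
  define w where "w = (\<lambda>ws. \<Sum>v\<in>V. g v * c (v # ws))"
  have w_Pol: "w ws \<in> Pol V" if "set ws \<subseteq> V" "Suc (length ws) = i" for ws
    unfolding w_def using that g(1) Cons.prems(5) by (intro Pol_sum Pol_mult) auto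
  have w: "f * c vs - koszul variable w vs \<in> Q" if "set vs \<subseteq> V" "length vs = i" for vs
  proof -
    have "f * c vs - koszul variable w vs = (\<Sum>v\<in>V. g v * koszul variable c (v # vs))"
      unfolding w_def koszul_homotopy g(2) by simp
    also have "\<dots> \<in> Q"
      using that by (intro pideal_sum[OF Q] pideal_mult[OF Q] g Cons.prems(6)) auto
    finally show ?thesis .
  qed
  have cancel: "p \<in> Q" if "f * p \<in> Q" "p \<in> Pol V" for p
    using that f(2) by (auto simp: nonzerodivisor_def)
  show ?case
  proof (cases i)
    case 0
    \<comment> \<open>In degree 0 nothing has to be bounded: \<open>koszul variable w []\<close> is
      zero, so already \<open>f * c []\<close> is in \<open>Q\<close>.\<close>
    have "c [] \<in> Q"
    proof (rule cancel)
      show "f * c [] \<in> Q" using w[of "[]"] 0 by simp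
      show "c [] \<in> Pol V" using Cons.prems(5)[of "[]"] 0 by simp
    qed
    then show ?thesis using 0 by (intro exI[of _ "\<lambda>_. 0"] conjI allI impI) simp_all
  next
    case (Suc j)
    have "\<exists>b. (\<forall>vs. set vs \<subseteq> V \<and> Suc (length vs) = j \<longrightarrow> b vs \<in> Pol V) \<and>
      (\<forall>vs. set vs \<subseteq> V \<and> length vs = j \<longrightarrow> w vs - koszul variable b vs \<in> ideal_adjoin V Q f)"
    proof (rule Cons.IH[OF pideal_adjoin[OF Q f(1)] f(3)])
      show "koszul variable w vs \<in> ideal_adjoin V Q f" if "set vs \<subseteq> V" "length vs = Suc j" for vs
      proof -
        have "koszul variable w vs \<in> Pol V"
          using that w_Pol Suc by (intro koszul_Pol) auto
        moreover have "koszul variable w vs - c vs * f \<in> Q"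
          using pideal_uminus[OF Q w[of vs]] that Suc by (simp add: mult.commute)
        ultimately show ?thesis
          using Cons.prems(5)[of vs] that Suc by (auto simp: ideal_adjoin_def)
      qed
    qed (use Cons.prems Suc w_Pol in auto)
    then obtain b where b: "\<And>vs. set vs \<subseteq> V \<Longrightarrow> Suc (length vs) = j \<Longrightarrow> b vs \<in> Pol V"
      "\<And>vs. set vs \<subseteq> V \<Longrightarrow> length vs = j \<Longrightarrow> w vs - koszul variable b vs \<in> ideal_adjoin V Q f"
      by blast
    have "\<forall>vs. \<exists>h. set vs \<subseteq> V \<and> length vs = j \<longrightarrow> h \<in> Pol V \<and> w vs - koszul variable b vs - h * f \<in> Q"
      using b(2) by (auto simp: ideal_adjoin_def)
    then obtain h where h: "\<And>vs. set vs \<subseteq> V \<Longrightarrow> length vs = j \<Longrightarrow> h vs \<in> Pol V"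
      "\<And>vs. set vs \<subseteq> V \<Longrightarrow> length vs = j \<Longrightarrow> w vs - koszul variable b vs - h vs * f \<in> Q"
      by metis
    \<comment> \<open>Applying the coboundary to the relation in \<open>h(2)\<close> removes
      \<open>b\<close>, as the square of the coboundary vanishes.\<close>
    have "c vs - koszul variable h vs \<in> Q" if vs: "set vs \<subseteq> V" "length vs = i" for vs
    proof (rule cancel)
      have "koszul variable (\<lambda>ws. w ws - koszul variable b ws - h ws * f) vs \<in> Q"
        using vs Suc by (intro koszul_in_ideal[OF Q] h(2)) auto
      then have "koszul variable w vs - f * koszul variable h vs \<in> Q"
        using koszul_scale[of variable f h vs]
        by (simp add: koszul_diff koszul_square mult.commute)
      from pideal_add[OF Q w[OF vs] this]
      show "f * (c vs - koszul variable h vs) \<in> Q" by (simp add: algebra_simps)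
      have "koszul variable h vs \<in> Pol V"
        using vs Suc h(1) by (intro koszul_Pol) auto
      then show "c vs - koszul variable h vs \<in> Pol V"
        using Cons.prems(5)[OF vs] by auto
    qed
    then show ?thesis using h(1) Suc by (intro exI[of _ h] conjI allI impI) simp_all
  qed
qed

subsection \<open>A nonvanishing criterion for Koszul cohomology\<close>

text \<open>The variant for cochains whose values lie not in \<open>Q\<close> itself but in a colon
  ideal of it.\<close>

lemma koszul_in_ideal':
  assumes "pideal V Q" "set vs \<subseteq> V"
    "\<And>v ws. v \<in> V \<Longrightarrow> set ws \<subseteq> V \<Longrightarrow> a v * c ws \<in> Q"
  shows "koszul a c vs \<in> Q"
  using assms(2,3)
proof (induction vs arbitrary: c)
  case (Cons v vs)
  have "koszul a (\<lambda>ws. c (v # ws)) vs \<in> Q"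
    using Cons.prems by (intro Cons.IH) auto
  moreover have "a v * c vs \<in> Q"
    using Cons.prems by auto
  ultimately show ?case using pideal_minus[OF assms(1)] by simp
qed (simp add: pideal_zero[OF assms(1)])

fun wedge :: "('v \<Rightarrow> 'r::comm_ring_1) list \<Rightarrow> 'r \<Rightarrow> 'v list \<Rightarrow> 'r" where
  "wedge [] u = (\<lambda>_. u)"
| "wedge (a # as) u = koszul a (wedge as u)"

lemma pideal_colon:
  assumes "pideal V (Q :: ('v, 'k::field) mpoly set)" and "\<And>i. i \<in> I \<Longrightarrow> g i \<in> Pol V"
  shows "pideal V {p \<in> Pol V. \<forall>i\<in>I. g i * p \<in> Q}"
  unfolding pideal_def
proof (intro conjI ballI CollectI)
  fix p q i assume "p \<in> {p \<in> Pol V. \<forall>i\<in>I. g i * p \<in> Q}" "q \<in> {p \<in> Pol V. \<forall>i\<in>I. g i * p \<in> Q}" "i \<in> I"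
  then show "g i * (p + q) \<in> Q"
    using pideal_add[OF assms(1), of "g i * p" "g i * q"] by (simp add: distrib_left)
next
  fix p q :: "('v, 'k) mpoly" and i assume "p \<in> Pol V" "q \<in> {p \<in> Pol V. \<forall>i\<in>I. g i * p \<in> Q}" "i \<in> I"
  then show "g i * (p * q) \<in> Q"
    using pideal_mult[OF assms(1), of p "g i * q"] by (simp add: mult.left_commute)
qed (use pideal_zero[OF assms(1)] in auto)

text \<open>Every value of the wedge is a multiple of \<open>u\<close>. Phrased as membership in
  each ideal containing \<open>u\<close>, this can be applied to colon ideals.\<close>

lemma wedge_multiple:
  assumes "pideal V (Q :: ('v, 'k::field) mpoly set)" "u \<in> Q" "set vs \<subseteq> V"
    and "\<And>a v. a \<in> set as \<Longrightarrow> v \<in> V \<Longrightarrow> a v \<in> Pol V"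
  shows "wedge as u vs \<in> Q"
  using assms(3,4)
proof (induction as arbitrary: vs)
  case (Cons a as)
  then show ?case
    by (auto intro!: koszul_in_ideal'[OF assms(1)] pideal_mult[OF assms(1)])
qed (use assms in auto)

lemma koszul_wedge_zero: "a \<in> set as \<Longrightarrow> koszul a (wedge as u) vs = 0"
proof (induction as arbitrary: vs)
  case (Cons b as)
  show ?case
  proof (cases "a = b")
    case False
    then have "koszul a (wedge as u) = (\<lambda>_. 0)" using Cons by auto
    then show ?thesis by (simp add: koszul_anticommute'[of a b] koszul_0)
  qed (simp add: koszul_square)
qed simp

text \<open>By anticommutation \<open>b\<close> moves past the forms of the list until it stands
  next to \<open>a\<close>; then each term contains a product \<open>b v * a w * u\<close>.\<close>

lemma koszul_wedge_in_ideal: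
  assumes Q: "pideal V (Q :: ('v, 'k::field) mpoly set)" and u: "u \<in> Pol V" and vs: "set vs \<subseteq> V"
    and as: "\<And>a v. a \<in> set as \<Longrightarrow> v \<in> V \<Longrightarrow> a v \<in> Pol V"
    and b: "\<And>v. v \<in> V \<Longrightarrow> b v \<in> Pol V"
    and a: "a \<in> set as" "\<And>v w. v \<in> V \<Longrightarrow> w \<in> V \<Longrightarrow> b v * (a w * u) \<in> Q"
  shows "koszul b (wedge as u) vs \<in> Q"
  using as a(1) vs
proof (induction as arbitrary: vs)
  case (Cons e as)
  show ?case
  proof (cases "a \<in> set as")
    case True
    have "koszul e (koszul b (wedge as u)) vs \<in> Q"
    proof (intro koszul_in_ideal'[OF Q])
      fix v ws assume v: "v \<in> V" "set ws \<subseteq> V"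
      show "e v * koszul b (wedge as u) ws \<in> Q"
        using Cons.prems Cons.IH[of ws] True v by (intro pideal_mult[OF Q]) auto
    qed (use Cons.prems in auto)
    then show ?thesis
      by (simp add: koszul_anticommute'[of b e] pideal_uminus[OF Q])
  next
    case False
    then have e: "e = a" using Cons.prems by auto
    \<comment> \<open>\<open>?A\<close> is the colon of \<open>Q\<close> by the values of
      \<open>b\<close>, and \<open>?B\<close> the colon of \<open>?A\<close> by the values of
      \<open>a\<close>. The hypothesis on products says exactly that \<open>u\<close> is in
      \<open>?B\<close>.\<close>
    let ?A = "{p \<in> Pol V. \<forall>v\<in>V. b v * p \<in> Q}"
    let ?B = "{p \<in> Pol V. \<forall>w\<in>V. a w * p \<in> ?A}"
    have A: "pideal V ?A" using b by (intro pideal_colon[OF Q])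
    have aP: "a w \<in> Pol V" if "w \<in> V" for w using Cons.prems e that by auto
    have B: "pideal V ?B" by (intro pideal_colon[OF A] aP)
    have "u \<in> ?B" using u a(2) aP by auto
    then have "wedge as u ws \<in> ?B" if "set ws \<subseteq> V" for ws
      using Cons.prems that by (intro wedge_multiple[OF B]) auto
    then have "koszul a (wedge as u) ws \<in> ?A" if "set ws \<subseteq> V" for ws
      using that by (intro koszul_in_ideal'[OF A]) auto
    then show ?thesis
      unfolding e wedge.simps using Cons.prems by (intro koszul_in_ideal'[OF Q]) auto
  qed
qed simp

text \<open>Evaluation on the product of the cycles \<open>x - y\<close> for the pairs \<open>(x, y)\<close>, in the degree that is \<open>m\<close>
  times the vertices evaluated at; therefore it kills coboundaries.\<close>

fun pairing :: "('v \<times> 'v) list \<Rightarrow> ('v \<Rightarrow>\<^sub>0 nat) \<Rightarrow> ('v list \<Rightarrow> ('v, 'k::field) mpoly) \<Rightarrow> 'k" where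
  "pairing [] m c = lookup (c []) m"
| "pairing ((x, y) # ps) m c =
    pairing ps (xv x + m) (\<lambda>ws. c (x # ws)) - pairing ps (xv y + m) (\<lambda>ws. c (y # ws))"

lemma pairing_diff: "pairing ps m (\<lambda>ws. c ws - d ws) = pairing ps m c - pairing ps m d"
  by (induction ps m c arbitrary: d rule: pairing.induct) (auto simp: lookup_minus)

lemma pairing_uminus: "pairing ps m (\<lambda>ws. - c ws) = - pairing ps m c"
  by (induction ps m c rule: pairing.induct) auto

lemma pairing_variable: "pairing ps (xv x + m) (\<lambda>ws. variable x * c ws) = pairing ps m c"
  by (induction ps m c rule: pairing.induct) (auto simp: add.left_commute[of _ "xv x"])

text \<open>The shift of the degree by \<open>xv x\<close> absorbs the factor
  \<open>variable x\<close>, so the two ends of the first pair contribute the same number and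
  cancel.\<close>

lemma pairing_koszul_variable: "pairing ps m (koszul variable c) = 0"
  by (induction ps m c rule: pairing.induct) (auto simp: pairing_diff pairing_variable)

definition transversal :: "('v \<times> 'v) list \<Rightarrow> 'v list \<Rightarrow> bool" where
  "transversal = list_all2 (\<lambda>p t. t = fst p \<or> t = snd p)"

text \<open>Unfolded, the pairing is a signed sum over the choices of one end from each pair, each
  reading a single coefficient.\<close>

lemma pairing_eq_0:
  "(\<And>T. transversal ps T \<Longrightarrow> lookup (c T) (sum_list (map xv T) + m) = 0) \<Longrightarrow> pairing ps m c = 0"
proof (induction ps m c rule: pairing.induct)
  case (1 m c)
  then show ?case by (auto simp: transversal_def)
next
  case (2 x y ps m c)
  have "pairing ps (xv x + m) (\<lambda>ws. c (x # ws)) = 0"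
  proof (rule 2)
    show "lookup (c (x # T)) (sum_list (map xv T) + (xv x + m)) = 0" if "transversal ps T" for T
      using 2(3)[of "x # T"] that by (simp add: transversal_def ac_simps)
  qed
  moreover have "pairing ps (xv y + m) (\<lambda>ws. c (y # ws)) = 0"
  proof (rule 2)
    show "lookup (c (y # T)) (sum_list (map xv T) + (xv y + m)) = 0" if "transversal ps T" for T
      using 2(3)[of "y # T"] that by (simp add: transversal_def ac_simps)
  qed
  ultimately show ?case by simp
qed

lemma transversal_set:
  assumes "transversal ps T" "t \<in> set T"
  shows "t \<in> fst ` set ps \<union> snd ` set ps"
  using assms unfolding transversal_def
  by (induction ps T rule: list_all2_induct) auto

lemma pairing_koszul_zero:
  assumes "\<And>x. x \<in> fst ` set ps \<union> snd ` set ps \<Longrightarrow> a x = 0"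
  shows "pairing ps m (koszul a c) = 0"
  using assms transversal_set[of ps] by (intro pairing_eq_0) (auto simp: koszul_zero_form)

text \<open>The matrix of values of the forms on the cycles is diagonal: \<open>a r\<close> is
  \<open>variable r\<close> at \<open>r\<close>, and zero at \<open>n r\<close> and at both ends of
  all other pairs. Only the diagonal term survives, with its degree shifts absorbed.\<close>

lemma pairing_wedge:
  assumes "distinct rs"
    and "\<And>r. r \<in> set rs \<Longrightarrow> a r r = variable r \<and> a r (n r) = 0"
    and "\<And>r s. r \<in> set rs \<Longrightarrow> s \<in> set rs \<Longrightarrow> r \<noteq> s \<Longrightarrow> a r s = 0 \<and> a r (n s) = 0"
  shows "pairing (map (\<lambda>r. (r, n r)) rs) m (wedge (map a rs) u) = lookup u m"
  using assms
proof (induction rs arbitrary: m)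
  case (Cons r rs)
  have "pairing (map (\<lambda>r. (r, n r)) rs) m' (koszul (a r) c) = 0" for m' c
    using Cons.prems by (intro pairing_koszul_zero) (auto, blast+)
  moreover have "pairing (map (\<lambda>r. (r, n r)) rs) m (wedge (map a rs) u) = lookup u m"
    using Cons.prems by (intro Cons.IH) auto
  ultimately show ?case using Cons.prems
    by (simp add: pairing_diff pairing_uminus pairing_variable)
qed simp

text \<open>The wedge of the forms \<open>a r\<close> with the monomial \<open>m\<close> is a
  cocycle modulo the ideal. The total form splits into the \<open>a r\<close>, which die because
  their squares vanish, and the \<open>b r\<close>, which enter the ideal either against
  \<open>m\<close> alone or against \<open>a r\<close> and \<open>m\<close>. With a longer regular
  sequence the wedge would be a coboundary, and the pairing would give \<open>1 = 0\<close>.\<close>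

theorem rseq_length_le:
  fixes a b :: "'v \<Rightarrow> 'v \<Rightarrow> ('v, 'k::field) mpoly" and fs :: "('v, 'k) mpoly list"
  assumes V: "finite V" and M: "upset M"
    and fs: "rseq V (mon V M) fs" "set fs \<subseteq> graded_maximal_ideal V"
    and rs: "distinct rs" "set rs \<subseteq> V" "n ` set rs \<subseteq> V"
    and Pol: "\<And>r v. v \<in> V \<Longrightarrow> a r v \<in> Pol V" "\<And>r v. v \<in> V \<Longrightarrow> b r v \<in> Pol V"
    and m: "keys m \<subseteq> V"
    and variable: "\<And>v. v \<in> V \<Longrightarrow> variable v = (\<Sum>r\<in>set rs. a r v) + (\<Sum>r\<in>R. b r v)"
    and b: "\<And>r. r \<in> R \<Longrightarrow> (\<forall>v\<in>V. b r v * single m 1 \<in> mon V M) \<or>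
      r \<in> set rs \<and> (\<forall>v\<in>V. \<forall>w\<in>V. b r v * (a r w * single m 1) \<in> mon V M)"
    and a: "\<And>r. r \<in> set rs \<Longrightarrow> a r r = variable r \<and> a r (n r) = 0"
      "\<And>r s. r \<in> set rs \<Longrightarrow> s \<in> set rs \<Longrightarrow> r \<noteq> s \<Longrightarrow> a r s = 0 \<and> a r (n s) = 0"
    and T: "\<And>T. transversal (map (\<lambda>r. (r, n r)) rs) T \<Longrightarrow> \<not> M (sum_list (map xv T) + m)"
  shows "length fs \<le> length rs"
proof (rule ccontr)
  assume "\<not> length fs \<le> length rs"
  then have less: "length rs < length fs" by simp
  define u :: "('v, 'k) mpoly" where "u = single m 1"
  have u: "u \<in> Pol V" using m by (auto simp: u_def)
  note Q = pideal_mon[OF M, of V, where 'k = 'k]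
  define c where "c = wedge (map a rs) u"
  have c_Pol: "c vs \<in> Pol V" if "set vs \<subseteq> V" for vs
    unfolding c_def using that u Pol by (intro wedge_multiple[OF pideal_carrier]) auto
  have "koszul variable c vs \<in> mon V M" if vs: "set vs \<subseteq> V" for vs
  proof -
    have "koszul variable c vs = koszul (\<lambda>v. (\<Sum>r\<in>set rs. a r v) + (\<Sum>r\<in>R. b r v)) c vs"
      using vs variable by (intro koszul_cong) auto
    also have "\<dots> = (\<Sum>r\<in>set rs. koszul (a r) c vs) + (\<Sum>r\<in>R. koszul (b r) c vs)"
      by (simp add: koszul_add_form koszul_sum_form)
    also have "(\<Sum>r\<in>set rs. koszul (a r) c vs) = 0"
      by (intro sum.neutral) (auto simp: c_def koszul_wedge_zero)
    finally have "koszul variable c vs = (\<Sum>r\<in>R. koszul (b r) c vs)" by simp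
    also have "\<dots> \<in> mon V M"
    proof (intro pideal_sum[OF Q])
      fix r assume r: "r \<in> R"
      show "koszul (b r) c vs \<in> mon V M"
      proof (cases "\<forall>v\<in>V. b r v * single m 1 \<in> mon V M")
        case True
        let ?A = "{p \<in> Pol V. \<forall>v\<in>V. b r v * p \<in> mon V M}"
        have A: "pideal V ?A" using Pol by (intro pideal_colon[OF Q])
        have "c ws \<in> ?A" if "set ws \<subseteq> V" for ws
          unfolding c_def using that u Pol True by (intro wedge_multiple[OF A]) (auto simp: u_def)
        then show ?thesis using vs by (intro koszul_in_ideal'[OF Q]) auto
      next
        case False
        then show ?thesis
          unfolding c_def using r b[OF r] u vs Pol
          by (intro koszul_wedge_in_ideal[OF Q, where a = "a r"]) (auto simp: u_def)
      qed
    qed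
    finally show ?thesis .
  qed
  note cocycle = this
  have "\<exists>d. (\<forall>vs. set vs \<subseteq> V \<and> Suc (length vs) = length rs \<longrightarrow> d vs \<in> Pol V) \<and>
    (\<forall>vs. set vs \<subseteq> V \<and> length vs = length rs \<longrightarrow> c vs - koszul variable d vs \<in> mon V M)"
    by (rule koszul_acyclic[OF V Q fs less]) (simp_all add: c_Pol cocycle)
  then obtain d where d: "\<And>vs. set vs \<subseteq> V \<Longrightarrow> length vs = length rs \<Longrightarrow> c vs - koszul variable d vs \<in> mon V M"
    by blast
  let ?ps = "map (\<lambda>r. (r, n r)) rs"
  \<comment> \<open>Elements of the ideal have coefficient zero at every monomial the pairing reads;
    this is the hypothesis on transversals.\<close>
  have "pairing ?ps m (\<lambda>ws. c ws - koszul variable d ws) = 0"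
  proof (rule pairing_eq_0)
    fix T assume T': "transversal ?ps T"
    have "set T \<subseteq> V" using transversal_set[OF T'] rs by fastforce
    moreover have "length T = length rs"
      using T' by (auto simp: transversal_def dest: list_all2_lengthD)
    ultimately show "lookup (c T - koszul variable d T) (sum_list (map xv T) + m) = 0"
      using d T[OF T'] by (intro mon_lookup) auto
  qed
  moreover have "pairing ?ps m c = 1"
    unfolding c_def using pairing_wedge[OF rs(1), of a n m u] a by (simp add: u_def)
  ultimately show False
    by (simp add: pairing_diff pairing_koszul_variable)
qed

subsection \<open>Sums of variables as nonzerodivisors\<close>

definition filt :: "('a \<Rightarrow> bool) \<Rightarrow> ('a \<Rightarrow>\<^sub>0 'b::comm_monoid_add) \<Rightarrow> ('a \<Rightarrow>\<^sub>0 'b)" where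
  "filt P p = (\<Sum>m | m \<in> keys p \<and> P m. single m (lookup p m))"

lemma lookup_filt [simp]: "lookup (filt P p) m = (if P m then lookup p m else 0)"
proof -
  have "lookup (filt P p) m = (\<Sum>n | n \<in> keys p \<and> P n. if n = m then lookup p n else 0)"
    unfolding filt_def lookup_sum by (intro sum.cong) (auto simp: lookup_single when_def)
  also have "\<dots> = (if P m then lookup p m else 0)"
    by (auto simp: in_keys_iff sum.delta')
  finally show ?thesis .
qed

lemma filt_add: "filt P (p + q) = filt P p + filt P q"
  and filt_0 [simp]: "filt P 0 = 0"
  and filt_filt: "filt P (filt Q p) = filt (\<lambda>m. P m \<and> Q m) p"
  by (rule poly_mapping_eqI; simp add: lookup_add)+

lemma filt_diff: "filt P (p - q) = filt P p - filt P q"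
  for p q :: "'a \<Rightarrow>\<^sub>0 'b::ab_group_add"
  by (rule poly_mapping_eqI) (simp add: lookup_minus)

lemma filt_sum: "filt P (sum f A) = (\<Sum>i\<in>A. filt P (f i))"
  by (induction A rule: infinite_finite_induct) (auto simp: filt_add)

lemma keys_filt: "keys (filt P p) = {m \<in> keys p. P m}"
  by (auto simp: in_keys_iff split: if_splits)

lemma filt_Pol [intro]: "p \<in> Pol V \<Longrightarrow> filt P p \<in> Pol V"
  by (auto simp: Pol_def keys_filt)

lemma filt_id_iff: "filt P p = p \<longleftrightarrow> (\<forall>m\<in>keys p. P m)"
  by (auto simp: poly_mapping_eq_iff fun_eq_iff in_keys_iff)

lemma filt_single_times:
  fixes p :: "('v, 'k::field) mpoly"
  shows "filt P (single a c * p) = single a c * filt (\<lambda>m. P (a + m)) p"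
  by (rule poly_mapping_eqI) (auto simp: lookup_single_times)

text \<open>Together with \<open>filt\<close> this is the projection to a fixed multidegree in the
  variables of \<open>Z\<close>, all other variables being treated as scalars.\<close>

definition agree :: "'v set \<Rightarrow> ('v \<Rightarrow> nat) \<Rightarrow> ('v \<Rightarrow>\<^sub>0 nat) \<Rightarrow> bool" where
  "agree Z z m \<longleftrightarrow> (\<forall>v\<in>Z. lookup m v = z v)"

lemma filt_agree_times:
  fixes f p :: "('v, 'k::field) mpoly"
  assumes "f \<in> Pol W" and "W \<inter> Z = {}"
  shows "filt (agree Z z) (f * p) = f * filt (agree Z z) p"
proof -
  have "filt (agree Z z) (single m c * p) = single m c * filt (agree Z z) p"
    if "m \<in> keys f" for m c
  proof -
    have "keys m \<inter> Z = {}" using that assms by (auto simp: Pol_def)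
    then have "lookup m v = 0" if "v \<in> Z" for v using that by (auto simp: in_keys_iff)
    then have "agree Z z (m + n) = agree Z z n" for n
      by (auto simp: agree_def lookup_add)
    then show ?thesis by (simp add: filt_single_times)
  qed
  then have "filt (agree Z z) ((\<Sum>m\<in>keys f. single m (lookup f m)) * p) =
    (\<Sum>m\<in>keys f. single m (lookup f m)) * filt (agree Z z) p"
    by (simp add: sum_distrib_right filt_sum)
  then show ?thesis by (simp add: poly_mapping_sum_single)
qed

lemma filt_agree_variable:
  fixes p :: "('v, 'k::field) mpoly"
  assumes "v \<in> Z"
  shows "filt (agree Z z) (variable v * p) =
    (if z v > 0 then variable v * filt (agree Z (z(v := z v - 1))) p else 0)"
proof -
  have "agree Z z (xv v + m) \<longleftrightarrow> z v > 0 \<and> agree Z (z(v := z v - 1)) m" for m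
    using assms by (auto simp: agree_def lookup_add lookup_single when_def split: if_splits)
  then have "agree Z z (xv v + m) = (if z v > 0 then agree Z (z(v := z v - 1)) m else False)" for m
    by simp
  then have "filt (\<lambda>m. agree Z z (xv v + m)) p =
      (if z v > 0 then filt (agree Z (z(v := z v - 1))) p else 0)"
    by (intro poly_mapping_eqI) auto
  then show ?thesis
    by (simp add: variable_def filt_single_times)
qed

section \<open>Multidegrees and the exchange argument\<close>

definition graded_on :: "'v set \<Rightarrow> ('v, 'k::field) mpoly set \<Rightarrow> bool" where
  "graded_on Z Q \<longleftrightarrow> (\<forall>p\<in>Q. \<forall>z. filt (agree Z z) p \<in> Q)"

text \<open>\<open>C x z\<close> is a condition under which \<open>x\<close> acts injectively on the
  part of \<open>S/Q\<close> of multidegree \<open>z\<close>. In a multidegree where no vertex meets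
  it, that part must vanish.\<close>

definition stable_on ::
  "'v set \<Rightarrow> 'v set \<Rightarrow> ('v \<Rightarrow> ('v \<Rightarrow> nat) \<Rightarrow> bool) \<Rightarrow> ('v, 'k::field) mpoly set \<Rightarrow> bool" where
  "stable_on V Z C Q \<longleftrightarrow>
    (\<forall>x z p. x \<in> Z \<longrightarrow> C x z \<longrightarrow> p \<in> Pol V \<longrightarrow> filt (agree Z z) p = p \<longrightarrow> variable x * p \<in> Q \<longrightarrow> p \<in> Q) \<and>
    (\<forall>z. (\<exists>x\<in>Z. C x z) \<or> (\<forall>p\<in>Pol V. filt (agree Z z) p = p \<longrightarrow> p \<in> Q))"

definition exchange :: "'v set \<Rightarrow> ('v \<Rightarrow> ('v \<Rightarrow> nat) \<Rightarrow> bool) \<Rightarrow> bool" where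
  "exchange Z C \<longleftrightarrow> (\<forall>x\<in>Z. \<forall>v\<in>Z. \<forall>z. v \<noteq> x \<longrightarrow> z v > 0 \<longrightarrow> C x z \<longrightarrow> C x (z(x := Suc (z x), v := z v - 1)))"

lemma sum_filt_agree:
  assumes "graded_on Z Q" "pideal V Q" and "\<And>z. filt (agree Z z) p \<in> Q"
  shows "p \<in> Q"
proof -
  \<comment> \<open>The value 0 outside \<open>Z\<close> normalises the multidegrees, so each
    homogeneous part is counted once.\<close>
  let ?z = "\<lambda>m v. if v \<in> Z then lookup m v else 0"
  let ?A = "?z ` keys p"
  have "lookup p m = (\<Sum>z\<in>?A. lookup (filt (agree Z z) p) m)" for m
  proof (cases "m \<in> keys p")
    case True
    have "(\<Sum>z\<in>?A. lookup (filt (agree Z z) p) m) = (\<Sum>z\<in>?A. if z = ?z m then lookup p m else 0)"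
    proof (intro sum.cong refl)
      fix z assume "z \<in> ?A"
      then obtain n where "z = ?z n" by auto
      then have "agree Z z m \<Longrightarrow> z = ?z m"
        by (auto simp: agree_def)
      moreover have "agree Z (?z m) m" by (simp add: agree_def)
      ultimately have "agree Z z m \<longleftrightarrow> z = ?z m" by metis
      then show "lookup (filt (agree Z z) p) m = (if z = ?z m then lookup p m else 0)" by simp
    qed
    then show ?thesis using True by simp
  next
    case False
    then have "lookup p m = 0" by (simp add: in_keys_iff)
    then show ?thesis by (simp cong: if_cong)
  qed
  then have "p = (\<Sum>z\<in>?A. filt (agree Z z) p)"
    by (intro poly_mapping_eqI) (simp add: lookup_sum)
  also have "\<dots> \<in> Q" using assms by (intro pideal_sum[OF assms(2)])
  finally show ?thesis .
qed

text \<open>Suppose a homogeneous part of \<open>p\<close> is not in \<open>Q\<close>, and let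
  \<open>x\<close> be admissible for its multidegree. Among such multidegrees take one,
  \<open>y\<close>, with the largest exponent of \<open>x\<close>. In multidegree \<open>y\<close>
  plus \<open>x\<close> of the product, every summand other than \<open>x\<close> times the part in
  degree \<open>y\<close> comes from a multidegree with more \<open>x\<close>, hence lies in
  \<open>Q\<close>. So that one does too, and \<open>x\<close> cancels.\<close>

lemma nonzerodivisor_sum_variables:
  fixes Q :: "('v, 'k::field) mpoly set"
  assumes Q: "pideal V Q" "graded_on Z Q" "stable_on V Z C Q" "exchange Z C"
    and Z: "finite Z" "Z \<subseteq> V"
  shows "nonzerodivisor V Q (\<Sum>v\<in>Z. variable v)"
  unfolding nonzerodivisor_def
proof (intro ballI impI, rule sum_filt_agree[OF Q(2,1)], rule ccontr)
  fix p and z :: "'v \<Rightarrow> nat"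
  assume p: "p \<in> Pol V" "(\<Sum>v\<in>Z. variable v) * p \<in> Q" and z: "filt (agree Z z) p \<notin> Q"
  from z have "filt (agree Z z) p \<in> Pol V" "filt (agree Z z) (filt (agree Z z) p) = filt (agree Z z) p"
    using p by (auto simp: filt_filt)
  then obtain x where x: "x \<in> Z" "C x z"
    using Q(3) z unfolding stable_on_def by metis
  define B where "B = {z. C x z \<and> filt (agree Z z) p \<notin> Q}"
  have bdd: "z' x \<in> (\<lambda>m. lookup m x) ` keys p" if "z' \<in> B" for z'
  proof -
    have "filt (agree Z z') p \<noteq> 0" using that pideal_zero[OF Q(1)] by (auto simp: B_def)
    then obtain m where "m \<in> keys (filt (agree Z z') p)"
      by (metis equals0I keys_eq_empty)
    then show ?thesis using x by (intro image_eqI[of _ _ m]) (auto simp: keys_filt agree_def)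
  qed
  have fin: "finite ((\<lambda>z. z x) ` B)"
    by (rule finite_subset[of _ "(\<lambda>m. lookup m x) ` keys p"]) (use bdd in auto)
  have zB: "z \<in> B" using x z by (auto simp: B_def)
  then have "Max ((\<lambda>z. z x) ` B) \<in> (\<lambda>z. z x) ` B"
    using fin by (intro Max_in) auto
  then obtain y where y: "y \<in> B" "Max ((\<lambda>z. z x) ` B) = y x" by auto
  then have max: "\<And>z'. z' \<in> B \<Longrightarrow> z' x \<le> y x"
    using fin by (metis Max_ge imageI)
  let ?y = "y(x := Suc (y x))"
  let ?t = "\<lambda>v. filt (agree Z ?y) (variable v * p)"
  have "filt (agree Z ?y) ((\<Sum>v\<in>Z. variable v) * p) = (\<Sum>v\<in>Z. ?t v)"
    by (simp add: sum_distrib_right filt_sum)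
  also have "\<dots> = ?t x + (\<Sum>v\<in>Z - {x}. ?t v)"
    using Z(1) x(1) by (rule sum.remove)
  finally have eq: "?t x + (\<Sum>v\<in>Z - {x}. ?t v) \<in> Q"
    using Q(2) p(2) unfolding graded_on_def by metis
  \<comment> \<open>\<open>exchange\<close> keeps \<open>x\<close> admissible after a factor
    \<open>v\<close> is traded for \<open>x\<close>, so only maximality can have excluded this
    multidegree from \<open>B\<close>.\<close>
  have "?t v \<in> Q" if v: "v \<in> Z - {x}" for v
  proof (cases "y v > 0")
    case True
    have "C x (y(x := Suc (y x), v := y v - 1))"
      using y(1) x(1) v True Q(4) unfolding exchange_def B_def by auto
    moreover have "y(x := Suc (y x), v := y v - 1) \<notin> B"
      using max[of "y(x := Suc (y x), v := y v - 1)"] v by auto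
    ultimately have "filt (agree Z (y(x := Suc (y x), v := y v - 1))) p \<in> Q"
      by (auto simp: B_def)
    moreover have "variable v \<in> Pol V" using v Z(2) by auto
    ultimately show ?thesis using v True
      by (auto simp: filt_agree_variable fun_upd_twist intro: pideal_mult[OF Q(1)])
  next
    case False
    then show ?thesis using v by (auto simp: filt_agree_variable pideal_zero[OF Q(1)])
  qed
  then have "(\<Sum>v\<in>Z - {x}. ?t v) \<in> Q" by (intro pideal_sum[OF Q(1)])
  from pideal_minus[OF Q(1) eq this] have "?t x \<in> Q" by simp
  then have "variable x * filt (agree Z y) p \<in> Q"
    using x by (simp add: filt_agree_variable)
  moreover have "C x y" using y(1) by (simp add: B_def)
  moreover have "filt (agree Z y) p \<in> Pol V" "filt (agree Z y) (filt (agree Z y) p) = filt (agree Z y) p"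
    using p by (auto simp: filt_filt)
  ultimately have "filt (agree Z y) p \<in> Q"
    using Q(3) x(1) unfolding stable_on_def by blast
  then show False using y(1) by (simp add: B_def)
qed

lemma variable_factor:
  fixes p :: "('v, 'k::field) mpoly"
  assumes "p \<in> Pol V" "\<And>m. m \<in> keys p \<Longrightarrow> lookup m x > 0"
  shows "\<exists>q\<in>Pol V. p = variable x * q \<and> keys q = (\<lambda>m. m - xv x) ` keys p"
proof -
  define q where "q = (\<Sum>m\<in>keys p. single (m - xv x) (lookup p m))"
  have "variable x * q = (\<Sum>m\<in>keys p. single m (lookup p m))"
    unfolding q_def variable_def sum_distrib_left
  proof (intro sum.cong refl)
    fix m assume "m \<in> keys p"
    then show "single (single x 1) 1 * single (m - xv x) (lookup p m) = single m (lookup p m)"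
      using xv_minus_add[OF assms(2)] by (simp add: mult_single)
  qed
  then have *: "p = variable x * q" by (simp add: poly_mapping_sum_single)
  have keys: "keys q = (\<lambda>m. m - xv x) ` keys p"
    unfolding * keys_variable_times by (simp add: image_image)
  have "keys (m - xv x) \<subseteq> V" if "m \<in> keys p" for m
  proof -
    have "keys (m - xv x) \<subseteq> keys m" by (auto simp: in_keys_iff lookup_minus)
    then show ?thesis using that assms(1) by (auto simp: Pol_def)
  qed
  then have "q \<in> Pol V" by (auto simp: Pol_def keys)
  then show ?thesis using * keys by blast
qed

lemma graded_on_adjoin:
  assumes "graded_on Z Q" "f \<in> Pol W" "W \<inter> Z = {}"
  shows "graded_on Z (ideal_adjoin V Q f)"
  unfolding graded_on_def
proof (intro ballI allI)
  fix p z assume "p \<in> ideal_adjoin V Q f"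
  then obtain g where *: "p \<in> Pol V" "g \<in> Pol V" "p - g * f \<in> Q" by (auto simp: ideal_adjoin_def)
  have "filt (agree Z z) (g * f) = filt (agree Z z) g * f"
    using filt_agree_times[OF assms(2,3), of z g] by (simp add: mult.commute)
  then have "filt (agree Z z) p - filt (agree Z z) g * f \<in> Q"
    using assms(1) * unfolding graded_on_def by (metis filt_diff)
  then show "filt (agree Z z) p \<in> ideal_adjoin V Q f"
    using * by (auto simp: ideal_adjoin_def)
qed

text \<open>Since \<open>f\<close> has degree zero in \<open>Z\<close>, the cofactor of
  \<open>variable x * p\<close> may be replaced by its part in multidegree \<open>z\<close> plus
  \<open>x\<close>. All monomials of that part contain \<open>x\<close>, so it is
  \<open>variable x * h\<close>, and stability of \<open>Q\<close> applies to
  \<open>p - h * f\<close>.\<close>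

lemma stable_on_adjoin:
  fixes Q :: "('v, 'k::field) mpoly set"
  assumes Q: "pideal V Q" "graded_on Z Q" "stable_on V Z C Q"
    and f: "f \<in> Pol W" "W \<inter> Z = {}" "W \<subseteq> V"
  shows "stable_on V Z C (ideal_adjoin V Q f)"
  unfolding stable_on_def
proof (intro conjI allI impI)
  fix x z and p :: "('v, 'k) mpoly"
  assume x: "x \<in> Z" "C x z" and p: "p \<in> Pol V" "filt (agree Z z) p = p"
    and "variable x * p \<in> ideal_adjoin V Q f"
  then obtain g where g: "variable x * p \<in> Pol V" "g \<in> Pol V" "variable x * p - g * f \<in> Q"
    by (auto simp: ideal_adjoin_def)
  let ?z = "z(x := Suc (z x))"
  have fV: "f \<in> Pol V" using f by (auto simp: Pol_def)
  have "filt (agree Z ?z) (variable x * p) = variable x * p"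
    using x p by (simp add: filt_agree_variable)
  moreover have "filt (agree Z ?z) (g * f) = filt (agree Z ?z) g * f"
    using filt_agree_times[OF f(1,2), of ?z g] by (simp add: mult.commute)
  ultimately have 1: "variable x * p - filt (agree Z ?z) g * f \<in> Q"
    using Q(2) g(3) unfolding graded_on_def by (metis filt_diff)
  have deg: "agree Z ?z m" if "m \<in> keys (filt (agree Z ?z) g)" for m
    using that by (simp add: keys_filt)
  have "\<exists>q\<in>Pol V. filt (agree Z ?z) g = variable x * q \<and> keys q = (\<lambda>m. m - xv x) ` keys (filt (agree Z ?z) g)"
    using g(2) deg x(1) by (intro variable_factor) (auto simp: agree_def)
  then obtain h where h: "h \<in> Pol V" "filt (agree Z ?z) g = variable x * h"
    "keys h = (\<lambda>m. m - xv x) ` keys (filt (agree Z ?z) g)" by blast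
  have "agree Z z m" if "m \<in> keys h" for m
    using that deg x(1) unfolding h(3) by (auto simp: agree_def lookup_minus lookup_single when_def)
  then have "filt (agree Z z) h = h" by (simp add: filt_id_iff)
  then have "filt (agree Z z) (h * f) = h * f"
    using filt_agree_times[OF f(1,2), of z h] by (simp add: mult.commute)
  then have "filt (agree Z z) (p - h * f) = p - h * f"
    using p by (simp add: filt_diff)
  moreover have "variable x * (p - h * f) \<in> Q"
    using 1 by (simp add: h(2) algebra_simps)
  moreover have "p - h * f \<in> Pol V" using p h fV by auto
  ultimately have "p - h * f \<in> Q"
    using Q(3) x unfolding stable_on_def by blast
  then show "p \<in> ideal_adjoin V Q f"
    using p h by (auto simp: ideal_adjoin_def)
next
  fix z
  show "(\<exists>x\<in>Z. C x z) \<or> (\<forall>p\<in>Pol V. filt (agree Z z) p = p \<longrightarrow> p \<in> ideal_adjoin V Q f)"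
    using Q(3) ideal_adjoin_superset[OF Q(1), of f] unfolding stable_on_def by blast
qed

lemma graded_on_mon: "graded_on Z (mon V M)"
  by (auto simp: graded_on_def mon_def keys_filt)

lemma stable_on_mon:
  assumes "\<And>x z m. x \<in> Z \<Longrightarrow> C x z \<Longrightarrow> keys m \<subseteq> V \<Longrightarrow> agree Z z m \<Longrightarrow> M (xv x + m) \<Longrightarrow> M m"
    and "\<And>z. (\<exists>x\<in>Z. C x z) \<or> (\<forall>m. keys m \<subseteq> V \<longrightarrow> agree Z z m \<longrightarrow> M m)"
  shows "stable_on V Z C (mon V M :: ('v, 'k::field) mpoly set)"
  unfolding stable_on_def
proof (intro conjI allI impI)
  fix x z and p :: "('v, 'k) mpoly"
  assume *: "x \<in> Z" "C x z" "p \<in> Pol V" "filt (agree Z z) p = p" "variable x * p \<in> mon V M"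
  have "M m" if "m \<in> keys p" for m
  proof (rule assms(1))
    show "keys m \<subseteq> V" using * that by (auto simp: Pol_def)
    show "agree Z z m" using * that by (auto simp: filt_id_iff)
    show "M (xv x + m)" using * that by (auto simp: mon_def keys_variable_times)
  qed (use * in auto)
  then show "p \<in> mon V M" using * by (auto simp: mon_def)
next
  fix z
  have "p \<in> mon V M" if "\<forall>m. keys m \<subseteq> V \<longrightarrow> agree Z z m \<longrightarrow> M m" "p \<in> Pol V" "filt (agree Z z) p = p"
    for p :: "('v, 'k) mpoly"
    using that by (auto simp: mon_def filt_id_iff Pol_def)
  then show "(\<exists>x\<in>Z. C x z) \<or> (\<forall>p\<in>Pol V. filt (agree Z z) p = p \<longrightarrow> p \<in> (mon V M :: ('v, 'k) mpoly set))"
    using assms(2)[of z] by blast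
qed

text \<open>Each sum has degree zero in the variables of the other, disjoint sets, so adjoining it
  preserves homogeneity and stability for them. The vanishing of constant terms is also inherited
  and keeps \<open>1\<close> out of the last ideal.\<close>

lemma rseq_sums_of_variables:
  fixes Q :: "('v, 'k::field) mpoly set"
  assumes "pideal V Q" "\<And>p. p \<in> Q \<Longrightarrow> lookup p 0 = 0" "finite V"
    and "distinct Zs" "\<And>Z. Z \<in> set Zs \<Longrightarrow> Z \<subseteq> V"
    "\<And>Y Z. Y \<in> set Zs \<Longrightarrow> Z \<in> set Zs \<Longrightarrow> Y \<noteq> Z \<Longrightarrow> Y \<inter> Z = {}"
    and "\<And>Z. Z \<in> set Zs \<Longrightarrow> graded_on Z Q"
    "\<And>Z. Z \<in> set Zs \<Longrightarrow> exchange Z (C Z) \<and> stable_on V Z (C Z) Q"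
  shows "rseq V Q (map (\<lambda>Z. \<Sum>v\<in>Z. variable v) Zs)"
  using assms
proof (induction Zs arbitrary: Q)
  case Nil
  then show ?case by fastforce
next
  case (Cons Z Zs)
  let ?f = "\<Sum>v\<in>Z. variable v :: ('v, 'k) mpoly"
  have Z: "Z \<subseteq> V" "finite Z" using Cons.prems(3,5) by (auto intro: finite_subset)
  have f: "?f \<in> Pol V" "?f \<in> Pol Z" using Z by auto
  have "nonzerodivisor V Q ?f"
    using Cons.prems Z by (intro nonzerodivisor_sum_variables[where C = "C Z"]) auto
  moreover have "rseq V (ideal_adjoin V Q ?f) (map (\<lambda>Z. \<Sum>v\<in>Z. variable v) Zs)"
  proof (rule Cons.IH)
    show "pideal V (ideal_adjoin V Q ?f)" using Cons.prems(1) f by (intro pideal_adjoin)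
    have "ideal_adjoin V Q ?f \<subseteq> {p \<in> Pol V. lookup p 0 = 0}"
      using Cons.prems(2) pideal_Pol[OF Cons.prems(1)] f
      by (intro ideal_adjoin_minimal pideal_constant_term) (auto simp: lookup_sum)
    then show "lookup p 0 = 0" if "p \<in> ideal_adjoin V Q ?f" for p using that by auto
    fix Y assume Y: "Y \<in> set Zs"
    then have disj: "Z \<inter> Y = {}" using Cons.prems(4,6) by auto
    show "graded_on Y (ideal_adjoin V Q ?f)"
      using graded_on_adjoin[OF _ f(2) disj] Cons.prems(7) Y by auto
    show "exchange Y (C Y) \<and> stable_on V Y (C Y) (ideal_adjoin V Q ?f)"
      using stable_on_adjoin[OF Cons.prems(1) _ _ f(2) disj Z(1), of "C Y"] Cons.prems(7,8) Y by auto
  qed (use Cons.prems in auto)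
  ultimately show ?case using f by simp
qed

subsection \<open>A second regular element on a connected independence complex\<close>

lemma keys_add_nat: "keys (a + b) = keys a \<union> keys b" for a b :: "'v \<Rightarrow>\<^sub>0 nat"
  by (auto simp: in_keys_iff lookup_add)

text \<open>Membership in the squarefree ideal \<open>I\<close> depends on the support alone;
  monomials that are not \<open>edgy\<close> are those supported on faces of the independence
  complex.\<close>

definition edgy :: "('v \<Rightarrow> 'v \<Rightarrow> bool) \<Rightarrow> ('v \<Rightarrow>\<^sub>0 nat) \<Rightarrow> bool" where
  "edgy E m \<longleftrightarrow> (\<exists>a\<in>keys m. \<exists>b\<in>keys m. E a b)"

lemma upset_edgy: "upset (edgy E)"
  by (auto simp: upset_def edgy_def keys_add_nat)

text \<open>The strict bound lets the zero polynomial satisfy every instance, and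
  \<open>deg_lt u 1\<close> says that \<open>u\<close> does not occur.\<close>

definition deg_lt :: "'v \<Rightarrow> nat \<Rightarrow> ('v, 'k::field) mpoly \<Rightarrow> bool" where
  "deg_lt u n p \<longleftrightarrow> (\<forall>m\<in>keys p. lookup m u < n)"

lemma deg_lt_add: "deg_lt u n p \<Longrightarrow> deg_lt u n q \<Longrightarrow> deg_lt u n (p + q)"
  using Poly_Mapping.keys_add[of p q] by (auto simp: deg_lt_def)

lemma deg_lt_uminus: "deg_lt u n p \<Longrightarrow> deg_lt u n (- p)"
  by (simp add: deg_lt_def)

lemma deg_lt_0 [simp]: "deg_lt u n 0"
  by (simp add: deg_lt_def)

lemma deg_lt_sum: "(\<And>i. i \<in> A \<Longrightarrow> deg_lt u n (f i)) \<Longrightarrow> deg_lt u n (sum f A)"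
  by (induction A rule: infinite_finite_induct) (auto intro: deg_lt_add)

lemma deg_lt_mono: "deg_lt u n p \<Longrightarrow> n \<le> k \<Longrightarrow> deg_lt u k p"
  by (auto simp: deg_lt_def)

lemma deg_lt_mult:
  assumes "deg_lt u (Suc a) p" "deg_lt u b q"
  shows "deg_lt u (a + b) (p * q)"
  unfolding deg_lt_def
proof
  fix m assume "m \<in> keys (p * q)"
  then obtain x y where "m = x + y" "x \<in> keys p" "y \<in> keys q" using keys_mult[of p q] by auto
  then show "lookup m u < a + b" using assms by (fastforce simp: deg_lt_def lookup_add)
qed

lemma deg_lt_power: "deg_lt u (Suc a) p \<Longrightarrow> deg_lt u (Suc (n * a)) (p ^ n)"
proof (induction n)
  case 0
  then show ?case by (simp add: deg_lt_def)
next
  case (Suc n)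
  then show ?case using deg_lt_mult[of u a p "Suc (n * a)" "p ^ n"] by (simp add: add.commute)
qed

lemma keys_variable [simp]: "keys (variable v) = {xv v}"
  by (simp add: variable_def)

lemma deg_lt_variable: "deg_lt u 2 (variable v)" "u \<noteq> v \<Longrightarrow> deg_lt u (Suc 0) (variable v)"
  by (auto simp: deg_lt_def lookup_single when_def)

lemma variable_power: "variable v ^ n = single (single v n) 1"
  by (induction n) (simp_all add: variable_def mult_single flip: single_add)

lemma finite_max_image:
  fixes f :: "'a \<Rightarrow> nat"
  assumes "finite B" "B \<noteq> {}"
  shows "\<exists>m\<in>B. \<forall>n\<in>B. f n \<le> f m"
proof -
  have "Max (f ` B) \<in> f ` B" using assms by (intro Max_in) auto
  then obtain m where "m \<in> B" "Max (f ` B) = f m" by auto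
  moreover have "f n \<le> Max (f ` B)" if "n \<in> B" for n using assms that by (intro Max_ge) auto
  ultimately show ?thesis by auto
qed

text \<open>The sum is monic of degree one in \<open>v\<close>, and \<open>v\<close> is a
  nonzerodivisor modulo the monomial ideal. A monomial \<open>m\<close> of \<open>q\<close> outside
  the ideal with the most factors \<open>v\<close> would leave a term at \<open>v\<close> times
  \<open>m\<close>: other contributions there come from monomials with one more \<open>v\<close>,
  and \<open>F\<close> has no \<open>v\<close> at all.\<close>

lemma variable_free_cancel:
  fixes q F :: "('v, 'k::field) mpoly"
  assumes N: "upset N" "\<And>m. N (xv v + m) \<Longrightarrow> N m"
    and Z: "finite Z" "v \<in> Z" and F: "deg_lt v 1 F" and q: "q \<in> Pol V"
    and eq: "F - (\<Sum>u\<in>Z. variable u) * q \<in> mon V N"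
  shows "q \<in> mon V N"
proof (rule ccontr)
  assume "q \<notin> mon V N"
  define B where "B = {m \<in> keys q. \<not> N m}"
  have B: "finite B" "B \<noteq> {}" using \<open>q \<notin> mon V N\<close> q by (auto simp: B_def mon_def)
  obtain m where m: "m \<in> B" "\<And>n. n \<in> B \<Longrightarrow> lookup n v \<le> lookup m v"
    using finite_max_image[OF B, of "\<lambda>m. lookup m v"] by blast
  have zero: "lookup (variable u * q) (xv v + m) = 0" if u: "u \<in> Z - {v}" for u
  proof (rule ccontr)
    assume "lookup (variable u * q) (xv v + m) \<noteq> 0"
    then have *: "lookup (xv v + m) u > 0" "lookup q (xv v + m - xv u) \<noteq> 0"
      by (auto simp: lookup_variable_times split: if_splits)
    have "lookup (xv v + m - xv u) v = Suc (lookup m v)"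
      using u by (simp add: lookup_minus lookup_add lookup_single when_def)
    then have "xv v + m - xv u \<notin> B" using m(2)[of "xv v + m - xv u"] by auto
    then have "N (xv v + m - xv u)" using * by (auto simp: B_def in_keys_iff)
    then have "N (xv v + m)" using upset_add[OF N(1)] xv_minus_add[OF *(1)] by metis
    then show False using N(2) m(1) by (auto simp: B_def)
  qed
  have "lookup ((\<Sum>u\<in>Z. variable u) * q) (xv v + m) =
      (\<Sum>u\<in>Z. lookup (variable u * q) (xv v + m))"
    by (simp add: sum_distrib_right lookup_sum)
  also have "\<dots> = lookup (variable v * q) (xv v + m) + (\<Sum>u\<in>Z - {v}. lookup (variable u * q) (xv v + m))"
    using Z by (rule sum.remove)
  also have "\<dots> = lookup q m" using zero by simp
  finally have "lookup (F - (\<Sum>u\<in>Z. variable u) * q) (xv v + m) = lookup F (xv v + m) - lookup q m"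
    by (simp add: lookup_minus)
  moreover have "lookup F (xv v + m) = 0"
  proof (rule ccontr)
    assume "lookup F (xv v + m) \<noteq> 0"
    then have "lookup (xv v + m) v < 1" using F by (auto simp only: deg_lt_def in_keys_iff)
    then show False by (simp add: lookup_add)
  qed
  ultimately have "lookup (F - (\<Sum>u\<in>Z. variable u) * q) (xv v + m) \<noteq> 0"
    using m(1) by (simp add: B_def in_keys_iff)
  then have "N (xv v + m)" using mon_lookup[OF eq] by blast
  then show False using N(2) m(1) by (auto simp: B_def)
qed

text \<open>Division with remainder by the sum, which amounts to replacing \<open>v\<close> by minus
  the sum of the other variables.\<close>

lemma eliminate_variable:
  fixes p :: "('v, 'k::field) mpoly"
  assumes Z: "finite Z" "v \<in> Z" "Z \<subseteq> V" and p: "p \<in> Pol V"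
  shows "\<exists>q\<in>Pol V. \<exists>g\<in>Pol V. p = q + (\<Sum>u\<in>Z. variable u) * g \<and> deg_lt v 1 q"
proof -
  let ?f = "\<Sum>u\<in>Z. variable u :: ('v, 'k) mpoly"
  let ?s = "\<Sum>u\<in>Z - {v}. variable u :: ('v, 'k) mpoly"
  let ?P = "\<lambda>p. \<exists>q\<in>Pol V. \<exists>g\<in>Pol V. p = q + ?f * g \<and> deg_lt v 1 q"
  have f: "?f = variable v + ?s" using Z by (intro sum.remove)
  have s: "deg_lt v 1 ?s" "?s \<in> Pol V" using Z by (auto intro!: deg_lt_sum deg_lt_variable)
  have step: "?P (variable v * p)" if "?P p" for p
  proof -
    from that obtain q g where *: "q \<in> Pol V" "g \<in> Pol V" "p = q + ?f * g" "deg_lt v 1 q" by blast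
    have "variable v * p = - (?s * q) + ?f * (q + variable v * g)"
      unfolding *(3) f by (simp add: algebra_simps)
    moreover have "deg_lt v 1 (- (?s * q))"
      using s(1) *(4) deg_lt_mult[of v 0 ?s 1 q] by (intro deg_lt_uminus) simp
    moreover have "- (?s * q) \<in> Pol V" "q + variable v * g \<in> Pol V"
      using s * Z by auto
    ultimately show ?thesis by blast
  qed
  have single: "?P (single m c)" if "keys m \<subseteq> V" for m c
    using that
  proof (induction "lookup m v" arbitrary: m)
    case 0
    then have "deg_lt v 1 (single m c :: ('v, 'k) mpoly)" by (auto simp: deg_lt_def)
    moreover have "single m c = single m c + ?f * 0" by simp
    ultimately show ?case using 0 by (metis Pol_single Pol_zero)
  next
    case (Suc n)
    then have pos: "lookup m v > 0" by simp
    have "?P (single (m - xv v) c)"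
    proof (rule Suc.hyps(1))
      show "n = lookup (m - xv v) v" using Suc by (simp add: lookup_minus)
      have "keys (m - xv v) \<subseteq> keys m" by (auto simp: in_keys_iff lookup_minus)
      then show "keys (m - xv v) \<subseteq> V" using Suc by auto
    qed
    from step[OF this] show ?case
      using xv_minus_add[OF pos] by (simp add: variable_def mult_single)
  qed
  have add: "?P (p + q)" if "?P p" "?P q" for p q
  proof -
    from that obtain a g b h where *: "a \<in> Pol V" "g \<in> Pol V" "p = a + ?f * g" "deg_lt v 1 a"
      "b \<in> Pol V" "h \<in> Pol V" "q = b + ?f * h" "deg_lt v 1 b" by blast
    then have "p + q = (a + b) + ?f * (g + h)" by (simp add: algebra_simps)
    then show ?thesis using * by (intro bexI[of _ "a + b"] bexI[of _ "g + h"]) (auto intro: deg_lt_add)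
  qed
  have "?P (\<Sum>m\<in>A. single m (lookup p m))" if "finite A" "A \<subseteq> keys p" for A
    using that
  proof (induction A rule: finite_induct)
    case empty
    have "(0 :: ('v, 'k) mpoly) = 0 + ?f * 0" by simp
    then show ?case using Pol_zero deg_lt_0 by (metis sum.empty)
  next
    case (insert m A)
    then show ?case using p by (simp only: sum.insert insert.hyps) (intro add single; auto simp: Pol_def)
  qed
  from this[of "keys p"] show ?thesis by (simp add: poly_mapping_sum_single)
qed

lemma power_leading_term:
  fixes s :: "('v, 'k::field) mpoly"
  assumes "deg_lt u 1 s"
  shows "deg_lt u n ((variable u + s) ^ n - variable u ^ n)"
proof (induction n)
  case (Suc n)
  let ?r = "(variable u + s) ^ n - variable u ^ n"
  have eq: "(variable u + s) ^ Suc n - variable u ^ Suc n = variable u * ?r + s * (variable u ^ n + ?r)"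
    by (simp add: algebra_simps)
  have "deg_lt u (1 + n) (variable u * ?r)"
    using Suc deg_lt_variable(1)[of u u] by (intro deg_lt_mult) (simp add: numeral_2_eq_2)
  moreover have "deg_lt u (0 + Suc n) (s * (variable u ^ n + ?r))"
  proof (intro deg_lt_mult deg_lt_add)
    show "deg_lt u (Suc n) (variable u ^ n :: ('v, 'k) mpoly)"
      by (simp add: variable_power deg_lt_def)
  qed (use assms deg_lt_mono[OF Suc, of "Suc n"] in auto)
  ultimately show ?case unfolding eq by (intro deg_lt_add) simp_all
qed simp

text \<open>A monomial of \<open>p\<close> outside the ideal stays outside after multiplication by a
  suitable \<open>u\<close>, and from then on powers of \<open>u\<close> can be cancelled. Choosing
  such a monomial with the most factors \<open>u\<close> isolates the product with the leading term
  of \<open>h\<close> in \<open>u\<close>.\<close>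

lemma leading_variable_cancel:
  fixes h p :: "('v, 'k::field) mpoly"
  assumes N: "upset N" and N': "\<And>u m n. u \<in> U \<Longrightarrow> N (single u n + (xv u + m)) \<Longrightarrow> N (xv u + m)"
    and U: "\<And>m. \<not> N m \<Longrightarrow> \<exists>u\<in>U. \<not> N (xv u + m)"
    and h: "\<And>u. u \<in> U \<Longrightarrow> \<exists>D c. c \<noteq> 0 \<and> deg_lt u D (h - single (single u D) c)"
    and p: "p \<in> Pol V" and hp: "h * p \<in> mon V N"
  shows "p \<in> mon V N"
proof (rule ccontr)
  assume "p \<notin> mon V N"
  then obtain m0 where m0: "m0 \<in> keys p" "\<not> N m0" using p by (auto simp: mon_def)
  from U[OF m0(2)] obtain u where u: "u \<in> U" "\<not> N (xv u + m0)" by blast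
  define B where "B = {m \<in> keys p. \<not> N (xv u + m)}"
  have B: "finite B" "B \<noteq> {}" using u m0 by (auto simp: B_def)
  obtain m where m: "m \<in> B" "\<And>n. n \<in> B \<Longrightarrow> lookup n u \<le> lookup m u"
    using finite_max_image[OF B, of "\<lambda>m. lookup m u"] by blast
  obtain D c where D: "c \<noteq> 0" "deg_lt u D (h - single (single u D) c)" using h[OF u(1)] by blast
  let ?h = "h - single (single u D) c"
  have "lookup (?h * p) (single u D + m) = 0"
  proof (rule ccontr)
    assume "lookup (?h * p) (single u D + m) \<noteq> 0"
    then obtain a b where ab: "single u D + m = a + b" "a \<in> keys ?h" "b \<in> keys p"
      using keys_mult[of ?h p] by (auto simp: in_keys_iff)
    have "lookup (single u D + m) u = lookup (a + b) u" using ab by simp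
    moreover have "lookup a u < D" using D(2) ab by (auto simp: deg_lt_def)
    ultimately have "lookup b u > lookup m u" by (simp add: lookup_add)
    then have "b \<notin> B" using m(2)[of b] by auto
    then have "N (xv u + b)" using ab by (auto simp: B_def)
    then have "N (a + (xv u + b))" by (rule upset_add[OF N])
    also have "a + (xv u + b) = xv u + (single u D + m)" unfolding ab(1) by (rule add.left_commute)
    also have "\<dots> = single u D + (xv u + m)" by (rule add.left_commute)
    finally have "N (single u D + (xv u + m))" .
    from N'[OF u(1) this] show False using m(1) by (simp add: B_def)
  qed
  moreover have "h * p = single (single u D) c * p + ?h * p" by (simp add: algebra_simps)
  ultimately have "lookup (h * p) (single u D + m) = c * lookup p m"
    by (simp only: lookup_add lookup_single_times_add add_0_right)
  then have "lookup (h * p) (single u D + m) \<noteq> 0" using D m by (simp add: B_def in_keys_iff)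
  then have "N (single u D + m)" using mon_lookup[OF hp] by blast
  then have "N (xv u + (single u D + m))" by (rule upset_add[OF N])
  then have "N (single u D + (xv u + m))" by (simp add: add.left_commute)
  from N'[OF u(1) this] show False using m(1) by (simp add: B_def)
qed

lemma power_mod:
  fixes s :: "('v, 'k::field) mpoly"
  assumes "s \<in> Pol V" "x \<in> Pol V"
  shows "\<exists>t\<in>Pol V. x ^ n = (- s) ^ n + (x + s) * t"
proof (induction n)
  case (Suc n)
  then obtain t where t: "t \<in> Pol V" "x ^ n = (- s) ^ n + (x + s) * t" by blast
  have "x ^ Suc n = x * ((- s) ^ n + (x + s) * t)" using t by simp
  also have "\<dots> = (- s) ^ Suc n + (x + s) * (x * t + (- s) ^ n)" by (simp add: algebra_simps)
  finally show ?case using t assms by (intro bexI[of _ "x * t + (- s) ^ n"]) auto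
qed (auto intro!: bexI[of _ 0])

text \<open>In terms of \<open>u\<close> the two candidates for the leading term are
  \<open>u ^ d u\<close> and, up to sign, \<open>u ^ d v\<close>. Distinct exponents prevent
  cancellation, whatever the characteristic.\<close>

lemma power_sum_leading:
  fixes s :: "('v, 'k::field) mpoly"
  assumes Z: "finite Z" "v \<in> Z" "u \<in> Z" "u \<noteq> v"
    and d: "inj_on d Z" "\<And>w. w \<in> Z \<Longrightarrow> d w > 0"
    and s: "s = (\<Sum>w\<in>Z - {v}. variable w)"
  shows "\<exists>D c. c \<noteq> 0 \<and> deg_lt u D ((- s) ^ d v + (\<Sum>w\<in>Z - {v}. variable w ^ d w) - single (single u D) c)"
proof -
  let ?s = "\<Sum>w\<in>Z - {v} - {u}. variable w :: ('v, 'k) mpoly"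
  let ?t = "\<Sum>w\<in>Z - {v} - {u}. variable w ^ d w :: ('v, 'k) mpoly"
  have s': "s = variable u + ?s" unfolding s using Z by (intro sum.remove) auto
  have t': "(\<Sum>w\<in>Z - {v}. variable w ^ d w) = variable u ^ d u + ?t" using Z by (intro sum.remove) auto
  have deg_s: "deg_lt u 1 ?s" by (auto intro!: deg_lt_sum deg_lt_variable(2))
  have deg_s2: "deg_lt u 2 s"
    unfolding s' using deg_lt_mono[OF deg_s] by (intro deg_lt_add deg_lt_variable) auto
  have deg_t: "deg_lt u 1 ?t"
  proof (intro deg_lt_sum)
    fix w assume "w \<in> Z - {v} - {u}"
    then have "deg_lt u 1 (variable w :: ('v, 'k) mpoly)" using deg_lt_variable(2)[of u w] by auto
    then show "deg_lt u 1 (variable w ^ d w :: ('v, 'k) mpoly)"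
      using deg_lt_power[of u 0 "variable w" "d w"] by simp
  qed
  have "d u \<noteq> d v" using d(1) Z by (auto dest: inj_onD)
  then consider "d u > d v" | "d v > d u" by linarith
  then show ?thesis
  proof cases
    case 1
    have "deg_lt u (d u) ((- s) ^ d v)"
    proof (rule deg_lt_mono)
      show "deg_lt u (Suc (d v * 1)) ((- s) ^ d v)"
        using deg_lt_uminus[OF deg_s2] by (intro deg_lt_power) (simp add: numeral_2_eq_2)
    qed (use 1 in simp)
    moreover have "deg_lt u (d u) ?t"
      using d(2)[OF Z(3)] by (intro deg_lt_mono[OF deg_t]) simp
    ultimately have "deg_lt u (d u) ((- s) ^ d v + ?t)" by (rule deg_lt_add)
    then show ?thesis unfolding t'
      by (intro exI[of _ "d u"] exI[of _ 1]) (simp add: variable_power add.commute add.left_commute)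
  next
    case 2
    let ?c = "(- 1) ^ d v :: 'k"
    have c: "(- 1 :: ('v, 'k) mpoly) ^ n = single 0 ((- 1) ^ n)" for n
      by (induction n) (simp_all add: single_uminus)
    have "(- s) ^ d v = (- 1) ^ d v * s ^ d v" by (rule power_minus)
    also have "\<dots> = (- 1) ^ d v * (s ^ d v - variable u ^ d v) + (- 1) ^ d v * variable u ^ d v"
      by (simp add: algebra_simps)
    also have "(- 1) ^ d v * variable u ^ d v = single (single u (d v)) ?c"
      unfolding c by (simp add: variable_power mult_single)
    finally have eq: "(- s) ^ d v + (variable u ^ d u + ?t) - single (single u (d v)) ?c =
      (- 1) ^ d v * (s ^ d v - variable u ^ d v) + variable u ^ d u + ?t" by (simp add: algebra_simps)
    have "deg_lt u (d v) (s ^ d v - variable u ^ d v)"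
      unfolding s' by (rule power_leading_term[OF deg_s])
    then have "deg_lt u (0 + d v) ((- 1) ^ d v * (s ^ d v - variable u ^ d v))"
      unfolding c by (intro deg_lt_mult) (simp_all add: deg_lt_def)
    moreover have "deg_lt u (d v) (variable u ^ d u :: ('v, 'k) mpoly)"
      using 2 by (simp add: variable_power deg_lt_def)
    moreover have "deg_lt u (d v) ?t"
      using d(2)[OF Z(2)] by (intro deg_lt_mono[OF deg_t]) simp
    ultimately have "deg_lt u (d v) ((- 1) ^ d v * (s ^ d v - variable u ^ d v) + variable u ^ d u + ?t)"
      by (intro deg_lt_add) simp_all
    then show ?thesis unfolding t' eq[symmetric]
      by (intro exI[of _ "d v"] exI[of _ ?c]) simp
  qed
qed

text \<open>Modulo the first sum \<open>p\<close> becomes a remainder \<open>r\<close> without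
  \<open>v\<close>, and the sum of powers becomes \<open>h\<close>, also without \<open>v\<close>.
  Uniqueness of remainders turns the relation into \<open>h * r\<close> lying in the ideal, and the
  leading terms of \<open>h\<close> cancel it.\<close>

lemma power_sum_star:
  fixes p q :: "('v, 'k::field) mpoly"
  assumes N: "upset N" "\<And>m. N (xv v + m) \<Longrightarrow> N m"
    and N': "\<And>u m n. u \<in> Z \<Longrightarrow> N (single u n + (xv u + m)) \<Longrightarrow> N (xv u + m)"
    and U: "\<And>m. \<not> N m \<Longrightarrow> \<exists>u\<in>Z - {v}. \<not> N (xv u + m)"
    and Z: "finite Z" "v \<in> Z" "Z \<subseteq> V"
    and d: "inj_on d Z" "\<And>w. w \<in> Z \<Longrightarrow> d w > 0"
    and pq: "p \<in> Pol V" "q \<in> Pol V"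
    and eq: "(\<Sum>u\<in>Z. variable u ^ d u) * p - (\<Sum>u\<in>Z. variable u) * q \<in> mon V N"
  shows "\<exists>g\<in>Pol V. p - (\<Sum>u\<in>Z. variable u) * g \<in> mon V N"
proof -
  let ?f = "\<Sum>u\<in>Z. variable u :: ('v, 'k) mpoly"
  let ?f2 = "\<Sum>u\<in>Z. variable u ^ d u :: ('v, 'k) mpoly"
  define s where "s = (\<Sum>w\<in>Z - {v}. variable w :: ('v, 'k) mpoly)"
  define h where "h = (- s) ^ d v + (\<Sum>w\<in>Z - {v}. variable w ^ d w)"
  note K = pideal_mon[OF N(1), of V, where 'k = 'k]
  have f: "?f = variable v + s" unfolding s_def using Z by (intro sum.remove)
  have f2: "?f2 = variable v ^ d v + (\<Sum>w\<in>Z - {v}. variable w ^ d w)" using Z by (intro sum.remove)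
  have s: "s \<in> Pol V" "variable v \<in> (Pol V :: ('v, 'k) mpoly set)" "deg_lt v 1 s"
    unfolding s_def using Z by (auto intro!: deg_lt_sum deg_lt_variable)
  have P: "h \<in> Pol V" "?f \<in> Pol V" "?f2 \<in> Pol V"
    unfolding h_def using s Z by (auto intro!: Pol_add Pol_sum Pol_power Pol_uminus)
  obtain t where t: "t \<in> Pol V" "variable v ^ d v = (- s) ^ d v + ?f * t"
    using power_mod[OF s(1,2), of "d v"] f by auto
  obtain r g where r: "r \<in> Pol V" "g \<in> Pol V" "p = r + ?f * g" "deg_lt v 1 r"
    using eliminate_variable[OF Z pq(1)] by blast
  have hf: "?f2 = h + ?f * t" unfolding f2 h_def t(2) by (simp add: algebra_simps)
  have "?f2 * p - ?f * q = h * r - ?f * (q - h * g - t * p)"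
    unfolding hf r(3) by (simp add: algebra_simps)
  then have *: "h * r - ?f * (q - h * g - t * p) \<in> mon V N" using eq by simp
  have "deg_lt v 1 h"
    unfolding h_def
  proof (intro deg_lt_add deg_lt_sum)
    show "deg_lt v 1 ((- s) ^ d v)"
      using deg_lt_power[of v 0 "- s" "d v"] deg_lt_uminus[OF s(3)] by simp
    fix w assume "w \<in> Z - {v}"
    then have "deg_lt v 1 (variable w :: ('v, 'k) mpoly)" using deg_lt_variable(2)[of v w] by auto
    then show "deg_lt v 1 (variable w ^ d w :: ('v, 'k) mpoly)"
      using deg_lt_power[of v 0 "variable w" "d w"] by simp
  qed
  then have "deg_lt v 1 (h * r)" using deg_lt_mult[of v 0 h 1 r] r(4) by simp
  then have "q - h * g - t * p \<in> mon V N"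
    using pq r t P by (intro variable_free_cancel[OF N Z(1,2) _ _ *]) auto
  then have "?f * (q - h * g - t * p) \<in> mon V N" using P by (intro pideal_mult[OF K])
  from pideal_diff_cancel[OF K * this] have hr: "h * r \<in> mon V N" .
  have "r \<in> mon V N"
  proof (rule leading_variable_cancel[OF N(1) _ _ _ r(1) hr, where U = "Z - {v}"])
    show "\<exists>D c. c \<noteq> 0 \<and> deg_lt u D (h - single (single u D) c)" if "u \<in> Z - {v}" for u
      unfolding h_def using that by (intro power_sum_leading[OF Z(1,2) _ _ d s_def]) auto
    show "N (xv u + m)" if "u \<in> Z - {v}" "N (single u n + (xv u + m))" for u m n
      using that by (intro N') auto
  qed (use U in auto)
  then show ?thesis using r by (intro bexI[of _ g]) auto
qed

lemma edgy_cong: "keys m = keys n \<Longrightarrow> edgy E m = edgy E n"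
  by (simp add: edgy_def)

text \<open>On the star of each vertex \<open>v\<close> of \<open>Z\<close> a quotient \<open>G v\<close> of \<open>p\<close> by the sum of the variables is
  found; two of these agree on the intersection of the stars, and connectivity of the complement of
  the graph glues them, including their constant terms.\<close>

theorem nonzerodivisor_sum_powers:
  fixes V :: "'v set"
  assumes E: "\<And>a b. E a b \<Longrightarrow> E b a" "\<And>a. \<not> E a a" "\<And>a b. E a b \<Longrightarrow> a \<in> Z \<Longrightarrow> b \<in> Z"
    and conn: "\<And>u v. u \<in> Z \<Longrightarrow> v \<in> Z \<Longrightarrow> (\<lambda>a b. a \<in> Z \<and> b \<in> Z \<and> \<not> E a b)\<^sup>*\<^sup>* u v"
    and nonnbr: "\<And>v. v \<in> Z \<Longrightarrow> \<exists>u\<in>Z. u \<noteq> v \<and> \<not> E v u"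
    and Z: "finite Z" "Z \<noteq> {}" "Z \<subseteq> V"
    and d: "inj_on d Z" "\<And>w. w \<in> Z \<Longrightarrow> d w > 0"
  shows "nonzerodivisor V (ideal_adjoin V (mon V (edgy E) :: ('v, 'k::field) mpoly set) (\<Sum>v\<in>Z. variable v))
    (\<Sum>v\<in>Z. variable v ^ d v)"
  unfolding nonzerodivisor_def
proof (intro ballI impI)
  let ?f = "\<Sum>v\<in>Z. variable v :: ('v, 'k) mpoly"
  let ?f2 = "\<Sum>v\<in>Z. variable v ^ d v :: ('v, 'k) mpoly"
  let ?N = "\<lambda>v m. edgy E (xv v + m)"
  fix p :: "('v, 'k) mpoly"
  assume p: "p \<in> Pol V" and "?f2 * p \<in> ideal_adjoin V (mon V (edgy E)) ?f"
  then obtain q where q: "q \<in> Pol V" "?f2 * p - ?f * q \<in> mon V (edgy E)"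
    by (auto simp: ideal_adjoin_def mult.commute)
  have up: "upset (?N v)" for v
    by (auto simp: upset_def edgy_def keys_add_nat)
  have up2: "upset (\<lambda>m. ?N u (xv v + m))" for u v
    by (auto simp: upset_def edgy_def keys_add_nat)
  have f: "?f \<in> Pol V" using Z by auto
  have "\<exists>g\<in>Pol V. p - ?f * g \<in> mon V (?N v)" if v: "v \<in> Z" for v
  proof (rule power_sum_star[OF up _ _ _ Z(1) v Z(3) d p q(1)])
    show "?N v m" if "?N v (xv v + m)" for m
      using that by (simp add: edgy_def keys_add_nat)
    show "?N v (xv u + m)" if "?N v (single u n + (xv u + m))" for u m n
    proof -
      have "keys (xv v + (single u n + (xv u + m))) = keys (xv v + (xv u + m))"
        by (auto simp: keys_add_nat)
      from edgy_cong[OF this, of E] that show ?thesis by simp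
    qed
    show "?f2 * p - ?f * q \<in> mon V (?N v)"
      using q(2) by (auto simp: mon_def upset_add[OF upset_edgy])
    show "\<exists>u\<in>Z - {v}. \<not> ?N v (xv u + m)" if m: "\<not> ?N v m" for m
    proof (cases "\<exists>u\<in>Z - {v}. u \<in> keys m")
      case True
      then obtain u where u: "u \<in> Z - {v}" "u \<in> keys m" by blast
      then have "keys (xv v + (xv u + m)) = keys (xv v + m)" by (auto simp: keys_add_nat)
      from edgy_cong[OF this, of E] m have "\<not> ?N v (xv u + m)" by simp
      then show ?thesis using u by blast
    next
      case False
      \<comment> \<open>The monomial has no vertex of \<open>Z\<close> except possibly
        \<open>v\<close>, so adjoining any nonneighbour of \<open>v\<close> creates no edge.\<close>
      obtain u where u: "u \<in> Z" "u \<noteq> v" "\<not> E v u" using nonnbr[OF v] by blast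
      have "\<not> ?N v (xv u + m)"
      proof
        assume "?N v (xv u + m)"
        then obtain a b where ab: "E a b" "a \<in> insert v (insert u (keys m))" "b \<in> insert v (insert u (keys m))"
          by (auto simp: edgy_def keys_add_nat)
        have "\<not> (a \<in> insert v (keys m) \<and> b \<in> insert v (keys m))"
          using m ab(1) by (auto simp: edgy_def keys_add_nat)
        then have "a = u \<or> b = u" using ab by auto
        then show False
          using ab u v E False by (metis Diff_iff insertE singletonD)
      qed
      then show ?thesis using u by blast
    qed
  qed
  then obtain G where G: "\<And>v. v \<in> Z \<Longrightarrow> G v \<in> Pol V" "\<And>v. v \<in> Z \<Longrightarrow> p - ?f * G v \<in> mon V (?N v)"
    by metis
  \<comment> \<open>\<open>?K\<close> is the colon of the edge ideal by \<open>u\<close> and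
    \<open>v\<close>. Two quotients differ by something the sum of the variables sends into
    \<open>?K\<close>, and division with zero left side shows that the difference is in
    \<open>?K\<close>.\<close>
  have eq2: "lookup (G u) m = lookup (G v) m"
    if uv: "u \<in> Z" "v \<in> Z" and m: "\<not> edgy E (xv u + (xv v + m))" for u v m
  proof -
    let ?K = "\<lambda>m. edgy E (xv u + (xv v + m))"
    have "mon V (?N u) \<subseteq> (mon V ?K :: ('v, 'k) mpoly set)" "mon V (?N v) \<subseteq> (mon V ?K :: ('v, 'k) mpoly set)"
      by (auto simp: mon_def edgy_def keys_add_nat)
    then have "p - ?f * G u \<in> mon V ?K" "p - ?f * G v \<in> mon V ?K" using G(2) uv by blast+
    from pideal_minus[OF pideal_mon[OF up2] this]
    have "0 - ?f * (G u - G v) \<in> mon V ?K" by (simp add: algebra_simps)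
    then have "G u - G v \<in> mon V ?K"
      using G(1) uv
      by (intro variable_free_cancel[OF up2 _ Z(1) uv(2) _ _ \<open>0 - ?f * (G u - G v) \<in> mon V ?K\<close>])
        (auto simp: edgy_def keys_add_nat)
    from mon_lookup[OF this] m show ?thesis by (simp add: lookup_minus)
  qed
  have eq: "lookup (G u) m = lookup (G v) m"
    if uv: "u \<in> Z" "v \<in> Z" and m: "\<not> ?N u m" "\<not> ?N v m" for u v m
  proof (cases "\<exists>w\<in>Z. w \<in> keys m")
    case True
    then obtain w where w: "w \<in> Z" "w \<in> keys m" by blast
    have "keys (xv u + (xv w + m)) = keys (xv u + m)" "keys (xv v + (xv w + m)) = keys (xv v + m)"
      using w by (auto simp: keys_add_nat)
    from this[THEN edgy_cong, of E] m have "\<not> edgy E (xv u + (xv w + m))" "\<not> edgy E (xv v + (xv w + m))"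
      by simp_all
    then show ?thesis using eq2[of u w m] eq2[of v w m] uv w by simp
  next
    case False
    \<comment> \<open>For monomials without vertices of \<open>Z\<close> there is no common vertex
      to compare at, so equality travels along a path in the complement graph.\<close>
    have step: "lookup (G a) m = lookup (G b) m" if ab: "a \<in> Z" "b \<in> Z" "\<not> E a b" for a b
    proof (intro eq2 ab notI)
      assume "edgy E (xv a + (xv b + m))"
      then obtain x y where xy: "E x y" "x \<in> {a, b} \<union> keys m" "y \<in> {a, b} \<union> keys m"
        by (auto simp: edgy_def keys_add_nat)
      have "\<not> (x \<in> keys m \<and> y \<in> keys m)" using xy(1) m(1) by (auto simp: edgy_def keys_add_nat)
      then show False using xy ab E False by blast
    qed
    show ?thesis
      using conn[OF uv] by (induction rule: rtranclp_induct) (use step in auto)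
  qed
  define S where "S = {m \<in> (\<Union>v\<in>Z. keys (G v)). \<exists>v\<in>Z. \<not> ?N v m}"
  define sel where "sel = (\<lambda>m. SOME v. v \<in> Z \<and> \<not> ?N v m)"
  define g where "g = (\<Sum>m\<in>S. single m (lookup (G (sel m)) m))"
  have "finite S" unfolding S_def using Z by auto
  then have lookup_g: "lookup g m = (if m \<in> S then lookup (G (sel m)) m else 0)" for m
    unfolding g_def lookup_sum by (simp add: lookup_single when_def)
  have g_eq: "lookup g m = lookup (G v) m" if v: "v \<in> Z" "\<not> ?N v m" for v m
  proof (cases "m \<in> S")
    case True
    have "sel m \<in> Z \<and> \<not> ?N (sel m) m" unfolding sel_def by (rule someI[of _ v]) (use v in auto)
    then show ?thesis using True eq[of "sel m" v m] v by (simp add: lookup_g)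
  next
    case False
    then show ?thesis using v by (auto simp: lookup_g S_def in_keys_iff)
  qed
  have "g \<in> Pol V"
    unfolding g_def
  proof (intro Pol_sum Pol_single)
    show "keys m \<subseteq> V" if "m \<in> S" for m using that G(1) by (fastforce simp: S_def Pol_def)
  qed
  have "p - ?f * g \<in> mon V (edgy E)"
  proof -
    have "lookup (p - ?f * g) m = 0" if m: "\<not> edgy E m" for m
    proof -
      have "\<exists>v\<in>Z. \<not> ?N v m"
      proof (cases "\<exists>v\<in>Z. v \<in> keys m")
        case True
        then obtain v where v: "v \<in> Z" "v \<in> keys m" by blast
        then have "keys (xv v + m) = keys m" by (auto simp: keys_add_nat)
        from edgy_cong[OF this, of E] m v show ?thesis by auto
      next
        case False
        obtain v where v: "v \<in> Z" using Z by blast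
        have "\<not> ?N v m"
        proof
          assume "?N v m"
          then obtain x y where xy: "E x y" "x \<in> insert v (keys m)" "y \<in> insert v (keys m)"
            by (auto simp: edgy_def keys_add_nat)
          have "\<not> (x \<in> keys m \<and> y \<in> keys m)" using xy(1) m by (auto simp: edgy_def)
          then show False using xy v E False by blast
        qed
        then show ?thesis using v by blast
      qed
      then obtain v where v: "v \<in> Z" "\<not> ?N v m" by blast
      have times: "lookup (?f * h) m = (\<Sum>w\<in>Z. lookup (variable w * h) m)" for h
        by (simp add: sum_distrib_right lookup_sum)
      \<comment> \<open>Dividing a monomial in the star of \<open>v\<close> by a variable stays in
        that star, where the glued \<open>g\<close> has the coefficients of
        \<open>G v\<close>.\<close>
      have "lookup (variable w * g) m = lookup (variable w * G v) m" for w
      proof (cases "lookup m w > 0")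
        case True
        have "xv v + m = xv w + (xv v + (m - xv w))"
          using xv_minus_add[OF True] by (metis add.left_commute)
        then have "\<not> ?N v (m - xv w)" using v(2) upset_add[OF upset_edgy] by metis
        then show ?thesis using g_eq[OF v(1)] by (simp add: lookup_variable_times)
      qed (simp add: lookup_variable_times)
      then have "lookup (?f * g) m = lookup (?f * G v) m" by (simp add: times)
      moreover have "lookup (p - ?f * G v) m = 0" using G(2)[OF v(1)] v(2) by (rule mon_lookup)
      ultimately show ?thesis by (simp add: lookup_minus)
    qed
    moreover have "p - ?f * g \<in> Pol V" using p f \<open>g \<in> Pol V\<close> by auto
    ultimately show ?thesis using mon_iff by blast
  qed
  then show "p \<in> ideal_adjoin V (mon V (edgy E)) ?f"
    using p \<open>g \<in> Pol V\<close> by (auto simp: ideal_adjoin_def mult.commute)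
qed

subsection \<open>Walks and edge products\<close>

locale adjacency =
  fixes V :: "'v set" and E :: "'v \<Rightarrow> 'v \<Rightarrow> bool"
  assumes finite_V: "finite V"
    and E_V: "E u v \<Longrightarrow> u \<in> V \<and> v \<in> V"
    and E_sym: "E u v \<Longrightarrow> E v u"
    and E_irrefl: "\<not> E u u"
    and E_ex: "u \<in> V \<Longrightarrow> \<exists>v. E u v"
begin

text \<open>\<open>walk True\<close> and \<open>walk False\<close> relate the end points of walks of odd and even length.\<close>

inductive walk :: "bool \<Rightarrow> 'v \<Rightarrow> 'v \<Rightarrow> bool" where
  walk_refl: "u \<in> V \<Longrightarrow> walk False u u"
| walk_step: "walk p u v \<Longrightarrow> E v w \<Longrightarrow> walk (\<not> p) u w"

lemma walk_V: "walk p u v \<Longrightarrow> u \<in> V \<and> v \<in> V"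
  by (induction rule: walk.induct) (auto dest: E_V)

lemma walk_edge: "E u v \<Longrightarrow> walk True u v"
  using walk_step[OF walk_refl, of u v] E_V by auto

lemma walk_trans: "walk q v w \<Longrightarrow> walk p u v \<Longrightarrow> walk (p \<noteq> q) u w"
proof (induction arbitrary: p u rule: walk.induct)
  case (walk_step q v x w)
  have "(\<not> (p \<noteq> q)) = (p \<noteq> (\<not> q))" by auto
  then show ?case
    using walk.walk_step[OF walk_step.IH[OF walk_step.prems] walk_step.hyps(2)] by simp
qed simp

lemma walk_sym: "walk p u v \<Longrightarrow> walk p v u"
proof (induction rule: walk.induct)
  case (walk_step p u v w)
  then show ?case using walk_trans[OF walk_step.IH walk_edge[OF E_sym[OF walk_step.hyps(2)]]] by simp
qed (rule walk_refl)

definition conn :: "'v \<Rightarrow> 'v \<Rightarrow> bool" where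
  "conn u v \<longleftrightarrow> (\<exists>p. walk p u v)"

lemma walk_conn: "walk p u v \<Longrightarrow> conn u v"
  by (auto simp: conn_def)

lemma conn_refl: "u \<in> V \<Longrightarrow> conn u u"
  and conn_sym: "conn u v \<Longrightarrow> conn v u"
  and conn_trans: "conn u v \<Longrightarrow> conn v w \<Longrightarrow> conn u w"
  and conn_V: "conn u v \<Longrightarrow> u \<in> V \<and> v \<in> V"
  unfolding conn_def by (blast intro: walk_refl walk_sym walk_trans dest: walk_V)+

lemma conn_iff: "conn u v \<longleftrightarrow> walk True u v \<or> walk False u v"
  unfolding conn_def by (metis (full_types))

lemma conn_edge: "E u v \<Longrightarrow> conn u v"
  using walk_edge walk_conn by blast

text \<open>Connected vertices have the same predicate \<open>conn v\<close>, so the choice depends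
  on the component only.\<close>

definition root :: "'v \<Rightarrow> 'v" where
  "root v = (SOME u. conn v u)"

lemma conn_root: "v \<in> V \<Longrightarrow> conn v (root v)"
  unfolding root_def by (rule someI, rule conn_refl)

lemma root_eq: "conn u v \<Longrightarrow> root u = root v"
proof -
  assume "conn u v"
  then have "conn u = conn v" by (auto simp: fun_eq_iff intro: conn_sym conn_trans)
  then show ?thesis by (simp add: root_def)
qed

definition roots :: "'v set" where
  "roots = root ` V"

definition bip_roots :: "'v set" where
  "bip_roots = {r \<in> roots. \<not> walk True r r}"

lemma roots_V: "roots \<subseteq> V"
  using conn_root conn_V by (auto simp: roots_def)

lemma root_in_roots: "v \<in> V \<Longrightarrow> root v \<in> roots"
  by (auto simp: roots_def)

lemma root_root: "r \<in> roots \<Longrightarrow> root r = r"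
  using root_eq[OF conn_root] by (auto simp: roots_def)

lemma roots_conn_eq: "r \<in> roots \<Longrightarrow> s \<in> roots \<Longrightarrow> conn r s \<Longrightarrow> r = s"
  using root_eq root_root by metis

lemma finite_roots: "finite roots"
  by (simp add: roots_def finite_V)

section \<open>Products of edges and powers of the edge ideal\<close>

inductive edge_prod :: "nat \<Rightarrow> ('v \<Rightarrow>\<^sub>0 nat) \<Rightarrow> bool" where
  edge_prod_0: "edge_prod 0 0"
| edge_prod_Suc: "E a b \<Longrightarrow> edge_prod k m \<Longrightarrow> edge_prod (Suc k) (xv a + (xv b + m))"

definition power_mon :: "nat \<Rightarrow> ('v \<Rightarrow>\<^sub>0 nat) \<Rightarrow> bool" where
  "power_mon k m \<longleftrightarrow> (\<exists>n n'. edge_prod k n \<and> m = n + n')"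

lemma edge_prod_power_mon: "edge_prod k m \<Longrightarrow> power_mon k m"
  unfolding power_mon_def by (metis add_0_right)

lemma upset_power_mon: "upset (power_mon k)"
  unfolding upset_def power_mon_def by (metis add.assoc add.commute)

lemma power_mon_0: "power_mon 0 m"
  unfolding power_mon_def using edge_prod_0 by (intro exI[of _ 0] exI[of _ m]) simp

lemma edge_prod_Suc_iff: "edge_prod (Suc k) m \<longleftrightarrow> (\<exists>a b n. E a b \<and> edge_prod k n \<and> m = xv a + (xv b + n))"
  by (subst edge_prod.simps) auto

lemma edge_prod_add: "edge_prod k m \<Longrightarrow> edge_prod l n \<Longrightarrow> edge_prod (k + l) (m + n)"
  by (induction rule: edge_prod.induct) (auto simp: add.assoc intro: edge_prod_Suc)

lemma power_mon_Suc_iff: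
  "power_mon (Suc k) m \<longleftrightarrow> (\<exists>a b n. E a b \<and> power_mon k n \<and> m = xv a + (xv b + n))"
proof
  assume "power_mon (Suc k) m"
  then obtain a b n n' where "E a b" "edge_prod k n" "m = xv a + (xv b + n) + n'"
    by (auto simp: power_mon_def edge_prod_Suc_iff)
  then show "\<exists>a b n. E a b \<and> power_mon k n \<and> m = xv a + (xv b + n)"
    by (intro exI[of _ a] exI[of _ b] exI[of _ "n + n'"]) (auto simp: power_mon_def add.assoc)
next
  assume "\<exists>a b n. E a b \<and> power_mon k n \<and> m = xv a + (xv b + n)"
  then obtain a b n n' where "E a b" "edge_prod k n" "m = xv a + (xv b + (n + n'))"
    by (auto simp: power_mon_def)
  then show "power_mon (Suc k) m"
    unfolding power_mon_def
    by (intro exI[of _ "xv a + (xv b + n)"] exI[of _ n']) (auto simp: add.assoc intro: edge_prod_Suc)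
qed

lemma power_mon_1: "power_mon (Suc 0) m \<longleftrightarrow> edgy E m"
proof
  assume "power_mon (Suc 0) m"
  then show "edgy E m"
    unfolding power_mon_Suc_iff by (auto simp: edgy_def keys_add_nat)
next
  assume "edgy E m"
  then obtain a b where ab: "E a b" "a \<in> keys m" "b \<in> keys m" by (auto simp: edgy_def)
  then have m: "m = xv a + (m - xv a)"
    using xv_minus_add[of m a] by (auto simp: in_keys_iff)
  have "a \<noteq> b" using ab E_irrefl by auto
  then have "lookup (m - xv a) b > 0"
    using ab by (auto simp: in_keys_iff lookup_minus lookup_single when_def)
  from xv_minus_add[OF this] m have "m = xv a + (xv b + (m - xv a - xv b))" by simp
  then show "power_mon (Suc 0) m"
    unfolding power_mon_Suc_iff using ab power_mon_0 by blast
qed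

lemma Idl_edges:
  "Idl\<^bsub>mpoly_ring V\<^esub> {variable u * variable v |u v. E u v} =
    (mon V (power_mon (Suc 0)) :: ('v, 'k::field) mpoly set)" (is "Idl\<^bsub>_\<^esub> ?A = ?M")
proof
  have var: "variable u * variable v = (single (xv u + xv v) 1 :: ('v, 'k) mpoly)" for u v
    by (simp add: variable_def mult_single)
  have edge: "power_mon (Suc 0) (xv u + xv v)" "keys (xv u + xv v) \<subseteq> V" if "E u v" for u v
    using that E_V[OF that] by (auto simp: power_mon_1 edgy_def keys_add_nat)
  show "Idl\<^bsub>mpoly_ring V\<^esub> ?A \<subseteq> ?M"
    by (intro Idl_minimal pideal_mon upset_power_mon) (auto simp: var intro!: mon_single edge)
  have A: "?A \<subseteq> Pol V" by (auto simp: var intro!: Pol_single dest: edge(2))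
  note I = pideal_Idl[OF A]
  show "?M \<subseteq> Idl\<^bsub>mpoly_ring V\<^esub> ?A"
  proof
    fix p :: "('v, 'k) mpoly" assume p: "p \<in> ?M"
    have "single m (lookup p m) \<in> Idl\<^bsub>mpoly_ring V\<^esub> ?A" if m: "m \<in> keys p" for m
    proof -
      obtain a b n where ab: "E a b" "m = xv a + (xv b + n)"
        using p m by (auto simp: mon_def power_mon_Suc_iff)
      have "keys m \<subseteq> V" using p m by (auto simp: mon_def Pol_def)
      then have "keys n \<subseteq> V" by (auto simp: ab(2) keys_add_nat)
      moreover have "variable a * variable b \<in> Idl\<^bsub>mpoly_ring V\<^esub> ?A"
        using Idl_superset[OF A] ab by blast
      ultimately have "single n (lookup p m) * (variable a * variable b) \<in> Idl\<^bsub>mpoly_ring V\<^esub> ?A"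
        by (rule pideal_mult[OF I Pol_single])
      then show ?thesis using ab by (simp add: var mult_single add.commute add.left_commute)
    qed
    then have "(\<Sum>m\<in>keys p. single m (lookup p m)) \<in> Idl\<^bsub>mpoly_ring V\<^esub> ?A"
      by (intro pideal_sum[OF I])
    then show "p \<in> Idl\<^bsub>mpoly_ring V\<^esub> ?A" by (simp add: poly_mapping_sum_single)
  qed
qed

lemma power_Idl_edges:
  "mon V (power_mon (Suc 0)) [^]\<^bsub>ideals_set (mpoly_ring V)\<^esub> k =
    (mon V (power_mon k) :: ('v, 'k::field) mpoly set)"
proof (induction k)
  case 0
  then show ?case by (simp add: nat_pow_def ideals_set_def mon_def power_mon_0)
next
  case (Suc k)
  have "mon V (power_mon (Suc 0)) [^]\<^bsub>ideals_set (mpoly_ring V)\<^esub> Suc k =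
    (mon V (power_mon k) \<cdot>\<^bsub>mpoly_ring V\<^esub> mon V (power_mon (Suc 0)) :: ('v, 'k) mpoly set)"
    using Suc by (simp add: nat_pow_def ideals_set_def)
  also have "\<dots> = mon V (\<lambda>m. \<exists>a b. power_mon k a \<and> power_mon (Suc 0) b \<and> m = a + b)"
    by (intro ideal_prod_mon upset_power_mon)
  also have "\<dots> = mon V (power_mon (Suc k))"
  proof (intro mon_eqI iffI)
    fix m assume "\<exists>a b. power_mon k a \<and> power_mon (Suc 0) b \<and> m = a + b"
    then obtain n u v l where "power_mon k n" "E u v" "m = n + (xv u + (xv v + l))"
      by (auto simp: power_mon_Suc_iff)
    moreover from this have "power_mon k (n + l)" using upset_add'[OF upset_power_mon] by blast
    ultimately show "power_mon (Suc k) m"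
      unfolding power_mon_Suc_iff
      by (intro exI[of _ u] exI[of _ v] exI[of _ "n + l"]) (simp add: add.left_commute)
  next
    fix m assume "power_mon (Suc k) m"
    then obtain u v n where *: "E u v" "power_mon k n" "m = xv u + (xv v + n)"
      by (auto simp: power_mon_Suc_iff)
    then have "power_mon (Suc 0) (xv u + (xv v + 0))" unfolding power_mon_Suc_iff using power_mon_0 by blast
    then have "power_mon (Suc 0) (xv u + xv v)" by simp
    moreover have "m = n + (xv u + xv v)" using * by (simp add: add.commute add.left_commute)
    ultimately show "\<exists>a b. power_mon k a \<and> power_mon (Suc 0) b \<and> m = a + b" using * by blast
  qed
  finally show ?case .
qed

text \<open>Multiply alternate edges of the walk: every inner position lies on one edge of each of
  the two classes, so the two products differ only by the end points. For odd length one class has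
  an edge more.\<close>

lemma walk_edge_prod:
  "walk p v w \<Longrightarrow> \<exists>e m n. edge_prod e m \<and>
    (if p then edge_prod (Suc e) n \<and> xv v + (xv w + m) = n else edge_prod e n \<and> xv v + m = xv w + n)"
proof (induction rule: walk.induct)
  case (walk_refl u)
  then show ?case using edge_prod_0 by auto
next
  case (walk_step p v w z)
  show ?case
  proof (cases p)
    case True
    then obtain e m where m: "edge_prod e m" "edge_prod (Suc e) (xv v + (xv w + m))"
      using walk_step.IH by auto
    have "xv v + (xv z + (xv w + m)) = xv z + (xv v + (xv w + m))" by (rule add.left_commute)
    then show ?thesis
      using True m edge_prod_Suc[OF E_sym[OF walk_step.hyps(2)] m(1)] by auto
  next
    case False
    then obtain e m n where m: "edge_prod e m" "edge_prod e n" "xv v + m = xv w + n"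
      using walk_step.IH by auto
    have "xv v + (xv z + m) = xv z + (xv w + n)"
      using m(3) by (metis add.left_commute)
    also have "\<dots> = xv w + (xv z + n)" by (rule add.left_commute)
    finally show ?thesis
      using False m(1) edge_prod_Suc[OF walk_step.hyps(2) m(2)]
      by (intro exI[of _ e] exI[of _ m] exI[of _ "xv w + (xv z + n)"]) simp
  qed
qed

text \<open>Every pair joined by an odd walk has its own absorbing product, and multiplying by
  further edges preserves absorption. There are finitely many pairs, so one product serves
  all.\<close>

lemma ex_absorbing_edge_prod:
  "\<exists>e m. edge_prod e m \<and> (\<forall>v w. walk True v w \<longrightarrow> power_mon (Suc e) (xv v + (xv w + m)))"
proof -
  let ?A = "{(v, w). walk True v w}"
  have "finite A \<Longrightarrow> A \<subseteq> ?A \<Longrightarrow>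
    \<exists>e m. edge_prod e m \<and> (\<forall>(v, w)\<in>A. power_mon (Suc e) (xv v + (xv w + m)))" for A
  proof (induction A rule: finite_induct)
    case empty
    then show ?case using edge_prod_0 by auto
  next
    case (insert x A)
    obtain v w where x: "x = (v, w)" "walk True v w" using insert.prems by auto
    obtain e m where m: "edge_prod e m" "\<forall>(v, w)\<in>A. power_mon (Suc e) (xv v + (xv w + m))"
      using insert by auto
    obtain f n where n: "edge_prod f n" "edge_prod (Suc f) (xv v + (xv w + n))"
      using walk_edge_prod[OF x(2)] by auto
    have "power_mon (Suc (e + f)) (xv v + (xv w + (m + n)))"
      using edge_prod_power_mon[OF edge_prod_add[OF m(1) n(2)]] by (simp add: add.left_commute)
    moreover have "power_mon (Suc (e + f)) (xv a + (xv b + (m + n)))" if ab: "(a, b) \<in> A" for a b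
    proof -
      obtain c l where "edge_prod (Suc e) c" "xv a + (xv b + m) = c + l"
        using m(2) ab by (auto simp: power_mon_def)
      moreover have "xv a + (xv b + (m + n)) = (xv a + (xv b + m)) + n" by (simp add: add.assoc)
      ultimately have "xv a + (xv b + (m + n)) = (c + n) + l" "edge_prod (Suc e + f) (c + n)"
        using edge_prod_add[of "Suc e" c f n] n(1) by (simp_all add: ac_simps)
      then show ?thesis unfolding power_mon_def by auto
    qed
    ultimately show ?case
      using edge_prod_add[OF m(1) n(1)] x by (intro exI[of _ "e + f"] exI[of _ "m + n"]) auto
  qed
  moreover have "finite ?A"
    by (rule finite_subset[of _ "V \<times> V"]) (auto simp: finite_V dest: walk_V)
  ultimately show ?thesis by fastforce
qed

subsection \<open>Upper bound for the depth\<close>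

definition component :: "'v \<Rightarrow> 'v set" where
  "component r = {v. conn r v}"

definition deg_on :: "'v set \<Rightarrow> ('v \<Rightarrow>\<^sub>0 nat) \<Rightarrow> nat" where
  "deg_on A m = (\<Sum>v\<in>A. lookup m v)"

lemma deg_on_add: "deg_on A (m + n) = deg_on A m + deg_on A n"
  by (simp add: deg_on_def lookup_add sum.distrib)

lemma deg_on_0 [simp]: "deg_on A 0 = 0"
  by (simp add: deg_on_def)

lemma deg_on_xv: "finite A \<Longrightarrow> deg_on A (xv v) = (if v \<in> A then 1 else 0)"
  by (simp add: deg_on_def lookup_single when_def)

lemma finite_component: "finite (component r)"
  by (rule finite_subset[OF _ finite_V]) (auto simp: component_def dest: conn_V)

text \<open>Counting on the sides away from \<open>T\<close> makes the vertices of \<open>T\<close>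
  themselves invisible to the order defined below.\<close>

definition opposite :: "'v set \<Rightarrow> 'v set" where
  "opposite T = {v. \<exists>t\<in>T. walk True t v}"

lemma finite_opposite: "finite (opposite T)"
  by (rule finite_subset[OF _ finite_V]) (auto simp: opposite_def dest: walk_V)

text \<open>When \<open>T\<close> contains one vertex of each bipartite component, this superadditive function counts the
  factors of a product of edges, so it bounds the number of edges whose product divides a monomial.
  Rounding down in each component separately makes it sharp on a product of edges times one vertex of
  every nonbipartite component.\<close>

definition edge_order :: "'v set \<Rightarrow> ('v \<Rightarrow>\<^sub>0 nat) \<Rightarrow> nat" where
  "edge_order T m = deg_on (opposite T) m + (\<Sum>r\<in>roots - bip_roots. deg_on (component r) m div 2)"

lemma edge_order_add: "edge_order T m + edge_order T n \<le> edge_order T (m + n)"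
proof -
  have "(\<Sum>r\<in>roots - bip_roots. deg_on (component r) m div 2) + (\<Sum>r\<in>roots - bip_roots. deg_on (component r) n div 2)
    \<le> (\<Sum>r\<in>roots - bip_roots. deg_on (component r) (m + n) div 2)"
    unfolding sum.distrib[symmetric] deg_on_add by (intro sum_mono) linarith
  then show ?thesis by (simp add: edge_order_def deg_on_add)
qed

context
  fixes T :: "'v set"
  assumes T: "\<And>r. r \<in> bip_roots \<Longrightarrow> \<exists>t\<in>T. conn r t"
    "\<And>t. t \<in> T \<Longrightarrow> root t \<in> bip_roots"
    "\<And>t s. t \<in> T \<Longrightarrow> s \<in> T \<Longrightarrow> conn t s \<Longrightarrow> t = s"
begin

lemma T_bip: "t \<in> T \<Longrightarrow> \<not> walk True t t"
proof
  assume t: "t \<in> T" "walk True t t"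
  then have "conn t (root t)" using conn_root walk_V by blast
  then obtain p where p: "walk p t (root t)" by (auto simp: conn_def)
  have "walk True (root t) (root t)"
    using walk_trans[OF p walk_trans[OF t(2) walk_sym[OF p]]] by (cases p) auto
  then show False using T(2)[OF t(1)] by (auto simp: bip_roots_def)
qed

lemma edge_order_edge:
  assumes ab: "E a b"
  shows "edge_order T (xv a + (xv b + m)) = Suc (edge_order T m)"
proof -
  have rab: "root a = root b" using root_eq[OF conn_edge[OF ab]] .
  have aV: "a \<in> V" "b \<in> V" using E_V ab by auto
  have component_iff: "x \<in> component r \<longleftrightarrow> r = root x" if "r \<in> roots" "x \<in> V" for r x
    unfolding component_def
    using that root_eq root_root conn_root conn_sym by (metis mem_Collect_eq)
  have component: "deg_on (component r) (xv a + (xv b + m)) = deg_on (component r) m + (if r = root a then 2 else 0)"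
    if "r \<in> roots" for r
    using component_iff[OF that] aV rab by (simp add: deg_on_add deg_on_xv finite_component)
  have opp: "deg_on (opposite T) (xv a + (xv b + m)) =
    deg_on (opposite T) m + (if a \<in> opposite T then 1 else 0) + (if b \<in> opposite T then 1 else 0)"
    by (simp add: deg_on_add deg_on_xv finite_opposite)
  have half: "(\<Sum>r\<in>roots - bip_roots. deg_on (component r) (xv a + (xv b + m)) div 2) =
    (\<Sum>r\<in>roots - bip_roots. deg_on (component r) m div 2) + (if root a \<in> bip_roots then 0 else 1)"
  proof -
    have "(\<Sum>r\<in>roots - bip_roots. deg_on (component r) (xv a + (xv b + m)) div 2) =
      (\<Sum>r\<in>roots - bip_roots. deg_on (component r) m div 2 + (if r = root a then 1 else 0))"
      by (intro sum.cong) (auto simp: component)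
    then show ?thesis
      using root_in_roots[OF aV(1)] by (simp add: sum.distrib finite_roots)
  qed
  have "(if a \<in> opposite T then 1 else 0) + (if b \<in> opposite T then 1 else 0) =
    (if root a \<in> bip_roots then 1 else (0 :: nat))"
  proof (cases "root a \<in> bip_roots")
    case True
    then obtain t where t: "t \<in> T" "conn (root a) t" using T(1) by blast
    have ta: "conn t a" using t conn_root[OF aV(1)] conn_sym conn_trans by blast
    have uniq: "s = t" if "s \<in> T" "walk True s x" "x = a \<or> x = b" for s x
      using that T(3)[OF that(1) t(1)] walk_conn[OF that(2)] ta conn_edge[OF ab] conn_sym conn_trans by blast
    have a: "a \<in> opposite T \<longleftrightarrow> walk True t a" "b \<in> opposite T \<longleftrightarrow> walk True t b"
      unfolding opposite_def using t uniq by blast+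
    \<comment> \<open>An edge of a bipartite component has exactly one end opposite to
      \<open>t\<close>; two would close up to an odd walk from \<open>t\<close> to itself.\<close>
    have "walk True t b \<longleftrightarrow> \<not> walk True t a"
    proof
      assume "walk True t b"
      then show "\<not> walk True t a"
        using T_bip[OF t(1)] walk_trans[OF walk_sym, of True t a False t]
          walk_step[of True t b a] E_sym[OF ab] by auto
    next
      assume "\<not> walk True t a"
      then have "walk False t a" using ta conn_iff by auto
      from walk_step[OF this ab] show "walk True t b" by simp
    qed
    then show ?thesis using True a by simp
  next
    case False
    have "x \<notin> opposite T" if x: "root x = root a" for x
    proof
      assume "x \<in> opposite T"
      then obtain t where "t \<in> T" "walk True t x" by (auto simp: opposite_def)
      then have "root t = root x" "root t \<in> bip_roots" using root_eq walk_conn T(2) by auto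
      then show False using False x by simp
    qed
    then show ?thesis using False rab by simp
  qed
  then show ?thesis unfolding edge_order_def opp half by (simp split: if_splits)
qed

lemma edge_order_edge_prod: "edge_prod k m \<Longrightarrow> edge_order T m = k"
proof (induction rule: edge_prod.induct)
  case edge_prod_0
  show ?case by (simp add: edge_order_def)
qed (simp add: edge_order_edge)

lemma edge_order_power_mon: "power_mon k m \<Longrightarrow> k \<le> edge_order T m"
  unfolding power_mon_def using edge_order_edge_prod edge_order_add
  by (metis add.commute le_add2 le_trans)

end

end

context adjacency
begin

lemma even_deg_on_component:
  assumes "edge_prod k m"
  shows "even (deg_on (component r) m)"
  using assms
proof (induction rule: edge_prod.induct)
  case (edge_prod_Suc a b k m)
  have "a \<in> component r \<longleftrightarrow> b \<in> component r"
    using conn_trans conn_edge[OF edge_prod_Suc.hyps(1)] conn_sym unfolding component_def by blast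
  then show ?case using edge_prod_Suc.IH by (simp add: deg_on_add deg_on_xv finite_component)
qed simp

lemma edge_prod_keys: "edge_prod k m \<Longrightarrow> keys m \<subseteq> V"
  by (induction rule: edge_prod.induct) (auto simp: keys_add_nat dest: E_V)

lemma deg_on_sum_list: "finite A \<Longrightarrow> deg_on A (sum_list (map xv ts)) = length (filter (\<lambda>t. t \<in> A) ts)"
  by (induction ts) (simp_all add: deg_on_add deg_on_xv)

lemma deg_on_sum: "deg_on A (sum f I) = (\<Sum>i\<in>I. deg_on A (f i))"
  by (induction I rule: infinite_finite_induct) (simp_all add: deg_on_add)

text \<open>The order of this monomial is still \<open>e\<close>: vertices of \<open>T\<close> lie
  on their own sides and count zero, and each extra nonbipartite root raises an even component
  degree by one, which rounding discards.\<close>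

lemma not_power_mon_transversal:
  assumes T: "\<And>r. r \<in> bip_roots \<Longrightarrow> \<exists>t\<in>set T. conn r t"
    "\<And>t. t \<in> set T \<Longrightarrow> root t \<in> bip_roots"
    "\<And>t s. t \<in> set T \<Longrightarrow> s \<in> set T \<Longrightarrow> conn t s \<Longrightarrow> t = s"
    and m: "edge_prod e m"
  shows "\<not> power_mon (Suc e) (sum_list (map xv T) + ((\<Sum>r\<in>roots - bip_roots. xv r) + m))"
    (is "\<not> power_mon _ ?m")
proof
  assume "power_mon (Suc e) ?m"
  from edge_order_power_mon[OF T this]
  have "Suc e \<le> edge_order (set T) ?m" .
  have opp: "deg_on (opposite (set T)) ?m = deg_on (opposite (set T)) m"
  proof -
    have "t \<notin> opposite (set T)" if "t \<in> set T" for t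
      unfolding opposite_def using T_bip[OF T] T(3) that walk_conn by fastforce
    moreover have "r \<notin> opposite (set T)" if "r \<in> roots - bip_roots" for r
    proof
      assume "r \<in> opposite (set T)"
      then obtain t where t: "t \<in> set T" "walk True t r" by (auto simp: opposite_def)
      then have "root t = r" using that root_root root_eq[OF walk_conn] by auto
      then show False using T(2)[OF t(1)] that by auto
    qed
    ultimately show ?thesis
      by (simp add: deg_on_add deg_on_sum_list deg_on_sum deg_on_xv finite_opposite)
  qed
  have "deg_on (component r) ?m div 2 = deg_on (component r) m div 2" if r: "r \<in> roots - bip_roots" for r
  proof -
    have "t \<notin> component r" if "t \<in> set T" for t
    proof
      assume "t \<in> component r"
      then have "root t = r" using root_eq[of r t] root_root r by (auto simp: component_def)
      then show False using T(2)[OF that] r by auto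
    qed
    moreover have "(\<Sum>s\<in>roots - bip_roots. deg_on (component r) (xv s)) = (\<Sum>s\<in>roots - bip_roots. if s = r then 1 else 0)"
    proof (intro sum.cong refl)
      fix s assume s: "s \<in> roots - bip_roots"
      then have "s \<in> component r \<longleftrightarrow> s = r"
        using r roots_V roots_conn_eq[of r s] conn_refl[of r] by (auto simp: component_def)
      then show "deg_on (component r) (xv s) = (if s = r then 1 else 0)"
        by (simp add: deg_on_xv finite_component)
    qed
    ultimately have "deg_on (component r) ?m = Suc (deg_on (component r) m)"
      using r by (simp add: deg_on_add deg_on_sum_list deg_on_sum finite_component finite_roots filter_False)
    then show ?thesis using even_deg_on_component[OF m, of r] by simp
  qed
  then have "edge_order (set T) ?m = edge_order (set T) m" by (simp add: edge_order_def opp)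
  also have "\<dots> = e" using edge_order_edge_prod[OF T m] .
  finally show False using \<open>Suc e \<le> edge_order (set T) ?m\<close> by simp
qed

theorem rseq_power_length_le:
  fixes fs :: "('v, 'k::field) mpoly list"
  assumes m: "edge_prod e m" "\<And>v w. walk True v w \<Longrightarrow> power_mon (Suc e) (xv v + (xv w + m))"
    and fs: "rseq V (mon V (power_mon (Suc e))) fs" "set fs \<subseteq> graded_maximal_ideal V"
  shows "length fs \<le> card bip_roots"
proof -
  have fin: "finite bip_roots" using finite_roots by (auto simp: bip_roots_def)
  obtain rs where rs: "distinct rs" "set rs = bip_roots" using finite_distinct_list[OF fin] by blast
  have bip_sub: "bip_roots \<subseteq> roots" by (auto simp: bip_roots_def)
  define n where "n = (\<lambda>r. SOME v. E r v)"
  have n: "E r (n r)" if "r \<in> bip_roots" for r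
    unfolding n_def using E_ex[of r] that bip_sub roots_V by (auto intro: someI)
  \<comment> \<open>Walk parity from the root replaces the choice of a bipartition. In a bipartite
    component \<open>a r\<close> and \<open>b r\<close> live on the two sides; in a nonbipartite one
    \<open>b r\<close> alone covers every vertex, and \<open>rs\<close> omits its root.\<close>
  define a where "a = (\<lambda>r v. if walk False r v then variable v else 0 :: ('v, 'k) mpoly)"
  define b where "b = (\<lambda>r v. if walk True r v then variable v else 0 :: ('v, 'k) mpoly)"
  define m' where "m' = (\<Sum>r\<in>roots - bip_roots. xv r) + m"
  have bip: "\<not> (walk False r v \<and> walk True r v)" if "r \<in> bip_roots" for r v
    using that walk_trans[of True v r False r, OF walk_sym] by (auto simp: bip_roots_def)
  have power_m': "power_mon (Suc e) (xv v + (xv w + m'))" if "walk True v w" for v w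
    using upset_add[OF upset_power_mon m(2)[OF that], of "\<Sum>r\<in>roots - bip_roots. xv r"]
    by (simp add: m'_def ac_simps)
  have keys_m': "keys m' \<subseteq> V"
  proof -
    have "keys (\<Sum>r\<in>A. xv r) \<subseteq> V" if "A \<subseteq> V" for A
      using that by (induction A rule: infinite_finite_induct) (auto simp: keys_add_nat)
    from this[of "roots - bip_roots"] show ?thesis
      using edge_prod_keys[OF m(1)] roots_V by (auto simp: m'_def keys_add_nat)
  qed
  note [simp] = variable_def mult_single
  have "length fs \<le> length rs"
  proof (rule rseq_length_le[OF finite_V upset_power_mon fs rs(1), where n = n and a = a and b = b and R = roots and m = m'])
    show "set rs \<subseteq> V" "n ` set rs \<subseteq> V" using rs roots_V bip_sub n E_V by blast+
    show "keys m' \<subseteq> V" by (rule keys_m')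
    show "variable v = (\<Sum>r\<in>set rs. a r v) + (\<Sum>r\<in>roots. b r v)" if v: "v \<in> V" for v
    proof -
      let ?r = "root v"
      have r: "?r \<in> roots" "conn ?r v" using root_in_roots[OF v] conn_root[OF v] conn_sym by auto
      have only: "r = ?r" if "r \<in> roots" "walk p r v" for r p
        using root_eq[OF walk_conn[OF that(2)]] root_root[OF that(1)] by simp
      have "(\<Sum>r\<in>roots. b r v) = (\<Sum>r\<in>roots. if r = ?r then b ?r v else 0)"
        using only[of _ True] by (intro sum.cong) (auto simp: b_def)
      moreover have "(\<Sum>r\<in>set rs. a r v) = (\<Sum>r\<in>set rs. if r = ?r then a ?r v else 0)"
        using only[of _ False] rs(2) bip_sub by (intro sum.cong) (auto simp: a_def)
      moreover have "variable v = (if ?r \<in> bip_roots then a ?r v else 0) + b ?r v"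
      proof (cases "?r \<in> bip_roots")
        case True
        then show ?thesis using bip[OF True, of v] r(2) conn_iff by (auto simp: a_def b_def)
      next
        case False
        then have odd: "walk True ?r ?r" using r by (auto simp: bip_roots_def)
        have "walk True ?r v"
          using r(2) walk_trans[OF _ odd, of False v] conn_iff by auto
        then show ?thesis using False by (simp add: b_def)
      qed
      ultimately show ?thesis using r(1) rs(2) fin finite_roots by simp
    qed
    show "(\<forall>v\<in>V. b r v * single m' 1 \<in> mon V (power_mon (Suc e))) \<or>
      r \<in> set rs \<and> (\<forall>v\<in>V. \<forall>w\<in>V. b r v * (a r w * single m' 1) \<in> mon V (power_mon (Suc e)))"
      if r: "r \<in> roots" for r
    proof (cases "r \<in> bip_roots")
      case True
      have "b r v * (a r w * single m' 1) \<in> mon V (power_mon (Suc e))" if "v \<in> V" "w \<in> V" for v w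
      proof (cases "walk True r v \<and> walk False r w")
        case True
        \<comment> \<open>Here the two forms contribute vertices of opposite sides, whose product is
          absorbed by \<open>m\<close>.\<close>
        then have "walk True v w" using walk_trans[OF _ walk_sym, of False r w True v] by simp
        then show ?thesis
          using True power_m' keys_m' that by (auto simp: a_def b_def keys_add_nat intro!: mon_single)
      next
        case False
        then show ?thesis using pideal_zero[OF pideal_mon[OF upset_power_mon]] by (auto simp: a_def b_def)
      qed
      then show ?thesis using True rs by blast
    next
      case False
      have "b r v * single m' 1 \<in> mon V (power_mon (Suc e))" if "v \<in> V" for v
      proof (cases "walk True r v")
        case True
        \<comment> \<open>The factor \<open>r\<close> in \<open>m'\<close> supplies the partner that
          \<open>v\<close> needs for absorption, as the walk from \<open>r\<close> to
          \<open>v\<close> is odd.\<close>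
        have "(\<Sum>r\<in>roots - bip_roots. xv r) = xv r + (\<Sum>r\<in>roots - bip_roots - {r}. xv r)"
          using r False finite_roots by (intro sum.remove) auto
        then have "xv v + m' = (\<Sum>r\<in>roots - bip_roots - {r}. xv r) + (xv r + (xv v + m))"
          by (simp add: m'_def ac_simps)
        then have "power_mon (Suc e) (xv v + m')"
          using upset_add[OF upset_power_mon m(2)[OF True]] by metis
        then show ?thesis
          using True keys_m' that by (auto simp: b_def keys_add_nat intro!: mon_single)
      next
        case False
        then show ?thesis using pideal_zero[OF pideal_mon[OF upset_power_mon]] by (auto simp: b_def)
      qed
      then show ?thesis by blast
    qed
    show "a r r = variable r \<and> a r (n r) = 0" if "r \<in> set rs" for r
      using that rs bip_sub roots_V n[of r] bip[of r "n r"] walk_edge walk_refl[of r]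
      by (auto simp: a_def)
    show "a r s = 0 \<and> a r (n s) = 0" if rs': "r \<in> set rs" "s \<in> set rs" "r \<noteq> s" for r s
    proof -
      have "\<not> conn r s" "E s (n s)"
        using rs' roots_conn_eq[of r s] rs bip_sub n by auto
      then have "\<not> conn r (n s)" using conn_edge conn_sym conn_trans by blast
      then show ?thesis using \<open>\<not> conn r s\<close> walk_conn by (auto simp: a_def)
    qed
    show "\<not> power_mon (Suc e) (sum_list (map xv T) + m')"
      if T: "transversal (map (\<lambda>r. (r, n r)) rs) T" for T
      unfolding m'_def
    proof (rule not_power_mon_transversal[OF _ _ _ m(1)])
      have T': "list_all2 (\<lambda>r t. t = r \<or> t = n r) rs T"
        using T by (simp add: transversal_def list_all2_map1)
      have len: "length T = length rs" using T' by (auto dest: list_all2_lengthD)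
      have nth: "conn (rs ! i) (T ! i)" "rs ! i \<in> bip_roots" if "i < length rs" for i
      proof -
        show r: "rs ! i \<in> bip_roots" using nth_mem[OF that] rs(2) by simp
        show "conn (rs ! i) (T ! i)"
          using list_all2_nthD[OF T' that] conn_edge[OF n[OF r]] conn_refl[of "rs ! i"] r bip_sub roots_V
          by auto
      qed
      show "\<exists>t\<in>set T. conn r t" if "r \<in> bip_roots" for r
        using that nth rs(2) len by (metis in_set_conv_nth)
      have root: "root (T ! i) = rs ! i" if "i < length rs" for i
        using root_eq[OF nth(1)[OF that]] root_root[of "rs ! i"] nth(2)[OF that] bip_sub by auto
      show "root t \<in> bip_roots" if "t \<in> set T" for t
        using that root nth(2) len by (metis in_set_conv_nth)
      show "t = s" if ts: "t \<in> set T" "s \<in> set T" "conn t s" for t s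
      proof -
        obtain i j where ij: "i < length rs" "t = T ! i" "j < length rs" "s = T ! j"
          using ts len by (metis in_set_conv_nth)
        then have "rs ! i = rs ! j" using root root_eq[OF ts(3)] by auto
        then show ?thesis using rs(1) ij by (simp add: nth_eq_iff_index_eq)
      qed
    qed
  qed (auto simp: a_def b_def simp del: variable_def intro!: Pol_variable)
  then show ?thesis using rs distinct_card by metis
qed

end

subsection \<open>Lower bounds for the depth\<close>

context adjacency
begin

lemma component_V: "component r \<subseteq> V"
  using conn_V by (auto simp: component_def)

lemma component_edge: "E a b \<Longrightarrow> a \<in> component r \<Longrightarrow> b \<in> component r"
  using conn_edge conn_trans unfolding component_def by blast

lemma component_disjoint: "r \<in> roots \<Longrightarrow> s \<in> roots \<Longrightarrow> r \<noteq> s \<Longrightarrow> component r \<inter> component s = {}"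
  using roots_conn_eq conn_sym conn_trans unfolding component_def by blast

lemma root_in_component: "r \<in> roots \<Longrightarrow> r \<in> component r"
  using roots_V conn_refl by (auto simp: component_def)

lemma inj_on_component: "inj_on component roots"
  using component_disjoint root_in_component by (intro inj_onI) fastforce

text \<open>If no neighbour of \<open>x\<close> occurs in a monomial, multiplication by
  \<open>x\<close> cannot create an edge in its support.\<close>

definition free_class :: "'v \<Rightarrow> ('v \<Rightarrow> nat) \<Rightarrow> bool" where
  "free_class x z \<longleftrightarrow> (\<forall>y. E x y \<longrightarrow> z y = 0)"

lemma exchange_free_class: "exchange Z free_class"
  using E_irrefl by (auto simp: exchange_def free_class_def)

text \<open>If the support of \<open>z\<close> in the component contains an edge, the whole
  multidegree is in the ideal. Otherwise any vertex of the support is free, and for empty support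
  the root is.\<close>

lemma stable_on_edgy:
  assumes r: "r \<in> roots"
  shows "stable_on V (component r) free_class (mon V (edgy E) :: ('v, 'k::field) mpoly set)"
proof (rule stable_on_mon)
  fix x z m
  assume x: "x \<in> component r" "free_class x z" "agree (component r) z m" "edgy E (xv x + m)"
  then obtain a b where ab: "E a b" "a = x \<or> a \<in> keys m" "b = x \<or> b \<in> keys m"
    by (auto simp: edgy_def keys_add_nat)
  have "y \<notin> keys m" if "E x y" for y
    using that x component_edge[OF that x(1)] by (auto simp: agree_def free_class_def in_keys_iff)
  then show "edgy E m" using ab E_sym E_irrefl unfolding edgy_def by metis
next
  fix z
  show "(\<exists>x\<in>component r. free_class x z) \<or> (\<forall>m. keys m \<subseteq> V \<longrightarrow> agree (component r) z m \<longrightarrow> edgy E m)"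
  proof (cases "\<exists>a\<in>component r. \<exists>b\<in>component r. E a b \<and> z a > 0 \<and> z b > 0")
    case True
    then obtain a b where ab: "a \<in> component r" "b \<in> component r" "E a b" "z a > 0" "z b > 0" by blast
    have "edgy E m" if "agree (component r) z m" for m
    proof -
      have "a \<in> keys m" "b \<in> keys m" using ab that by (auto simp: agree_def in_keys_iff)
      then show ?thesis using ab unfolding edgy_def by blast
    qed
    then show ?thesis by blast
  next
    case False
    show ?thesis
    proof (cases "\<exists>x\<in>component r. z x > 0")
      case True
      then obtain x where x: "x \<in> component r" "z x > 0" by blast
      then have "free_class x z"
        using False component_edge[OF _ x(1)] by (auto simp: free_class_def)
      then show ?thesis using x by blast
    next
      case False
      then have "free_class r z"
        using component_edge[OF _ root_in_component[OF r]] by (auto simp: free_class_def)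
      then show ?thesis using root_in_component[OF r] by blast
    qed
  qed
qed

lemma constant_term_power_mon:
  assumes "p \<in> mon V (power_mon (Suc k))"
  shows "lookup p 0 = 0"
proof (rule mon_lookup[OF assms])
  have "xv a + (xv b + n) \<noteq> 0" for a b and n :: "'v \<Rightarrow>\<^sub>0 nat"
    by (metis keys_add_nat keys_single keys_zero Un_empty insert_not_empty nat.distinct(1))
  then show "\<not> power_mon (Suc k) 0" unfolding power_mon_Suc_iff by metis
qed

section \<open>Powers when the components are complete bipartite\<close>

definition side :: "bool \<Rightarrow> 'v \<Rightarrow> 'v set" where
  "side p x = {v. walk p x v}"

lemma finite_side: "finite (side p x)"
  by (rule finite_subset[OF _ finite_V]) (auto simp: side_def dest: walk_V)

lemma side_walk:
  assumes "walk q x y"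
  shows "side p y = side (p = (\<not> q)) x"
proof -
  have "walk p y v \<longleftrightarrow> walk (p = (\<not> q)) x v" for v
  proof
    assume "walk p y v"
    from walk_trans[OF this assms] show "walk (p = (\<not> q)) x v" by (cases p; cases q) simp_all
  next
    assume "walk (p = (\<not> q)) x v"
    from walk_trans[OF this walk_sym[OF assms]] show "walk p y v" by (cases p; cases q) simp_all
  qed
  then show ?thesis by (simp add: side_def)
qed

text \<open>In a complete bipartite component the largest number of edges whose product divides a
  monomial is the smaller of its degrees on the two sides. A factor \<open>x\<close> on a side at
  least as heavy as the other leaves that minimum unchanged.\<close>

definition heavy_class :: "'v \<Rightarrow> ('v \<Rightarrow> nat) \<Rightarrow> bool" where
  "heavy_class x z \<longleftrightarrow> sum z (side True x) \<le> sum z (side False x)"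

context
  assumes complete: "walk True u v \<Longrightarrow> E u v"
begin

lemma not_odd_closed: "\<not> walk True u u"
  using complete E_irrefl by blast

lemma side_edge: "E x y \<Longrightarrow> side p y = side (\<not> p) x"
  using side_walk[OF walk_edge, of x y p] by simp

text \<open>The side of \<open>x\<close> gains one at \<open>x\<close> and loses at most one at
  \<open>v\<close>, while the opposite side can only lose.\<close>

lemma exchange_heavy_class: "exchange (component r) heavy_class"
  unfolding exchange_def heavy_class_def
proof (intro ballI allI impI)
  fix x v and z :: "'v \<Rightarrow> nat"
  assume xv: "x \<in> component r" "v \<in> component r" "v \<noteq> x" "z v > 0"
    and le: "sum z (side True x) \<le> sum z (side False x)"
  let ?z = "z(x := Suc (z x), v := z v - 1)"
  have x: "x \<in> side False x" "x \<notin> side True x"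
    using walk_refl xv(1) component_V not_odd_closed by (auto simp: side_def)
  have "sum ?z (side True x) \<le> sum z (side True x)"
    using x by (intro sum_mono) auto
  moreover have "sum z (side False x) \<le> sum ?z (side False x)"
  proof (cases "v \<in> side False x")
    case True
    have "sum f (side False x) = f x + (f v + sum f (side False x - {x} - {v}))" for f :: "'v \<Rightarrow> nat"
      using sum.remove[OF finite_side x(1), of f] sum.remove[of "side False x - {x}" v f]
        True xv(3) finite_side by simp
    moreover have "sum ?z (side False x - {x} - {v}) = sum z (side False x - {x} - {v})"
      by (intro sum.cong) auto
    ultimately show ?thesis using xv by simp
  next
    case False
    then show ?thesis by (intro sum_mono) auto
  qed
  ultimately show "sum ?z (side True x) \<le> sum ?z (side False x)" using le by linarith
qed

text \<open>Since there are more vertices on the side of \<open>x\<close> than opposite to it, some of them do not occur in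
  the \<open>k\<close> edges, and one of these can take the place of \<open>x\<close>.\<close>

lemma power_mon_cancel:
  assumes "power_mon k (xv x + m)" "x \<in> V"
    and "deg_on (side True x) (xv x + m) < deg_on (side False x) (xv x + m)"
  shows "power_mon k m"
  using assms
proof (induction k arbitrary: x m)
  case 0
  then show ?case by (simp add: power_mon_0)
next
  case (Suc k)
  obtain a b n where n: "E a b" "power_mon k n" "xv x + m = xv a + (xv b + n)"
    using Suc.prems(1) unfolding power_mon_Suc_iff by blast
  have sides: "a \<in> side True x \<longleftrightarrow> b \<in> side False x" "a \<in> side False x \<longleftrightarrow> b \<in> side True x"
    using walk_step[of True x a b] walk_step[of False x a b] walk_step[of True x b a]
      walk_step[of False x b a] n(1) E_sym[OF n(1)] by (auto simp: side_def)
  \<comment> \<open>Removing an edge lowers both sides equally or neither, so the strict inequality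
    passes to the remaining \<open>n\<close>.\<close>
  have less: "deg_on (side True x) n < deg_on (side False x) n"
    using Suc.prems(3) unfolding n(3)
    by (simp add: deg_on_add deg_on_xv finite_side sides)
  show ?case
  proof (cases "lookup n x > 0")
    case True
    then obtain n' where n': "n = xv x + n'" by (auto simp: xv_split)
    have "xv x + m = xv x + (xv a + (xv b + n'))"
      using n(3) unfolding n' by (simp add: add.left_commute)
    then have "m = xv a + (xv b + n')" by simp
    moreover have "power_mon k n'" using Suc.IH[of x n'] n(2) less Suc.prems(2) unfolding n' by blast
    ultimately show ?thesis unfolding power_mon_Suc_iff using n(1) by blast
  next
    case False
    have "lookup (xv a + (xv b + n)) x > 0" unfolding n(3)[symmetric] by (simp add: lookup_add)
    then have "x = a \<or> x = b" using False by (auto simp: lookup_add lookup_single when_def split: if_splits)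
    then obtain c where c: "E x c" "m = xv c + n"
    proof
      assume "x = a"
      then show ?thesis using that[of b] n(1,3) by simp
    next
      assume "x = b"
      then have "xv x + m = xv x + (xv a + n)" using n(3) by (simp add: add.left_commute)
      then show ?thesis using that[of a] E_sym[OF n(1)] \<open>x = b\<close> by simp
    qed
    obtain y where y: "y \<in> side False x" "lookup n y > 0"
    proof -
      have "deg_on (side False x) n \<noteq> 0" using less by simp
      then show ?thesis using that finite_side by (auto simp: deg_on_def)
    qed
    then obtain n' where n': "n = xv y + n'" by (auto simp: xv_split)
    have xy: "walk False x y" using y by (simp add: side_def)
    have "power_mon k n'"
      using Suc.IH[of y n'] n(2) less walk_V[OF xy] side_walk[OF xy] unfolding n' by simp
    moreover have "E y c"
      using complete walk_trans[OF walk_edge[OF c(1)] walk_sym[OF xy]] by simp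
    moreover have "m = xv y + (xv c + n')" unfolding c(2) n' by (rule add.left_commute)
    ultimately show ?thesis unfolding power_mon_Suc_iff by blast
  qed
qed

lemma stable_on_power_mon:
  assumes r: "r \<in> roots"
  shows "stable_on V (component r) heavy_class (mon V (power_mon k) :: ('v, 'k::field) mpoly set)"
proof (rule stable_on_mon)
  fix x z m
  assume x: "x \<in> component r" "heavy_class x z" "agree (component r) z m" "power_mon k (xv x + m)"
  have "side p x \<subseteq> component r" for p
    using x(1) conn_trans walk_conn unfolding side_def component_def by blast
  then have deg: "deg_on (side p x) m = sum z (side p x)" for p
    unfolding deg_on_def using x(3) by (intro sum.cong) (auto simp: agree_def)
  have xV: "x \<in> V" using x(1) component_V by blast
  have "x \<in> side False x" "x \<notin> side True x"
    using walk_refl xV not_odd_closed by (auto simp: side_def)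
  then have "deg_on (side True x) (xv x + m) < deg_on (side False x) (xv x + m)"
    using x(2) by (simp add: heavy_class_def deg_on_add deg_on_xv finite_side deg)
  then show "power_mon k m" by (rule power_mon_cancel[OF x(4) xV])
next
  fix z
  have r': "r \<in> component r" using root_in_component[OF r] .
  obtain n where n: "E r n" using E_ex roots_V r by blast
  \<comment> \<open>A neighbour of \<open>r\<close> sees the same two sides interchanged, so one of
    the two vertices is on the heavier side.\<close>
  have "heavy_class r z \<or> heavy_class n z"
    unfolding heavy_class_def side_edge[OF n] by auto
  then show "(\<exists>x\<in>component r. heavy_class x z) \<or>
    (\<forall>m. keys m \<subseteq> V \<longrightarrow> agree (component r) z m \<longrightarrow> power_mon k m)"
    using r' component_edge[OF n r'] by blast
qed

end

abbreviation component_sum :: "'v set \<Rightarrow> ('v, 'k::field) mpoly" where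
  "component_sum Z \<equiv> \<Sum>v\<in>Z. variable v"

lemma component_sums_maximal:
  "set (map component_sum (map component rs)) \<subseteq> (graded_maximal_ideal V :: ('v, 'k::field) mpoly set)"
  using component_V
  by (auto intro!: pideal_sum[OF pideal_graded_maximal] variable_in_graded_maximal)

lemma rseq_components:
  assumes Q: "pideal V (Q :: ('v, 'k::field) mpoly set)" "\<And>p. p \<in> Q \<Longrightarrow> lookup p 0 = 0"
    and rs: "distinct rs" "set rs \<subseteq> roots"
    and "\<And>r. r \<in> set rs \<Longrightarrow> graded_on (component r) Q"
    "\<And>r. r \<in> set rs \<Longrightarrow> exchange (component r) C" "\<And>r. r \<in> set rs \<Longrightarrow> stable_on V (component r) C Q"
  shows "rseq V Q (map component_sum (map component rs))"
proof (rule rseq_sums_of_variables[OF Q finite_V, where C = "\<lambda>_. C"])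
  show "distinct (map component rs)"
    using rs inj_on_component by (simp add: distinct_map inj_on_subset)
  fix Y Z assume "Y \<in> set (map component rs)" "Z \<in> set (map component rs)" "Y \<noteq> Z"
  then obtain r s where "Y = component r" "Z = component s" "r \<in> roots" "s \<in> roots" "r \<noteq> s"
    using rs by auto
  then show "Y \<inter> Z = {}" using component_disjoint by simp
qed (use assms in \<open>auto dest: subsetD[OF component_V]\<close>)

lemma rseq_edgy:
  assumes "distinct rs" "set rs \<subseteq> roots"
  shows "rseq V (mon V (edgy E) :: ('v, 'k::field) mpoly set) (map component_sum (map component rs))"
proof (rule rseq_components[OF pideal_mon[OF upset_edgy] _ assms graded_on_mon exchange_free_class])
  show "lookup p 0 = 0" if "p \<in> mon V (edgy E)" for p :: "('v, 'k) mpoly"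
    by (rule mon_lookup[OF that]) (simp add: edgy_def)
  show "stable_on V (component r) free_class (mon V (edgy E) :: ('v, 'k) mpoly set)"
    if "r \<in> set rs" for r
    using that assms(2) by (intro stable_on_edgy) auto
qed

lemma rseq_power_complete:
  assumes "\<And>u v. walk True u v \<Longrightarrow> E u v" "distinct rs" "set rs \<subseteq> roots"
  shows "rseq V (mon V (power_mon (Suc k)) :: ('v, 'k::field) mpoly set)
    (map component_sum (map component rs))"
proof (rule rseq_components[OF pideal_mon[OF upset_power_mon] _ assms(2,3) graded_on_mon])
  fix r assume "r \<in> set rs"
  then have r: "r \<in> roots" using assms(3) by blast
  show "exchange (component r) heavy_class" by (rule exchange_heavy_class[OF assms(1)])
  show "stable_on V (component r) heavy_class (mon V (power_mon (Suc k)) :: ('v, 'k) mpoly set)"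
    by (rule stable_on_power_mon[OF assms(1) r])
qed (rule constant_term_power_mon)

text \<open>Each side of a bipartite component is a clique of the complement graph, and the missing
  edge between \<open>u\<close> and \<open>v\<close> joins the two cliques. The two elements for
  this component come first, while only its sum has been adjoined to the edge ideal; the sums of the
  other components need only stability on their own variables, which survives both.\<close>

lemma ex_long_rseq:
  assumes bip: "\<And>r. r \<in> roots \<Longrightarrow> \<not> walk True r r"
    and uv: "walk True u v" "\<not> E u v"
  shows "\<exists>fs :: ('v, 'k::field) mpoly list. rseq V (mon V (edgy E)) fs \<and>
    set fs \<subseteq> graded_maximal_ideal V \<and> length fs = Suc (card roots)"
proof -
  define r where "r = root u"
  define Z where "Z = component r"
  have uV: "u \<in> V" using walk_V uv by blast
  have r: "r \<in> roots" unfolding r_def using root_in_roots[OF uV] .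
  have uZ: "u \<in> Z" using conn_root[OF uV] conn_sym by (auto simp: Z_def component_def r_def)
  have vZ: "v \<in> Z" using uZ walk_conn[OF uv(1)] conn_trans unfolding Z_def component_def by blast
  have odd: "\<not> walk True w w" for w
  proof
    assume w: "walk True w w"
    then have "conn w (root w)" using conn_root walk_V by blast
    then obtain p where p: "walk p w (root w)" by (auto simp: conn_def)
    have "walk True (root w) (root w)"
      using walk_trans[OF p walk_trans[OF w walk_sym[OF p]]] by (cases p) auto
    then show False using bip root_in_roots walk_V w by blast
  qed
  have same: "\<not> E a b" if "walk False a b" for a b
    using odd[of a] walk_trans[OF walk_sym[OF walk_edge], of a b False a] that by auto
  have two: "walk False u w \<or> walk False v w" if "w \<in> Z" for w
  proof -
    have "conn u w" using that uZ conn_sym conn_trans unfolding Z_def component_def by blast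
    moreover have "walk False v w" if "walk True u w"
      using walk_trans[OF that walk_sym[OF uv(1)]] by simp
    ultimately show ?thesis using conn_iff by blast
  qed
  let ?N = "\<lambda>a b. a \<in> Z \<and> b \<in> Z \<and> \<not> E a b"
  have N_sym: "?N a b \<Longrightarrow> ?N b a" for a b using E_sym by blast
  have to_u: "?N\<^sup>*\<^sup>* w u \<and> ?N\<^sup>*\<^sup>* u w" if w: "w \<in> Z" for w
  proof (cases "walk False u w")
    case True
    then have "?N u w" using same w uZ by blast
    then show ?thesis using N_sym by blast
  next
    case False
    then have vw: "?N v w" using two[OF w] same w vZ by blast
    have uv': "?N u v" using uv uZ vZ by blast
    have "?N\<^sup>*\<^sup>* u w" using rtranclp.rtrancl_into_rtrancl[OF r_into_rtranclp[of ?N u v, OF uv'] vw] .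
    moreover have "?N\<^sup>*\<^sup>* w u"
      using rtranclp.rtrancl_into_rtrancl[OF r_into_rtranclp[of ?N w v, OF N_sym[OF vw]] N_sym[OF uv']] .
    ultimately show ?thesis by blast
  qed
  have nonnbr: "\<exists>x\<in>Z. x \<noteq> w \<and> \<not> E w x" if w: "w \<in> Z" for w
  proof -
    have neq: "u \<noteq> v" using uv odd by blast
    show ?thesis
      \<comment> \<open>For \<open>w\<close> equal to \<open>u\<close> or \<open>v\<close> the other
        one serves; any other \<open>w\<close> is not adjacent to the one of them on its own
        side.\<close>
      using two[OF w] same[of u w] same[of v w] neq uv(2) uZ vZ E_sym by metis
  qed
  have finZ: "finite Z" by (simp add: Z_def finite_component)
  obtain d0 :: "'v \<Rightarrow> nat" where d0: "inj_on d0 Z" using finite_imp_inj_to_nat_seg[OF finZ] by blast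
  \<comment> \<open>The successor makes all exponents positive, which puts \<open>?g\<close> into
    the graded maximal ideal.\<close>
  define d where "d = (\<lambda>v. Suc (d0 v))"
  have d: "inj_on d Z" "\<And>w. d w > 0" using d0 by (auto simp: d_def inj_on_def)
  let ?J = "mon V (edgy E) :: ('v, 'k) mpoly set"
  let ?f = "component_sum Z :: ('v, 'k) mpoly"
  let ?g = "\<Sum>v\<in>Z. variable v ^ d v :: ('v, 'k) mpoly"
  let ?Q1 = "ideal_adjoin V ?J ?f"
  let ?Q = "ideal_adjoin V ?Q1 ?g"
  have ZV: "Z \<subseteq> V" using component_V by (simp add: Z_def)
  have fP: "?f \<in> Pol V" "?f \<in> Pol Z" "?g \<in> Pol V" "?g \<in> Pol Z" using ZV by auto
  have J: "pideal V ?J" by (rule pideal_mon[OF upset_edgy])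
  have Q1: "pideal V ?Q1" by (rule pideal_adjoin[OF J fP(1)])
  have Q: "pideal V ?Q" by (rule pideal_adjoin[OF Q1 fP(3)])
  have fm: "?f \<in> graded_maximal_ideal V"
    using ZV by (intro pideal_sum[OF pideal_graded_maximal] variable_in_graded_maximal) auto
  have gm: "?g \<in> graded_maximal_ideal V"
  proof (intro pideal_sum[OF pideal_graded_maximal])
    fix i assume "i \<in> Z"
    then have i: "i \<in> V" using ZV by blast
    have "variable i ^ d0 i * variable i \<in> (graded_maximal_ideal V :: ('v, 'k) mpoly set)"
      using i by (intro pideal_mult[OF pideal_graded_maximal] variable_in_graded_maximal Pol_power) auto
    then show "variable i ^ d i \<in> (graded_maximal_ideal V :: ('v, 'k) mpoly set)"
      by (simp add: d_def mult.commute)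
  qed
  have f1: "nonzerodivisor V ?J ?f"
    by (rule nonzerodivisor_sum_variables[OF J graded_on_mon _ exchange_free_class finZ ZV])
      (unfold Z_def, rule stable_on_edgy[OF r])
  have g1: "nonzerodivisor V ?Q1 ?g"
  proof (rule nonzerodivisor_sum_powers)
    show "?N\<^sup>*\<^sup>* a b" if "a \<in> Z" "b \<in> Z" for a b
      using to_u that rtranclp_trans[of ?N a u b] by blast
    show "b \<in> Z" if "E a b" "a \<in> Z" for a b using that component_edge by (simp add: Z_def)
  qed (use E_sym E_irrefl nonnbr finZ uZ ZV d in auto)
  have "finite (roots - {r})" using finite_roots by simp
  from finite_distinct_list[OF this] obtain rs where rs: "distinct rs" "set rs = roots - {r}" by blast
  have "rseq V ?Q (map component_sum (map component rs))"
  proof (rule rseq_components[OF Q _ rs(1), where C = free_class])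
    have "?Q1 \<subseteq> {p \<in> Pol V. lookup p 0 = 0}"
    proof (rule ideal_adjoin_minimal[OF pideal_constant_term])
      show "?J \<subseteq> {p \<in> Pol V. lookup p 0 = 0}"
      proof
        fix p assume p: "p \<in> ?J"
        have "\<not> edgy E 0" by (simp add: edgy_def)
        then show "p \<in> {p \<in> Pol V. lookup p 0 = 0}"
          using mon_lookup[OF p] pideal_Pol[OF J p] by blast
      qed
      show "?f \<in> {p \<in> Pol V. lookup p 0 = 0}" using fP graded_maximal_constant_term[OF fm] by blast
    qed
    from ideal_adjoin_minimal[OF pideal_constant_term this]
    have "?Q \<subseteq> {p \<in> Pol V. lookup p 0 = 0}"
      using fP graded_maximal_constant_term[OF gm] by blast
    then show "lookup p 0 = 0" if "p \<in> ?Q" for p using that by blast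
  next
    fix s assume s: "s \<in> set rs"
    then have disj: "Z \<inter> component s = {}" using component_disjoint[OF r] rs by (auto simp: Z_def)
    have 1: "graded_on (component s) ?Q1" by (rule graded_on_adjoin[OF graded_on_mon fP(2) disj])
    then show "graded_on (component s) ?Q" by (rule graded_on_adjoin[OF _ fP(4) disj])
    have "stable_on V (component s) free_class ?J" using stable_on_edgy s rs by blast
    then have "stable_on V (component s) free_class ?Q1"
      by (rule stable_on_adjoin[OF J graded_on_mon _ fP(2) disj ZV])
    then show "stable_on V (component s) free_class ?Q"
      by (rule stable_on_adjoin[OF Q1 1 _ fP(4) disj ZV])
  qed (use rs exchange_free_class in auto)
  then have "rseq V ?J (?f # ?g # map component_sum (map component rs))"
    using f1 g1 fP by simp
  moreover have "set (?f # ?g # map component_sum (map component rs)) \<subseteq> graded_maximal_ideal V"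
    using fm gm component_sums_maximal[of rs, where 'k = 'k] by simp
  moreover have "length (?f # ?g # map component_sum (map component rs)) = Suc (card roots)"
  proof -
    have "length rs = card (roots - {r})" using distinct_card[OF rs(1)] rs(2) by simp
    moreover have "card roots = Suc (card (roots - {r}))"
      by (rule card.remove[OF finite_roots r])
    ultimately show ?thesis by simp
  qed
  ultimately show ?thesis by blast
qed

subsection \<open>Constancy of the depth function\<close>

lemma depth_ge:
  assumes "pideal V Q" "rseq V Q fs" "set fs \<subseteq> graded_maximal_ideal V"
  shows "enat (length fs) \<le> depth_quotient (mpoly_ring V) (graded_maximal_ideal V) Q"
  unfolding depth_quotient_def
  using assms regular_sequence_iff[OF assms(1)] by (intro Sup_upper) blast

lemma depth_le:
  assumes "pideal V Q"
    and "\<And>fs. rseq V Q fs \<Longrightarrow> set fs \<subseteq> graded_maximal_ideal V \<Longrightarrow> length fs \<le> c"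
  shows "depth_quotient (mpoly_ring V) (graded_maximal_ideal V) Q \<le> enat c"
  unfolding depth_quotient_def
  using assms regular_sequence_iff[OF assms(1)] by (intro Sup_least) auto

theorem constant_depth_iff:
  "constant_depth_function V (mon V (power_mon (Suc 0)) :: ('v, 'k::field) mpoly set) \<longleftrightarrow>
    (\<forall>u v. walk True u v \<longrightarrow> E u v)"
proof -
  define depth where "depth = (\<lambda>k. depth_quotient (mpoly_ring V) (graded_maximal_ideal V)
    (mon V (power_mon k) :: ('v, 'k) mpoly set))"
  have const: "constant_depth_function V (mon V (power_mon (Suc 0)) :: ('v, 'k) mpoly set) \<longleftrightarrow>
    (\<forall>k\<ge>1. depth k = depth 1)"
    by (simp add: constant_depth_function_def depth_function_def power_Idl_edges depth_def)
  have J: "pideal V (mon V (power_mon k) :: ('v, 'k) mpoly set)" for k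
    by (rule pideal_mon[OF upset_power_mon])
  have edgy: "mon V (power_mon (Suc 0)) = (mon V (edgy E) :: ('v, 'k) mpoly set)"
    by (rule mon_eqI) (rule power_mon_1)
  obtain rs where rs: "distinct rs" "set rs = roots"
    using finite_distinct_list[OF finite_roots] by blast
  have len: "length (map component_sum (map component rs) :: ('v, 'k) mpoly list) = card roots"
    using distinct_card[OF rs(1)] rs(2) by simp
  show ?thesis unfolding const
  proof
    assume c: "\<forall>k\<ge>1. depth k = depth 1"
    obtain e m where m: "edge_prod e m" "\<And>v w. walk True v w \<Longrightarrow> power_mon (Suc e) (xv v + (xv w + m))"
      using ex_absorbing_edge_prod by blast
    have "depth (Suc e) \<le> enat (card bip_roots)"
      unfolding depth_def by (rule depth_le[OF J rseq_power_length_le[OF m]])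
    then have le: "depth 1 \<le> enat (card bip_roots)" using spec[OF c, of "Suc e"] by simp
    have "rseq V (mon V (power_mon (Suc 0)) :: ('v, 'k) mpoly set) (map component_sum (map component rs))"
      unfolding edgy using rs by (intro rseq_edgy) auto
    from depth_ge[OF J this component_sums_maximal] have "enat (card roots) \<le> depth 1"
      unfolding depth_def len by simp
    from order_trans[OF this le] have "card roots \<le> card bip_roots" by simp
    moreover have "bip_roots \<subseteq> roots" by (auto simp: bip_roots_def)
    ultimately have bip: "bip_roots = roots" using finite_roots by (meson card_seteq)
    show "\<forall>u v. walk True u v \<longrightarrow> E u v"
    proof (rule ccontr)
      assume "\<not> ?thesis"
      then obtain u v where uv: "walk True u v" "\<not> E u v" by blast
      have "\<not> walk True r r" if "r \<in> roots" for r
        using that bip by (auto simp: bip_roots_def)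
      from ex_long_rseq[OF this uv] obtain fs :: "('v, 'k) mpoly list" where fs: "rseq V (mon V (edgy E)) fs"
        "set fs \<subseteq> graded_maximal_ideal V" "length fs = Suc (card roots)" by blast
      have "enat (Suc (card roots)) \<le> depth 1"
        using depth_ge[OF J fs(1)[folded edgy] fs(2)] fs(3) unfolding depth_def by simp
      from order_trans[OF this le] show False using bip by simp
    qed
  next
    assume complete: "\<forall>u v. walk True u v \<longrightarrow> E u v"
    show "\<forall>k\<ge>1. depth k = depth 1"
    proof (cases "V = {}")
      case True
      \<comment> \<open>Without vertices there is no edge to build the cocycle from; all positive
        powers are then the zero ideal.\<close>
      then have "\<not> power_mon (Suc k) m" for k m unfolding power_mon_Suc_iff using E_V by auto
      then have "mon V (power_mon (Suc k)) = (mon V (power_mon (Suc 0)) :: ('v, 'k) mpoly set)" for k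
        by (intro mon_eqI) blast
      then have "depth (Suc k) = depth (Suc 0)" for k unfolding depth_def by (rule arg_cong)
      then show ?thesis by (auto simp: Suc_le_eq gr0_conv_Suc)
    next
      case False
      then obtain a b where ab: "E a b" using E_ex by blast
      have ex: "\<exists>m. edge_prod e m" for e
        by (induction e) (use edge_prod_0 edge_prod_Suc[OF ab] in blast)+
      have "bip_roots = roots" using complete E_irrefl by (auto simp: bip_roots_def)
      have "depth (Suc e) = enat (card roots)" for e
      proof (rule antisym)
        obtain m where m: "edge_prod e m" using ex by blast
        \<comment> \<open>The vertices \<open>v\<close> and \<open>w\<close> are themselves an edge,
          so any product of \<open>e\<close> edges absorbs.\<close>
        have odd: "power_mon (Suc e) (xv v + (xv w + m))" if "walk True v w" for v w
          using complete that edge_prod_power_mon[OF m] unfolding power_mon_Suc_iff by blast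
        have "depth (Suc e) \<le> enat (card bip_roots)"
          unfolding depth_def by (rule depth_le[OF J rseq_power_length_le[OF m odd]])
        then show "depth (Suc e) \<le> enat (card roots)" using \<open>bip_roots = roots\<close> by simp
        show "enat (card roots) \<le> depth (Suc e)"
          using depth_ge[OF J rseq_power_complete[OF _ rs(1)] component_sums_maximal] complete rs(2)
          unfolding depth_def len by blast
      qed
      then show ?thesis by (auto simp: Suc_le_eq gr0_conv_Suc)
    qed
  qed
qed

end

subsection \<open>Complete bipartite components\<close>

lemma (in wf_digraph) arcs_ends_induce_subgraph:
  "arcs_ends (G \<restriction> S) = arcs_ends G \<inter> S \<times> S"
  by (auto simp: arcs_ends_conv)

lemma (in graph) adjacency_dominates:
  assumes "no_isolated_vertices G"
  shows "adjacency (verts G) (\<lambda>u v. u \<rightarrow>\<^bsub>G\<^esub> v)"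
proof
  show "v \<rightarrow>\<^bsub>G\<^esub> u" if "u \<rightarrow>\<^bsub>G\<^esub> v" for u v using arcs_ends_symmetric[OF sym_arcs that] .
  show "\<not> u \<rightarrow>\<^bsub>G\<^esub> u" for u using adj_not_same by blast
  show "\<exists>v. u \<rightarrow>\<^bsub>G\<^esub> v" if "u \<in> verts G" for u using assms that by (auto simp: no_isolated_vertices_def)
qed (auto dest: adj_in_verts)

text \<open>In a complete bipartite graph an odd walk changes sides, so its ends are adjacent.
  Conversely, if odd walks always have adjacent ends, there is no odd closed walk, since it would
  give a loop; walk parity from a vertex then yields the two parts.\<close>

lemma (in graph) complete_bipartite_components_iff:
  assumes "no_isolated_vertices G"
  shows "(\<forall>H\<in>sccs. complete_bipartite H) \<longleftrightarrow>
    (\<forall>u v. adjacency.walk (verts G) (\<lambda>u v. u \<rightarrow>\<^bsub>G\<^esub> v) True u v \<longrightarrow> u \<rightarrow>\<^bsub>G\<^esub> v)"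
proof -
  interpret adjacency "verts G" "\<lambda>u v. u \<rightarrow>\<^bsub>G\<^esub> v" by (rule adjacency_dominates[OF assms])
  have reach_walk: "\<exists>p. walk p u v" if "u \<rightarrow>\<^sup>*\<^bsub>G\<^esub> v" for u v
    using that
  proof (induction rule: reachable_induct)
    case base
    then show ?case using walk_refl by blast
  next
    case (step x y)
    then show ?case using walk_step by blast
  qed
  have walk_reach: "u \<rightarrow>\<^sup>*\<^bsub>G\<^esub> v" if "walk p u v" for p u v
    using that by (induction rule: walk.induct) (auto intro: reachable_adj_trans)
  show ?thesis
  proof (intro iffI allI impI ballI)
    fix u v assume comp: "\<forall>H\<in>sccs. complete_bipartite H" and uv: "walk True u v"
    let ?S = "{v. u \<rightarrow>\<^sup>*\<^bsub>G\<^esub> v}"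
    have u: "u \<in> verts G" using walk_V uv by blast
    have "complete_bipartite (G \<restriction> ?S)" using comp induce_reachable_is_in_sccs[OF u] by blast
    then obtain A B where AB: "?S = A \<union> B" "A \<inter> B = {}"
      "arcs_ends G \<inter> ?S \<times> ?S = A \<times> B \<union> B \<times> A"
      unfolding complete_bipartite_def complete_bipartite_digraph_def arcs_ends_induce_subgraph
      by auto
    have parity: "(x \<in> A \<longleftrightarrow> (u \<in> A) \<noteq> p)" if "walk p y x" "y = u" for p x y
      using that
    proof (induction rule: walk.induct)
      case (walk_step p y w z)
      have "w \<in> ?S" using walk_reach[OF walk_step.hyps(1)] walk_step.prems by simp
      moreover have "z \<in> ?S"
        using walk_reach[OF walk.walk_step[OF walk_step.hyps]] walk_step.prems by simp
      ultimately have "(w, z) \<in> A \<times> B \<union> B \<times> A"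
        using walk_step.hyps(2) AB(3) by blast
      then have "z \<in> A \<longleftrightarrow> w \<notin> A" using AB(2) by blast
      then show ?case using walk_step by auto
    qed simp
    have "u \<in> A \<union> B" "v \<in> A \<union> B" using AB(1) u walk_reach[OF uv] by blast+
    then have "(u, v) \<in> A \<times> B \<union> B \<times> A" using parity[OF uv] by auto
    then show "u \<rightarrow>\<^bsub>G\<^esub> v" using AB(3) by blast
  next
    fix H assume complete: "\<forall>u v. walk True u v \<longrightarrow> u \<rightarrow>\<^bsub>G\<^esub> v" and H: "H \<in> sccs"
    then obtain S where S: "S \<in> sccs_verts" "H = G \<restriction> S" unfolding sccs_conv_sccs_verts by blast
    then obtain r where r: "r \<in> S" by (auto simp: sccs_verts_def)
    have S_eq: "S = {v. conn r v}"
    proof (intro equalityI subsetI CollectI)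
      fix v assume "v \<in> S"
      then have "r \<rightarrow>\<^sup>*\<^bsub>G\<^esub> v" using S(1) r by (auto simp: sccs_verts_def)
      then show "conn r v" using reach_walk by (auto simp: conn_def)
    next
      fix v assume "v \<in> {v. conn r v}"
      then obtain p where p: "walk p r v" by (auto simp: conn_def)
      have "r \<rightarrow>\<^sup>*\<^bsub>G\<^esub> v" "v \<rightarrow>\<^sup>*\<^bsub>G\<^esub> r" using walk_reach[OF p] walk_reach[OF walk_sym[OF p]] by blast+
      then show "v \<in> S" using S(1) r unfolding sccs_verts_def by blast
    qed
    have rV: "r \<in> verts G"
      using r S_eq conn_V by blast
    let ?A = "{v. walk False r v}" and ?B = "{v. walk True r v}"
    have AB: "S = ?A \<union> ?B" unfolding S_eq by (auto simp: conn_iff)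
    have disj: "?A \<inter> ?B = {}"
    proof -
      have False if "walk False r v" "walk True r v" for v
      proof -
        have "walk True v v" using walk_trans[OF that(2) walk_sym[OF that(1)]] by simp
        then show False using complete E_irrefl by blast
      qed
      then show ?thesis by blast
    qed
    have ends: "arcs_ends H = ?A \<times> ?B \<union> ?B \<times> ?A"
    proof -
      have sub_ends: "(a, b) \<in> ?A \<times> ?B \<union> ?B \<times> ?A" if ab: "a \<rightarrow>\<^bsub>G\<^esub> b" "a \<in> S" for a b
      proof -
        have "walk False r a \<or> walk True r a" using ab(2) AB by blast
        then show ?thesis using walk_step[OF _ ab(1), of _ r] by fastforce
      qed
      have ends_sub: "a \<rightarrow>\<^bsub>G\<^esub> b" if "(a, b) \<in> ?A \<times> ?B \<union> ?B \<times> ?A" for a b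
      proof -
        have "walk True a b"
          using that walk_trans[of True r b False a, OF _ walk_sym] walk_trans[of False r b True a, OF _ walk_sym]
          by auto
        then show ?thesis using complete by blast
      qed
      have "arcs_ends H = arcs_ends G \<inter> S \<times> S" unfolding S(2) by (rule arcs_ends_induce_subgraph)
      moreover have "?A \<times> ?B \<union> ?B \<times> ?A \<subseteq> S \<times> S" using AB by blast
      moreover have "arcs_ends G \<inter> S \<times> S \<subseteq> ?A \<times> ?B \<union> ?B \<times> ?A"
      proof
        fix x assume "x \<in> arcs_ends G \<inter> S \<times> S"
        then show "x \<in> ?A \<times> ?B \<union> ?B \<times> ?A" using sub_ends[of "fst x" "snd x"] by (cases x) simp
      qed
      moreover have "?A \<times> ?B \<union> ?B \<times> ?A \<subseteq> arcs_ends G"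
      proof
        fix x assume "x \<in> ?A \<times> ?B \<union> ?B \<times> ?A"
        then show "x \<in> arcs_ends G" using ends_sub[of "fst x" "snd x"] by (cases x) simp
      qed
      ultimately show ?thesis by blast
    qed
    have ind: "induced_subgraph H G" using in_sccs_imp_induced[OF H] .
    have "graph H"
      using digraph.graphI[OF digraphI_induced[OF ind]] induced_graph_imp_symmetric[OF sym_arcs ind] .
    moreover have "verts H = ?A \<union> ?B" using S(2) AB by simp
    ultimately have "complete_bipartite_digraph (card ?A) (card ?B) H"
      unfolding complete_bipartite_digraph_def using disj ends by blast
    moreover have "finite ?A" "finite ?B"
      using finite_side[of False r] finite_side[of True r] by (simp_all add: side_def)
    moreover have "r \<in> ?A" using walk_refl rV by simp
    moreover obtain n where "n \<in> ?B" using E_ex[OF rV] walk_edge by blast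
    ultimately have "card ?A > 0" "card ?B > 0" "complete_bipartite_digraph (card ?A) (card ?B) H"
      by (auto simp: card_gt_0_iff)
    then show "complete_bipartite H" unfolding complete_bipartite_def by blast
  qed
qed

theorem theorem2p2:
  fixes G :: "('v, 'e) pre_digraph"
  assumes "graph G"
    and "no_isolated_vertices G"
  shows "constant_depth_function (verts G) (edge_ideal G :: ('v, 'k::field) mpoly set) \<longleftrightarrow>
    (\<forall>H \<in> pre_digraph.sccs G. complete_bipartite H)"
proof -
  interpret graph G by fact
  interpret adjacency "verts G" "\<lambda>u v. u \<rightarrow>\<^bsub>G\<^esub> v" by (rule adjacency_dominates[OF assms(2)])
  show ?thesis
    unfolding edge_ideal_def Idl_edges complete_bipartite_components_iff[OF assms(2)]
    by (rule constant_depth_iff)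
qed

end
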